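(* Let $(X_n)_{n\in\mathbb N}$ be random variables on $(\Omega,\mathcal F)$ that are i.i.d. under every $\mathsf P\in\mathcal P$, and suppose there is some $\delta>0$ with $$\sup_{\mathsf P\in\mathcal P}\mathbb E_{\mathsf P}\big[|X_1-\mathbb E_{\mathsf P}[X_1]|^{2+\delta}\big]<\infty\quad\text{and}\quad\inf_{\mathsf P\in\mathcal P}\mathrm{Var}_{\mathsf P}(X_1)>0 .$$ Let $\widehat\mu_n:=\frac1n\sum_{i=1}^nX_i$, $\widehat\sigma_n^2:=\frac1n\sum_{i=1}^n(X_i-\widehat\mu_n)^2$, and for $m\ge1$, $k\ge m$, $\alpha\in(0,1)$ define $$\overline p_k^{(m)}:=1-\Psi\big(k\widehat\mu_k^2/\widehat\sigma_k^2-\log(k/m)\big),\qquad \overline C_k^{(m)}(\alpha):=\widehat\mu_k\pm\widehat\sigma_k\sqrt{\frac{\Psi^{-1}(1-\alpha)+\log(k/m)}{k}} .$$ Let $\mathcal P_0:=\{\mathsf P\in\mathcal P:\mathbb E_{\mathsf P}[X_1]=0\}$, where $\mathcal P_0$ is nonempty. Then for every $\alpha\in(0,1)$, $$\lim_{m\to\infty}\sup_{\mathsf P\in\mathcal P_0}\mathsf P\big(\exists k\ge m:\overline p_k^{(m)}\le\alpha\big)=\alpha ,$$ and $$\lim_{m\to\infty}\sup_{\mathsf P\in\mathcal P}\mathsf P\big(\exists k\ge m:\mathbb E_{\mathsf P}[X_1]\notin\overline C_k^{(m)}(\alpha)\big)=\alpha .$$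
   Context: $(\Omega,\mathcal F)$ is a measurable space and $\mathcal P$ is a (nonempty) collection of probability measures on it; $\mathbb E_{\mathsf P}$ and $\mathrm{Var}_{\mathsf P}$ are expectation and variance under $\mathsf P$. The notation $a\pm b$ denotes the interval $[a-b,a+b]$. $\Phi$ and $\phi$ are the standard Gaussian CDF and density. The two-sided Robbins-Siegmund CDF is $\Psi(x)=1-2\left[1-\Phi(\sqrt x)+\sqrt x\,\phi(\sqrt x)\right]$ for $x\ge0$ and $\Psi(x)=0$ for $x<0$; it is continuous and strictly increasing from $[0,\infty)$ onto $[0,1)$, and $\Psi^{-1}:[0,1)\to[0,\infty)$ is the inverse. *)

theory Defs
  imports "HOL-Probability.Probability"
begin

definition iid :: "'a measure \<Rightarrow> (nat \<Rightarrow> 'a \<Rightarrow> real) \<Rightarrow> bool" where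
  "iid P X \<longleftrightarrow>
     prob_space.indep_vars P (\<lambda>_. borel) X {1..} \<and>
     (\<forall>n\<ge>1. distr P borel (X n) = distr P borel (X 1))"

abbreviation Phi :: "real \<Rightarrow> real" where
  "Phi \<equiv> cdf std_normal_distribution"

text \<open>The two-sided Robbins-Siegmund CDF; as a map from \<open>[0, \<infinity>)\<close> onto \<open>[0, 1)\<close> it is
  a bijection, and \<open>RS_quantile\<close> is the inverse of that restriction, hence meaningful on
  \<open>[0, 1)\<close> only.\<close>

definition RS_cdf :: "real \<Rightarrow> real" where
  "RS_cdf x =
     (if x \<ge> 0 then 1 - 2 * (1 - Phi (sqrt x) + sqrt x * std_normal_density (sqrt x)) else 0)"

definition RS_quantile :: "real \<Rightarrow> real" where
  "RS_quantile = the_inv_into {0..} RS_cdf"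

definition sample_mean :: "(nat \<Rightarrow> 'a \<Rightarrow> real) \<Rightarrow> nat \<Rightarrow> 'a \<Rightarrow> real" where
  "sample_mean X n \<omega> = (1 / real n) * (\<Sum>i=1..n. X i \<omega>)"

definition sample_var :: "(nat \<Rightarrow> 'a \<Rightarrow> real) \<Rightarrow> nat \<Rightarrow> 'a \<Rightarrow> real" where
  "sample_var X n \<omega> = (1 / real n) * (\<Sum>i=1..n. (X i \<omega> - sample_mean X n \<omega>)\<^sup>2)"

definition sample_sd :: "(nat \<Rightarrow> 'a \<Rightarrow> real) \<Rightarrow> nat \<Rightarrow> 'a \<Rightarrow> real" where
  "sample_sd X n \<omega> = sqrt (sample_var X n \<omega>)"

text \<open>Where the sample variance vanishes the studentized statistic is \<open>0\<close>, by division by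
  zero, and the p-value is \<open>1\<close>. For \<open>k \<ge> m\<close> this forces \<open>X 1, \<dots>, X m\<close> to coincide, an event
  that is negligible as \<open>m\<close> grows, uniformly under the moment and variance bounds.\<close>

definition p_value :: "(nat \<Rightarrow> 'a \<Rightarrow> real) \<Rightarrow> nat \<Rightarrow> nat \<Rightarrow> 'a \<Rightarrow> real" where
  "p_value X m k \<omega> =
     1 - RS_cdf (real k * (sample_mean X k \<omega>)\<^sup>2 / sample_var X k \<omega> - ln (real k / real m))"

definition pm_interval :: "real \<Rightarrow> real \<Rightarrow> real set" where
  "pm_interval a b = {a - b..a + b}"

definition conf_set :: "(nat \<Rightarrow> 'a \<Rightarrow> real) \<Rightarrow> nat \<Rightarrow> nat \<Rightarrow> real \<Rightarrow> 'a \<Rightarrow> real set" where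
  "conf_set X m k \<alpha> \<omega> =
     pm_interval (sample_mean X k \<omega>)
       (sample_sd X k \<omega> * sqrt ((RS_quantile (1 - \<alpha>) + ln (real k / real m)) / real k))"

end

theory Submission
  imports Defs "HOL-Real_Asymp.Real_Asymp"
begin

text \<open>
  Standardise the observations to \<open>Y i\<close>, with mean zero and variance one, and put
  \<open>S k = (\<Sum>i=1..k. Y i)\<close>, \<open>Q k = (\<Sum>i=1..k. (Y i)\<^sup>2)\<close>. With \<open>q\<close> the quantile of order \<open>1 - \<alpha>\<close> and
  \<open>b k = q + ln (k / m)\<close>, both events say that \<open>b k * Q k \<le> (S k)\<^sup>2 * (1 + b k / k)\<close> for some \<open>k \<ge> m\<close>
  (weakly or strictly, and up to vanishing sample variance). As \<open>Q k\<close> is close to \<open>k\<close>, this is the event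
  that the walk crosses the boundary \<open>(S k)\<^sup>2 = k * (q + ln (k / m))\<close>.

  That boundary is a level set. The mixture \<open>h t x = exp (x\<^sup>2 / (2 * t)) / sqrt t\<close> of Gaussian likelihood
  ratios solves the backward heat equation, so that \<open>h t (W t)\<close> is a martingale for a Brownian motion
  \<open>W\<close>, and the walk is on the boundary at time \<open>k\<close> iff \<open>h (k / m) (S k / sqrt m) = exp (q / 2)\<close>. A
  continuous path is stopped exactly at this value and otherwise sees \<open>h\<close> tend to zero, hence optional
  stopping gives the crossing probability \<open>E (min 1 (h 1 Z / exp (q / 2)))\<close> for a standard normal \<open>Z\<close>,
  and this integral is \<open>1 - RS_cdf q = \<alpha>\<close> (\<open>gauss_crossing_eq\<close>).

  For the walk the same computation is made with errors that are bounded in terms of the moment of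
  order \<open>2 + \<delta>\<close> alone. Up to a horizon \<open>T * m\<close> with fixed \<open>T\<close> a Taylor expansion of \<open>h\<close> shows that the
  stopped value loses \<open>O(m powr (-1 - \<kappa>))\<close> per step, that the overshoot is negligible, and that a
  surviving walk has a small value of \<open>h\<close> (\<open>finite_horizon\<close>). The starting value converges by the central
  limit theorem (\<open>uniform_clt\<close>). Beyond the horizon the boundary is unlikely to be reached, and
  \<open>Q k / k\<close> is likely to stay close to one for all \<open>k \<ge> m\<close>; both follow from one Hajek-Renyi inequality, applied to the martingale \<open>S\<^sup>2 - Q\<close>
  (\<open>square_minus_sum_squares_tail\<close>) and to the truncated centred squares (\<open>sum_squares_law\<close>).

  Uniformity over the probability measures is obtained by letting the measure depend on \<open>m\<close>: a
  supremum converges as soon as the probabilities converge along every sequence of measures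
  (\<open>SUP_tendsto_of_sequences\<close>), and \<open>studentized_crossing_limit\<close> is stated for such sequences.
\<close>

section \<open>Independence from the past and a Hajek-Renyi inequality\<close>

text \<open>Generated by the prefix \<open>Y 1, \<dots>, Y k\<close>, taken as one random element of a product space, so that the
  independence of disjoint blocks of a family applies to it.\<close>

definition past :: "'a measure \<Rightarrow> (nat \<Rightarrow> 'a \<Rightarrow> real) \<Rightarrow> nat \<Rightarrow> 'a measure" where
  "past P Y k =
     vimage_algebra (space P) (\<lambda>\<omega>. \<lambda>i\<in>{1..k}. Y i \<omega>) (PiM {1..k} (\<lambda>_. borel))"

locale indep_seq = prob_space P for P :: "'a measure" +
  fixes Y :: "nat \<Rightarrow> 'a \<Rightarrow> real"
  assumes indep: "indep_vars (\<lambda>_. borel) Y {1..}"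
begin

lemma Y_measurable: "1 \<le> i \<Longrightarrow> Y i \<in> borel_measurable P"
  using indep by (auto simp: indep_vars_def)

lemma space_past [simp]: "space (past P Y k) = space P"
  by (simp add: past_def)

lemma prefix_measurable:
  "(\<lambda>\<omega>. \<lambda>i\<in>{1..k}. Y i \<omega>) \<in> P \<rightarrow>\<^sub>M PiM {1..k} (\<lambda>_. borel)"
  by (rule measurable_restrict) (auto intro: Y_measurable)

lemma prefix_in_space:
  "(\<lambda>\<omega>. \<lambda>i\<in>{1..k}. Y i \<omega>) \<in> space P \<rightarrow> space (PiM {1..k} (\<lambda>_. borel))"
  using measurable_space[OF prefix_measurable] by auto

lemma sets_past_subset: "sets (past P Y k) \<subseteq> sets P"
  using prefix_measurable[of k] unfolding past_def
  by (subst sets_vimage_algebra2[OF prefix_in_space]) (auto simp: measurable_def)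

lemma past_imp_measurable: "f \<in> past P Y k \<rightarrow>\<^sub>M N \<Longrightarrow> f \<in> P \<rightarrow>\<^sub>M N"
  using sets_past_subset[of k] unfolding measurable_def by auto

lemma Y_past: "1 \<le> i \<Longrightarrow> i \<le> k \<Longrightarrow> Y i \<in> borel_measurable (past P Y k)"
proof -
  assume i: "1 \<le> i" "i \<le> k"
  have "(\<lambda>f. f i) \<circ> (\<lambda>\<omega>. \<lambda>i\<in>{1..k}. Y i \<omega>) \<in> borel_measurable (past P Y k)"
    unfolding past_def
    by (rule measurable_comp[OF measurable_vimage_algebra1[OF prefix_in_space]
          measurable_component_singleton]) (use i in auto)
  also have "(\<lambda>f. f i) \<circ> (\<lambda>\<omega>. \<lambda>i\<in>{1..k}. Y i \<omega>) = Y i"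
    using i by auto
  finally show ?thesis .
qed

lemma past_mono:
  assumes "k \<le> l" "f \<in> past P Y k \<rightarrow>\<^sub>M N"
  shows "f \<in> past P Y l \<rightarrow>\<^sub>M N"
proof -
  have "(\<lambda>\<omega>. \<lambda>i\<in>{1..k}. Y i \<omega>) \<in> past P Y l \<rightarrow>\<^sub>M PiM {1..k} (\<lambda>_. borel)"
    by (rule measurable_restrict) (use assms(1) in \<open>auto intro: Y_past\<close>)
  then have "sets (past P Y k) \<subseteq> sets (past P Y l)"
    unfolding past_def[of P Y k]
    by (subst sets_vimage_algebra2[OF prefix_in_space]) (auto simp: measurable_def)
  then show ?thesis
    using assms(2) unfolding measurable_def by auto
qed

text \<open>Events about \<open>F\<close> are events about the block of the first \<open>k\<close> variables, and this block is
  independent of the block that consists of the next variable.\<close>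

lemma indep_past:
  fixes F :: "'a \<Rightarrow> real"
  assumes "F \<in> borel_measurable (past P Y k)"
  shows "indep_var borel F borel (Y (Suc k))"
proof -
  have "indep_var (PiM {1..k} (\<lambda>_. borel)) (\<lambda>\<omega>. \<lambda>i\<in>{1..k}. Y i \<omega>)
          (PiM {Suc k} (\<lambda>_. borel)) (\<lambda>\<omega>. \<lambda>i\<in>{Suc k}. Y i \<omega>)"
    by (rule indep_var_restrict[OF indep]) auto
  then have *: "indep_set
      (sigma_sets (space P) {(\<lambda>\<omega>. \<lambda>i\<in>{1..k}. Y i \<omega>) -` A \<inter> space P |A. A \<in> sets (PiM {1..k} (\<lambda>_. borel))})
      (sigma_sets (space P) {(\<lambda>\<omega>. \<lambda>i\<in>{Suc k}. Y i \<omega>) -` A \<inter> space P |A. A \<in> sets (PiM {Suc k} (\<lambda>_. borel))})"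
    unfolding indep_var_eq by blast
  have "{Y (Suc k) -` A \<inter> space P |A. A \<in> sets borel} \<subseteq>
      {(\<lambda>\<omega>. \<lambda>i\<in>{Suc k}. Y i \<omega>) -` A \<inter> space P |A. A \<in> sets (PiM {Suc k} (\<lambda>_. borel))}"
  proof safe
    fix A :: "real set" assume A: "A \<in> sets borel"
    let ?C = "(\<lambda>f. f (Suc k)) -` A \<inter> space (PiM {Suc k} (\<lambda>_. borel))"
    have "?C \<in> sets (PiM {Suc k} (\<lambda>_. borel))"
      using A by (intro measurable_sets[where A = borel] measurable_component_singleton) simp_all
    moreover have "Y (Suc k) -` A \<inter> space P = (\<lambda>\<omega>. \<lambda>i\<in>{Suc k}. Y i \<omega>) -` ?C \<inter> space P"
      by (auto simp: space_PiM)
    ultimately show "\<exists>C. Y (Suc k) -` A \<inter> space P = (\<lambda>\<omega>. \<lambda>i\<in>{Suc k}. Y i \<omega>) -` C \<inter> space P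
        \<and> C \<in> sets (PiM {Suc k} (\<lambda>_. borel))"
      by blast
  qed
  then have present: "sigma_sets (space P) {Y (Suc k) -` A \<inter> space P |A. A \<in> sets borel} \<subseteq>
      sigma_sets (space P) {(\<lambda>\<omega>. \<lambda>i\<in>{Suc k}. Y i \<omega>) -` A \<inter> space P |A. A \<in> sets (PiM {Suc k} (\<lambda>_. borel))}"
    by (rule sigma_sets_mono')
  have "sigma_sets (space P) {F -` A \<inter> space P |A. A \<in> sets borel} \<subseteq> sets (past P Y k)"
    using sets.sigma_sets_subset[of "{F -` A \<inter> space P |A. A \<in> sets borel}" "past P Y k"]
      measurable_sets[OF assms] by auto
  also have "sets (past P Y k) = sigma_sets (space P)
      {(\<lambda>\<omega>. \<lambda>i\<in>{1..k}. Y i \<omega>) -` A \<inter> space P |A. A \<in> sets (PiM {1..k} (\<lambda>_. borel))}"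
    unfolding past_def by (simp add: sets_vimage_algebra)
  finally have "indep_set (sigma_sets (space P) {F -` A \<inter> space P |A. A \<in> sets borel})
      (sigma_sets (space P) {Y (Suc k) -` A \<inter> space P |A. A \<in> sets borel})"
    using * present unfolding indep_sets2_eq by blast
  then show ?thesis
    unfolding indep_var_eq using past_imp_measurable[OF assms] Y_measurable by auto
qed

lemma
  fixes F :: "'a \<Rightarrow> real" and g :: "real \<Rightarrow> real"
  assumes F: "F \<in> borel_measurable (past P Y k)" "integrable P F"
    and g: "g \<in> borel_measurable borel" "integrable P (\<lambda>\<omega>. g (Y (Suc k) \<omega>))"
  shows integrable_past_mult: "integrable P (\<lambda>\<omega>. F \<omega> * g (Y (Suc k) \<omega>))"
    and expectation_past_mult:
      "expectation (\<lambda>\<omega>. F \<omega> * g (Y (Suc k) \<omega>)) = expectation F * expectation (\<lambda>\<omega>. g (Y (Suc k) \<omega>))"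
proof -
  have "indep_var borel F borel (\<lambda>\<omega>. g (Y (Suc k) \<omega>))"
    using indep_var_compose[OF indep_past[OF F(1)] measurable_ident g(1)]
    by (simp add: comp_def)
  then show "integrable P (\<lambda>\<omega>. F \<omega> * g (Y (Suc k) \<omega>))"
    "expectation (\<lambda>\<omega>. F \<omega> * g (Y (Suc k) \<omega>)) = expectation F * expectation (\<lambda>\<omega>. g (Y (Suc k) \<omega>))"
    using indep_var_integrable[OF _ F(2) g(2)] indep_var_lebesgue_integral[OF _ F(2) g(2)] by auto
qed

lemma integrable_product_of_squares:
  fixes f g :: "'a \<Rightarrow> real"
  assumes [measurable]: "f \<in> borel_measurable P" "g \<in> borel_measurable P"
    and "integrable P (\<lambda>\<omega>. (f \<omega>)\<^sup>2)" "integrable P (\<lambda>\<omega>. (g \<omega>)\<^sup>2)"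
  shows "integrable P (\<lambda>\<omega>. f \<omega> * g \<omega>)"
proof (rule Bochner_Integration.integrable_bound[where f = "\<lambda>\<omega>. (f \<omega>)\<^sup>2 + (g \<omega>)\<^sup>2"])
  show "AE \<omega> in P. norm (f \<omega> * g \<omega>) \<le> norm ((f \<omega>)\<^sup>2 + (g \<omega>)\<^sup>2)"
  proof (rule AE_I2)
    fix \<omega>
    have "2 * (\<bar>f \<omega>\<bar> * \<bar>g \<omega>\<bar>) \<le> (f \<omega>)\<^sup>2 + (g \<omega>)\<^sup>2"
      using sum_squares_bound[of "\<bar>f \<omega>\<bar>" "\<bar>g \<omega>\<bar>"] by simp
    moreover have "0 \<le> \<bar>f \<omega>\<bar> * \<bar>g \<omega>\<bar>" by simp
    ultimately show "norm (f \<omega> * g \<omega>) \<le> norm ((f \<omega>)\<^sup>2 + (g \<omega>)\<^sup>2)"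
      unfolding real_norm_def abs_mult by (smt (verit) zero_le_power2)
  qed
qed (use assms in auto)

end

text \<open>Sums of centred functions of the new observation with weights known one step earlier. Constant
  weights give the walk and the sum of its truncated squares; the weights \<open>2 * S\<close> give \<open>S\<^sup>2 - Q\<close>.\<close>

locale martingale_transform = indep_seq +
  fixes W :: "nat \<Rightarrow> 'a \<Rightarrow> real" and f :: "nat \<Rightarrow> real \<Rightarrow> real"
  assumes W_past: "\<And>k. W (Suc k) \<in> borel_measurable (past P Y k)"
    and W_square: "\<And>k. integrable P (\<lambda>\<omega>. (W (Suc k) \<omega>)\<^sup>2)"
    and f_borel [measurable]: "\<And>k. f k \<in> borel_measurable borel"
    and f_square: "\<And>k. integrable P (\<lambda>\<omega>. (f (Suc k) (Y (Suc k) \<omega>))\<^sup>2)"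
    and f_centred: "\<And>k. expectation (\<lambda>\<omega>. f (Suc k) (Y (Suc k) \<omega>)) = 0"
begin

definition mart :: "nat \<Rightarrow> 'a \<Rightarrow> real" where
  "mart k \<omega> = (\<Sum>i=1..k. W i \<omega> * f i (Y i \<omega>))"

definition step_var :: "nat \<Rightarrow> real" where
  "step_var i = expectation (\<lambda>\<omega>. (W i \<omega>)\<^sup>2) * expectation (\<lambda>\<omega>. (f i (Y i \<omega>))\<^sup>2)"

lemma mart_Suc: "mart (Suc k) \<omega> = mart k \<omega> + W (Suc k) \<omega> * f (Suc k) (Y (Suc k) \<omega>)"
  by (simp add: mart_def)

lemma mart_past: "mart k \<in> borel_measurable (past P Y k)"
proof -
  have "(\<lambda>\<omega>. W i \<omega> * f i (Y i \<omega>)) \<in> borel_measurable (past P Y k)" if "i \<in> {1..k}" for i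
  proof -
    have "i = Suc (i - 1)" using that by simp
    then obtain j where j: "i = Suc j" by blast
    have [measurable]: "W i \<in> borel_measurable (past P Y k)" "Y i \<in> borel_measurable (past P Y k)"
      using past_mono[OF _ W_past[of j], of k] Y_past[of i k] that unfolding j by simp_all
    show ?thesis by measurable
  qed
  then have "(\<lambda>\<omega>. \<Sum>i=1..k. W i \<omega> * f i (Y i \<omega>)) \<in> borel_measurable (past P Y k)"
    by (rule borel_measurable_sum)
  then show ?thesis by (simp add: mart_def[abs_def])
qed

lemma mart_measurable: "mart k \<in> borel_measurable P"
  by (rule past_imp_measurable[OF mart_past])

lemma step_integrable:
  "integrable P (\<lambda>\<omega>. (W (Suc k) \<omega> * f (Suc k) (Y (Suc k) \<omega>))\<^sup>2)"
  "expectation (\<lambda>\<omega>. (W (Suc k) \<omega> * f (Suc k) (Y (Suc k) \<omega>))\<^sup>2) = step_var (Suc k)"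
proof -
  have [measurable]: "W (Suc k) \<in> borel_measurable (past P Y k)" by (rule W_past)
  have *: "(\<lambda>\<omega>. (W (Suc k) \<omega>)\<^sup>2) \<in> borel_measurable (past P Y k)" by measurable
  show "integrable P (\<lambda>\<omega>. (W (Suc k) \<omega> * f (Suc k) (Y (Suc k) \<omega>))\<^sup>2)"
    using integrable_past_mult[OF * W_square, of "\<lambda>y. (f (Suc k) y)\<^sup>2"] f_square[of k]
    by (simp add: power_mult_distrib)
  show "expectation (\<lambda>\<omega>. (W (Suc k) \<omega> * f (Suc k) (Y (Suc k) \<omega>))\<^sup>2) = step_var (Suc k)"
    using expectation_past_mult[OF * W_square, of "\<lambda>y. (f (Suc k) y)\<^sup>2"] f_square[of k]
    by (simp add: power_mult_distrib step_var_def)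
qed

lemma mart_square: "integrable P (\<lambda>\<omega>. (mart k \<omega>)\<^sup>2)"
proof (induction k)
  case 0
  then show ?case by (simp add: mart_def)
next
  case (Suc k)
  note [measurable] = mart_measurable[of k] past_imp_measurable[OF W_past[of k]] Y_measurable[of "Suc k", simplified]
  have "integrable P (\<lambda>\<omega>. mart k \<omega> * (W (Suc k) \<omega> * f (Suc k) (Y (Suc k) \<omega>)))"
    by (rule integrable_product_of_squares[OF _ _ Suc step_integrable(1)]) measurable
  then show ?case
    using Suc step_integrable(1)[of k] by (simp add: mart_Suc power2_sum mult.assoc)
qed

text \<open>The increment is orthogonal to everything that the past determines, so the conditional
  second moment of the martingale grows by the second moment of the increment.\<close>

lemma mart_square_step:
  assumes B: "B \<in> sets (past P Y k)"
  shows "expectation (\<lambda>\<omega>. indicator B \<omega> * (mart (Suc k) \<omega>)\<^sup>2)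
           \<le> expectation (\<lambda>\<omega>. indicator B \<omega> * (mart k \<omega>)\<^sup>2) + step_var (Suc k)"
proof -
  let ?D = "\<lambda>\<omega>. W (Suc k) \<omega> * f (Suc k) (Y (Suc k) \<omega>)"
  have [measurable]: "B \<in> sets P" using B sets_past_subset by auto
  note [measurable] = mart_measurable[of k] past_imp_measurable[OF W_past[of k]] Y_measurable[of "Suc k", simplified]
  have fi: "integrable P (\<lambda>\<omega>. f (Suc k) (Y (Suc k) \<omega>))"
    by (rule square_integrable_imp_integrable[OF _ f_square]) measurable
  have past_F: "(\<lambda>\<omega>. indicator B \<omega> * (mart k \<omega> * W (Suc k) \<omega>)) \<in> borel_measurable (past P Y k)"
    by (intro borel_measurable_times borel_measurable_indicator B mart_past W_past)
  have "integrable P (\<lambda>\<omega>. mart k \<omega> * W (Suc k) \<omega>)"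
    by (rule integrable_product_of_squares[OF _ _ mart_square W_square]) measurable
  from integrable_mult_indicator[OF _ this, of B]
  have int_F: "integrable P (\<lambda>\<omega>. indicator B \<omega> * (mart k \<omega> * W (Suc k) \<omega>))"
    by simp
  note cross = integrable_past_mult[OF past_F int_F f_borel fi]
    expectation_past_mult[OF past_F int_F f_borel fi]
  have I1: "integrable P (\<lambda>\<omega>. indicator B \<omega> * (mart k \<omega>)\<^sup>2)"
    using integrable_mult_indicator[OF _ mart_square[of k], of B] by simp
  have I2: "integrable P (\<lambda>\<omega>. indicator B \<omega> * (?D \<omega>)\<^sup>2)"
    using integrable_mult_indicator[OF _ step_integrable(1)[of k], of B] by simp
  have "(\<lambda>\<omega>. indicator B \<omega> * (mart (Suc k) \<omega>)\<^sup>2) =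
      (\<lambda>\<omega>. indicator B \<omega> * (mart k \<omega>)\<^sup>2 + indicator B \<omega> * (?D \<omega>)\<^sup>2 +
         2 * (indicator B \<omega> * (mart k \<omega> * W (Suc k) \<omega>) * f (Suc k) (Y (Suc k) \<omega>)))"
    by (rule ext) (simp only: mart_Suc power2_sum, algebra)
  then have "expectation (\<lambda>\<omega>. indicator B \<omega> * (mart (Suc k) \<omega>)\<^sup>2)
      = expectation (\<lambda>\<omega>. indicator B \<omega> * (mart k \<omega>)\<^sup>2) + expectation (\<lambda>\<omega>. indicator B \<omega> * (?D \<omega>)\<^sup>2)"
    using I1 I2 cross f_centred[of k] by simp
  also have "expectation (\<lambda>\<omega>. indicator B \<omega> * (?D \<omega>)\<^sup>2) \<le> expectation (\<lambda>\<omega>. (?D \<omega>)\<^sup>2)"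
    by (rule integral_mono[OF I2 step_integrable(1)]) (simp add: indicator_def)
  finally show ?thesis
    by (simp add: step_integrable(2))
qed

lemma expectation_mart_square_le: "expectation (\<lambda>\<omega>. (mart k \<omega>)\<^sup>2) \<le> (\<Sum>i=1..k. step_var i)"
proof (induction k)
  case 0
  then show ?case by (simp add: mart_def)
next
  case (Suc k)
  have "expectation (\<lambda>\<omega>. (mart (Suc k) \<omega>)\<^sup>2) =
      expectation (\<lambda>\<omega>. indicator (space P) \<omega> * (mart (Suc k) \<omega>)\<^sup>2)"
    by (intro Bochner_Integration.integral_cong) auto
  also have "\<dots> \<le> expectation (\<lambda>\<omega>. indicator (space P) \<omega> * (mart k \<omega>)\<^sup>2) + step_var (Suc k)"
    by (rule mart_square_step) (metis sets.top space_past)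
  also have "expectation (\<lambda>\<omega>. indicator (space P) \<omega> * (mart k \<omega>)\<^sup>2) = expectation (\<lambda>\<omega>. (mart k \<omega>)\<^sup>2)"
    by (intro Bochner_Integration.integral_cong) auto
  finally show ?case using Suc by simp
qed

text \<open>At each step either the weighted square has already reached the level one, which pays for
  the probability of crossing, or it is carried over to the next step at a smaller weight.\<close>

lemma hajek_renyi:
  fixes a :: "nat \<Rightarrow> real"
  assumes a_pos: "\<And>k. n \<le> k \<Longrightarrow> 0 < a k"
    and a_mono: "\<And>k. n \<le> k \<Longrightarrow> a k \<le> a (Suc k)"
    and bound: "\<And>N. (\<Sum>i=1..n. step_var i) / (a n)\<^sup>2 + (\<Sum>i\<in>{n<..N}. step_var i / (a i)\<^sup>2) \<le> C"
  shows "prob {\<omega> \<in> space P. \<exists>k\<ge>n. a k \<le> \<bar>mart k \<omega>\<bar>} \<le> C"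
proof -
  define B where "B N = {\<omega> \<in> space P. \<forall>k\<in>{n..N}. \<bar>mart k \<omega>\<bar> < a k}" for N
  have B_past: "B N \<in> sets (past P Y N)" for N
  proof -
    have "B N = {\<omega> \<in> space (past P Y N). \<forall>k\<in>{n..N}. \<bar>mart k \<omega>\<bar> < a k}"
      by (simp add: B_def)
    also have "\<dots> \<in> sets (past P Y N)"
    proof (rule sets.sets_Collect_finite_All)
      fix k assume "k \<in> {n..N}"
      then have [measurable]: "mart k \<in> borel_measurable (past P Y N)"
        using past_mono[OF _ mart_past] by simp
      show "{\<omega> \<in> space (past P Y N). \<bar>mart k \<omega>\<bar> < a k} \<in> sets (past P Y N)" by measurable
    qed simp
    finally show ?thesis .
  qed
  have B_ev [measurable]: "B N \<in> sets P" for N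
    using B_past sets_past_subset by auto
  have mart_m [measurable]: "mart k \<in> borel_measurable P" for k
    by (rule mart_measurable)
  have ind_sq: "integrable P (\<lambda>\<omega>. indicator A \<omega> * (mart k \<omega>)\<^sup>2)" if "A \<in> sets P" for A k
    using integrable_mult_indicator[OF that mart_square[of k]] by simp
  have markov: "prob (A - B' ) + expectation (\<lambda>\<omega>. indicator B' \<omega> * (mart k \<omega>)\<^sup>2) / (a k)\<^sup>2
        \<le> expectation (\<lambda>\<omega>. indicator A \<omega> * (mart k \<omega>)\<^sup>2) / (a k)\<^sup>2"
    if A: "A \<in> sets P" "B' \<in> sets P" "B' \<subseteq> A" "n \<le> k"
      and big: "\<And>\<omega>. \<omega> \<in> A - B' \<Longrightarrow> a k \<le> \<bar>mart k \<omega>\<bar>" for A B' k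
  proof -
    have ak: "0 < a k" using a_pos that(4) by simp
    have "prob (A - B') = expectation (indicator (A - B'))"
      using that by simp
    also have "\<dots> \<le> expectation (\<lambda>\<omega>. (indicator A \<omega> * (mart k \<omega>)\<^sup>2 - indicator B' \<omega> * (mart k \<omega>)\<^sup>2) / (a k)\<^sup>2)"
    proof (rule integral_mono)
      show "integrable P (indicator (A - B') :: _ \<Rightarrow> real)"
        using that by (intro integrable_real_indicator) (auto simp: less_top[symmetric])
      show "integrable P (\<lambda>\<omega>. (indicator A \<omega> * (mart k \<omega>)\<^sup>2 - indicator B' \<omega> * (mart k \<omega>)\<^sup>2) / (a k)\<^sup>2)"
        using ind_sq[OF A(1), of k] ind_sq[OF A(2), of k] by simp
      fix \<omega>
      show "indicator (A - B') \<omega> \<le> (indicator A \<omega> * (mart k \<omega>)\<^sup>2 - indicator B' \<omega> * (mart k \<omega>)\<^sup>2) / (a k)\<^sup>2"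
      proof (cases "\<omega> \<in> A - B'")
        case True
        then have "(a k)\<^sup>2 \<le> \<bar>mart k \<omega>\<bar>\<^sup>2" using big[OF True] ak by (intro power_mono) auto
        then show ?thesis using True ak by (simp add: divide_simps)
      next
        case False
        then show ?thesis using A(3) by (auto simp: indicator_def)
      qed
    qed
    also have "\<dots> = expectation (\<lambda>\<omega>. indicator A \<omega> * (mart k \<omega>)\<^sup>2) / (a k)\<^sup>2
        - expectation (\<lambda>\<omega>. indicator B' \<omega> * (mart k \<omega>)\<^sup>2) / (a k)\<^sup>2"
      using ind_sq[OF A(1), of k] ind_sq[OF A(2), of k]
      by (simp add: Bochner_Integration.integral_diff diff_divide_distrib)
    finally show ?thesis by simp
  qed
  have main: "prob (space P - B N) + expectation (\<lambda>\<omega>. indicator (B N) \<omega> * (mart N \<omega>)\<^sup>2) / (a N)\<^sup>2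
      \<le> (\<Sum>i=1..n. step_var i) / (a n)\<^sup>2 + (\<Sum>i\<in>{n<..N}. step_var i / (a i)\<^sup>2)" if "n \<le> N" for N
    using that
  proof (induction N rule: dec_induct)
    case base
    have "prob (space P - B n) + expectation (\<lambda>\<omega>. indicator (B n) \<omega> * (mart n \<omega>)\<^sup>2) / (a n)\<^sup>2
        \<le> expectation (\<lambda>\<omega>. indicator (space P) \<omega> * (mart n \<omega>)\<^sup>2) / (a n)\<^sup>2"
      by (rule markov) (auto simp: B_def[of n])
    also have "expectation (\<lambda>\<omega>. indicator (space P) \<omega> * (mart n \<omega>)\<^sup>2) = expectation (\<lambda>\<omega>. (mart n \<omega>)\<^sup>2)"
      by (intro Bochner_Integration.integral_cong) auto
    also have "\<dots> / (a n)\<^sup>2 \<le> (\<Sum>i=1..n. step_var i) / (a n)\<^sup>2"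
      by (intro divide_right_mono expectation_mart_square_le) simp
    finally show ?case by simp
  next
    case (step N)
    have aN: "0 < a N" "a N \<le> a (Suc N)" using a_pos a_mono step by auto
    have sub: "B (Suc N) \<subseteq> B N" by (auto simp: B_def)
    have "prob (space P - B (Suc N)) = prob ((space P - B N) \<union> (B N - B (Suc N)))"
      using sub sets.sets_into_space[OF B_ev] by (intro arg_cong[where f=prob]) auto
    also have "\<dots> = prob (space P - B N) + prob (B N - B (Suc N))"
      by (rule finite_measure_Union) auto
    finally have split: "prob (space P - B (Suc N)) = \<dots>" .
    have "prob (B N - B (Suc N)) + expectation (\<lambda>\<omega>. indicator (B (Suc N)) \<omega> * (mart (Suc N) \<omega>)\<^sup>2) / (a (Suc N))\<^sup>2
        \<le> expectation (\<lambda>\<omega>. indicator (B N) \<omega> * (mart (Suc N) \<omega>)\<^sup>2) / (a (Suc N))\<^sup>2"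
    proof (rule markov)
      fix \<omega> assume "\<omega> \<in> B N - B (Suc N)"
      then show "a (Suc N) \<le> \<bar>mart (Suc N) \<omega>\<bar>" by (auto simp: B_def le_Suc_eq)
    qed (use sub step in auto)
    also have "\<dots> \<le> (expectation (\<lambda>\<omega>. indicator (B N) \<omega> * (mart N \<omega>)\<^sup>2) + step_var (Suc N)) / (a (Suc N))\<^sup>2"
      by (intro divide_right_mono mart_square_step B_past) simp
    also have "\<dots> = expectation (\<lambda>\<omega>. indicator (B N) \<omega> * (mart N \<omega>)\<^sup>2) / (a (Suc N))\<^sup>2 + step_var (Suc N) / (a (Suc N))\<^sup>2"
      by (simp add: add_divide_distrib)
    also have "expectation (\<lambda>\<omega>. indicator (B N) \<omega> * (mart N \<omega>)\<^sup>2) / (a (Suc N))\<^sup>2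
        \<le> expectation (\<lambda>\<omega>. indicator (B N) \<omega> * (mart N \<omega>)\<^sup>2) / (a N)\<^sup>2"
    proof (rule divide_left_mono)
      show "(a N)\<^sup>2 \<le> (a (Suc N))\<^sup>2" using aN by (intro power_mono) auto
      show "0 \<le> expectation (\<lambda>\<omega>. indicator (B N) \<omega> * (mart N \<omega>)\<^sup>2)"
        by (rule Bochner_Integration.integral_nonneg) auto
      show "0 < (a (Suc N))\<^sup>2 * (a N)\<^sup>2" using aN by simp
    qed
    finally have "prob (B N - B (Suc N)) + expectation (\<lambda>\<omega>. indicator (B (Suc N)) \<omega> * (mart (Suc N) \<omega>)\<^sup>2) / (a (Suc N))\<^sup>2
        \<le> expectation (\<lambda>\<omega>. indicator (B N) \<omega> * (mart N \<omega>)\<^sup>2) / (a N)\<^sup>2 + step_var (Suc N) / (a (Suc N))\<^sup>2"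
      by simp
    moreover have "{n<..Suc N} = insert (Suc N) {n<..N}" using step by auto
    ultimately show ?case using step split by simp
  qed
  have le: "prob (space P - B N) \<le> C" for N
  proof (cases "n \<le> N")
    case True
    have "0 \<le> expectation (\<lambda>\<omega>. indicator (B N) \<omega> * (mart N \<omega>)\<^sup>2) / (a N)\<^sup>2"
      by (intro divide_nonneg_nonneg Bochner_Integration.integral_nonneg) auto
    then show ?thesis using main[OF True] bound[of N] by linarith
  next
    case False
    have "B N = space P" using False by (auto simp: B_def)
    moreover have "0 \<le> C"
    proof -
      have "0 \<le> (\<Sum>i=1..n. step_var i) / (a n)\<^sup>2"
        unfolding step_var_def
        by (intro divide_nonneg_nonneg sum_nonneg mult_nonneg_nonneg Bochner_Integration.integral_nonneg) auto
      then show ?thesis using bound[of n] by simp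
    qed
    ultimately show ?thesis by simp
  qed
  have "(\<lambda>N. prob (space P - B N)) \<longlonglongrightarrow> prob (\<Union>N. space P - B N)"
    by (rule finite_Lim_measure_incseq) (auto simp: incseq_def B_def)
  then have "prob (\<Union>N. space P - B N) \<le> C"
    by (rule LIMSEQ_le_const2) (use le in auto)
  also have "(\<Union>N. space P - B N) = {\<omega> \<in> space P. \<exists>k\<ge>n. a k \<le> \<bar>mart k \<omega>\<bar>}"
    by (auto simp: B_def not_less) force
  finally show ?thesis .
qed

end

section \<open>Standardised walks and their sums of squares\<close>

text \<open>The integral test in telescoped form, for sums of \<open>i powr (-1 - \<kappa>)\<close> and of \<open>1 / (i * (ln (i / m))\<^sup>2)\<close>.\<close>

lemma sum_le_telescope:
  fixes v F :: "nat \<Rightarrow> real"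
  assumes "\<And>i. m \<le> i \<Longrightarrow> v (Suc i) \<le> F i - F (Suc i)" "m \<le> N"
  shows "(\<Sum>i\<in>{m<..N}. v i) \<le> F m - F N"
  using assms(2)
proof (induction N rule: dec_induct)
  case base
  then show ?case by simp
next
  case (step N)
  then have "{m<..Suc N} = insert (Suc N) {m<..N}" by auto
  then show ?case using step assms(1)[of N] by simp
qed

lemma inverse_Suc_le_ln_ratio:
  assumes "1 \<le> i"
  shows "1 / real (Suc i) \<le> ln (real (Suc i) / real i)"
proof -
  have "ln (real i / real (Suc i)) \<le> real i / real (Suc i) - 1"
    by (rule ln_le_minus_one) (use assms in auto)
  also have "\<dots> = - (1 / real (Suc i))" by (simp add: field_simps)
  finally show ?thesis using assms by (simp add: ln_div)
qed

lemma sum_powr_tail: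
  assumes "0 < \<kappa>" "1 \<le> m"
  shows "(\<Sum>i\<in>{m<..N}. real i powr (-1 - \<kappa>)) \<le> real m powr (-\<kappa>) / \<kappa>"
proof (cases "m \<le> N")
  case True
  have "(\<Sum>i\<in>{m<..N}. real i powr (-1 - \<kappa>))
      \<le> real m powr (-\<kappa>) / \<kappa> - real N powr (-\<kappa>) / \<kappa>"
  proof (rule sum_le_telescope[OF _ True])
    fix i assume "m \<le> i"
    then have i: "1 \<le> i" using assms by simp
    have "\<kappa> / real (Suc i) \<le> \<kappa> * ln (real (Suc i) / real i)"
      using mult_left_mono[OF inverse_Suc_le_ln_ratio[OF i], of \<kappa>] assms(1) by simp
    then have "1 + \<kappa> / real (Suc i) \<le> 1 + \<kappa> * ln (real (Suc i) / real i)" by simp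
    also have "\<dots> \<le> exp (\<kappa> * ln (real (Suc i) / real i))" by (rule exp_ge_add_one_self)
    also have "\<dots> = (real (Suc i) / real i) powr \<kappa>" using i by (simp add: powr_def)
    also have "\<dots> = real (Suc i) powr \<kappa> * real i powr (-\<kappa>)"
      using i by (simp add: powr_divide powr_minus_divide)
    finally have *: "1 + \<kappa> / real (Suc i) \<le> real (Suc i) powr \<kappa> * real i powr (-\<kappa>)" .
    have "(1 + \<kappa> / real (Suc i)) * real (Suc i) powr (-\<kappa>)
        \<le> real (Suc i) powr \<kappa> * real i powr (-\<kappa>) * real (Suc i) powr (-\<kappa>)"
      by (rule mult_right_mono[OF *]) simp
    also have "\<dots> = real i powr (-\<kappa>)" by (simp add: powr_minus field_simps)
    finally have "\<kappa> * (real (Suc i) powr (-\<kappa>) / real (Suc i)) \<le> real i powr (-\<kappa>) - real (Suc i) powr (-\<kappa>)"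
      by (simp add: algebra_simps)
    also have "real (Suc i) powr (-\<kappa>) / real (Suc i) = real (Suc i) powr (-1 - \<kappa>)"
      by (simp add: powr_diff powr_minus field_simps)
    finally show "real (Suc i) powr (-1 - \<kappa>) \<le> real i powr (-\<kappa>) / \<kappa> - real (Suc i) powr (-\<kappa>) / \<kappa>"
      using assms(1) by (simp add: field_simps)
  qed
  moreover have "0 \<le> real N powr (-\<kappa>) / \<kappa>" using assms by simp
  ultimately show ?thesis by linarith
qed (use assms in simp)

lemma sum_log_tail:
  assumes "1 \<le> m" "m < n"
  shows "(\<Sum>i\<in>{n<..N}. 1 / (real i * (ln (real i / real m))\<^sup>2)) \<le> 1 / ln (real n / real m)"
proof (cases "n \<le> N")
  case True
  have "(\<Sum>i\<in>{n<..N}. 1 / (real i * (ln (real i / real m))\<^sup>2))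
      \<le> 1 / ln (real n / real m) - 1 / ln (real N / real m)"
  proof (rule sum_le_telescope[OF _ True])
    fix i assume "n \<le> i"
    then have i: "1 \<le> i" "m < i" using assms by auto
    let ?a = "ln (real i / real m)" and ?b = "ln (real (Suc i) / real m)"
    have a: "0 < ?a" using i assms by simp
    have ab: "?b - ?a = ln (real (Suc i) / real i)" using i assms by (simp add: ln_div)
    then have d: "1 / real (Suc i) \<le> ?b - ?a" using inverse_Suc_le_ln_ratio[OF i(1)] by simp
    then have b: "?a \<le> ?b" by (smt (verit) divide_nonneg_nonneg of_nat_0_le_iff)
    have "1 / (real (Suc i) * ?b\<^sup>2) = (1 / real (Suc i)) / (?b * ?b)"
      by (simp add: power2_eq_square)
    also have "\<dots> \<le> (?b - ?a) / (?b * ?b)" by (rule divide_right_mono[OF d]) simp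
    also have "\<dots> \<le> (?b - ?a) / (?a * ?b)"
      using a b by (intro divide_left_mono mult_right_mono mult_pos_pos) auto
    also have "\<dots> = 1 / ?a - 1 / ?b" using a b by (simp add: field_simps)
    finally show "1 / (real (Suc i) * ?b\<^sup>2) \<le> 1 / ?a - 1 / ?b" .
  qed
  moreover have "0 \<le> 1 / ln (real N / real m)" using assms True by (simp add: ln_ge_zero)
  ultimately show ?thesis by linarith
qed (use assms in \<open>simp add: ln_ge_zero\<close>)

text \<open>What truncation of \<open>z\<close> at the level \<open>c\<close> costs, in units of the moment of order \<open>1 + \<kappa>\<close>: the second
  moment that is kept, the bias, and the chance of exceeding \<open>c\<close>.\<close>

lemma powr_truncation:
  fixes z c \<kappa> :: real
  assumes "0 \<le> z" "0 < c" "0 < \<kappa>" "\<kappa> \<le> 1"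
  shows "(min z c)\<^sup>2 \<le> z powr (1 + \<kappa>) * c powr (1 - \<kappa>)"
    and "z - min z c \<le> z powr (1 + \<kappa>) * c powr (-\<kappa>)"
    and "c < z \<Longrightarrow> 1 \<le> z powr (1 + \<kappa>) * c powr (-1 - \<kappa>)"
proof -
  show "(min z c)\<^sup>2 \<le> z powr (1 + \<kappa>) * c powr (1 - \<kappa>)"
  proof (cases "z = 0")
    case False
    then have pos: "0 < min z c" using assms by simp
    have "(min z c)\<^sup>2 = (min z c) powr ((1 + \<kappa>) + (1 - \<kappa>))"
      using pos by (simp add: powr_numeral)
    also have "\<dots> = (min z c) powr (1 + \<kappa>) * (min z c) powr (1 - \<kappa>)" by (rule powr_add)
    also have "\<dots> \<le> z powr (1 + \<kappa>) * c powr (1 - \<kappa>)"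
      using pos assms by (intro mult_mono powr_mono2) auto
    finally show ?thesis .
  qed (use assms in simp)
  have key: "1 \<le> z powr a * c powr (-a)" if "c < z" "0 \<le> a" for a
  proof -
    have "1 \<le> (z / c) powr a" using that assms by (intro ge_one_powr_ge_zero) auto
    also have "(z / c) powr a = z powr a * c powr (-a)"
      using assms by (simp add: powr_divide powr_minus_divide)
    finally show ?thesis .
  qed
  show "z - min z c \<le> z powr (1 + \<kappa>) * c powr (-\<kappa>)"
  proof (cases "c < z")
    case True
    have "z * 1 \<le> z * (z powr \<kappa> * c powr (-\<kappa>))"
      using key[OF True, of \<kappa>] assms by (intro mult_left_mono) auto
    also have "\<dots> = z powr (1 + \<kappa>) * c powr (-\<kappa>)"
      using True assms by (simp add: powr_add)
    finally show ?thesis using assms True by simp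
  next
    case False
    then show ?thesis by simp
  qed
  show "1 \<le> z powr (1 + \<kappa>) * c powr (-1 - \<kappa>)" if "c < z"
    using key[OF that, of "1 + \<kappa>"] assms by simp
qed

text \<open>The moment hypothesis is carried in terms of the square, of order \<open>1 + \<kappa>\<close> with
  \<open>\<kappa> = \<delta> / 2\<close>: the truncations below are applied to \<open>(Y i)\<^sup>2\<close>.\<close>

locale std_walk = indep_seq P Y for P :: "'a measure" and Y +
  fixes \<kappa> K :: real
  assumes same_distr: "\<And>i. 1 \<le> i \<Longrightarrow> distr P borel (Y i) = distr P borel (Y 1)"
    and mean: "expectation (Y 1) = 0"
    and second_moment: "expectation (\<lambda>\<omega>. (Y 1 \<omega>)\<^sup>2) = 1"
    and kappa: "0 < \<kappa>" "\<kappa> \<le> 1 / 2"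
    and moment_integrable: "integrable P (\<lambda>\<omega>. ((Y 1 \<omega>)\<^sup>2) powr (1 + \<kappa>))"
    and moment_le: "expectation (\<lambda>\<omega>. ((Y 1 \<omega>)\<^sup>2) powr (1 + \<kappa>)) \<le> K"
begin

definition S :: "nat \<Rightarrow> 'a \<Rightarrow> real" where "S k \<omega> = (\<Sum>i=1..k. Y i \<omega>)"
definition Q :: "nat \<Rightarrow> 'a \<Rightarrow> real" where "Q k \<omega> = (\<Sum>i=1..k. (Y i \<omega>)\<^sup>2)"

lemma transfer:
  fixes g :: "real \<Rightarrow> real"
  assumes [measurable]: "g \<in> borel_measurable borel" and i: "1 \<le> i"
  shows integrable_transfer: "integrable P (\<lambda>\<omega>. g (Y i \<omega>)) \<longleftrightarrow> integrable P (\<lambda>\<omega>. g (Y 1 \<omega>))"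
    and expectation_transfer: "expectation (\<lambda>\<omega>. g (Y i \<omega>)) = expectation (\<lambda>\<omega>. g (Y 1 \<omega>))"
proof -
  note [measurable] = Y_measurable[OF i] Y_measurable[of 1, simplified]
  show "integrable P (\<lambda>\<omega>. g (Y i \<omega>)) \<longleftrightarrow> integrable P (\<lambda>\<omega>. g (Y 1 \<omega>))"
    using integrable_distr_eq[of "Y i" P borel g] integrable_distr_eq[of "Y 1" P borel g]
      same_distr[OF i] by simp
  show "expectation (\<lambda>\<omega>. g (Y i \<omega>)) = expectation (\<lambda>\<omega>. g (Y 1 \<omega>))"
    using integral_distr[of "Y i" P borel g] integral_distr[of "Y 1" P borel g]
      same_distr[OF i] by simp
qed

lemma Y_square_integrable: "1 \<le> i \<Longrightarrow> integrable P (\<lambda>\<omega>. (Y i \<omega>)\<^sup>2)"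
proof -
  assume i: "1 \<le> i"
  have "integrable P (\<lambda>\<omega>. (Y 1 \<omega>)\<^sup>2)"
    using second_moment not_integrable_integral_eq by force
  then show ?thesis using integrable_transfer[of "\<lambda>y. y\<^sup>2", OF _ i] by simp
qed

lemma Y_integrable: "1 \<le> i \<Longrightarrow> integrable P (Y i)"
  by (rule square_integrable_imp_integrable[OF Y_measurable Y_square_integrable])

lemma Y_moments:
  assumes "1 \<le> i"
  shows "expectation (Y i) = 0" "expectation (\<lambda>\<omega>. (Y i \<omega>)\<^sup>2) = 1"
    "integrable P (\<lambda>\<omega>. ((Y i \<omega>)\<^sup>2) powr (1 + \<kappa>))"
    "expectation (\<lambda>\<omega>. ((Y i \<omega>)\<^sup>2) powr (1 + \<kappa>)) \<le> K"
  using expectation_transfer[of "\<lambda>y. y", OF _ assms] expectation_transfer[of "\<lambda>y. y\<^sup>2", OF _ assms]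
    expectation_transfer[of "\<lambda>y. (y\<^sup>2) powr (1 + \<kappa>)", OF _ assms]
    integrable_transfer[of "\<lambda>y. (y\<^sup>2) powr (1 + \<kappa>)", OF _ assms]
    mean second_moment moment_integrable moment_le by simp_all

lemma K_nonneg: "0 \<le> K"
  by (rule order_trans[OF Bochner_Integration.integral_nonneg moment_le]) simp

lemma S_past: "k \<le> l \<Longrightarrow> S k \<in> borel_measurable (past P Y l)"
  unfolding S_def[abs_def] by (intro borel_measurable_sum Y_past) auto

lemma Q_past: "k \<le> l \<Longrightarrow> Q k \<in> borel_measurable (past P Y l)"
  unfolding Q_def[abs_def] by (intro borel_measurable_sum borel_measurable_power Y_past) auto

lemma S_measurable [measurable]: "S k \<in> borel_measurable P"
  by (rule past_imp_measurable[OF S_past[OF order_refl]])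

lemma Q_measurable [measurable]: "Q k \<in> borel_measurable P"
  by (rule past_imp_measurable[OF Q_past[OF order_refl]])

lemma S_Suc: "S (Suc k) \<omega> = S k \<omega> + Y (Suc k) \<omega>"
  by (simp add: S_def)

lemma Q_Suc: "Q (Suc k) \<omega> = Q k \<omega> + (Y (Suc k) \<omega>)\<^sup>2"
  by (simp add: Q_def)

lemma S_second_moment:
  "integrable P (\<lambda>\<omega>. (S k \<omega>)\<^sup>2)" "expectation (\<lambda>\<omega>. (S k \<omega>)\<^sup>2) \<le> real k"
proof -
  interpret MT: martingale_transform P Y "\<lambda>_ _. 1" "\<lambda>_ y. y"
    by unfold_locales (auto simp: Y_square_integrable Y_moments)
  have eq: "MT.mart k = S k"
    by (simp add: MT.mart_def S_def fun_eq_iff)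
  have v: "MT.step_var i = 1" if "i \<in> {1..k}" for i
    using that by (simp add: MT.step_var_def Y_moments prob_space)
  show "integrable P (\<lambda>\<omega>. (S k \<omega>)\<^sup>2)" "expectation (\<lambda>\<omega>. (S k \<omega>)\<^sup>2) \<le> real k"
    using MT.mart_square[of k] MT.expectation_mart_square_le[of k] v unfolding eq by simp_all
qed

lemma S_chebyshev:
  assumes "0 < c" "1 \<le> k"
  shows "prob {\<omega> \<in> space P. c * real k \<le> (S k \<omega>)\<^sup>2} \<le> 1 / c"
proof -
  have "prob {\<omega> \<in> space P. c * real k \<le> (S k \<omega>)\<^sup>2} \<le> expectation (\<lambda>\<omega>. (S k \<omega>)\<^sup>2) / (c * real k)"
    by (rule integral_Markov_inequality_measure[OF S_second_moment(1), of "{}"]) (use assms in auto)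
  also have "\<dots> \<le> real k / (c * real k)"
    using assms by (intro divide_right_mono S_second_moment) auto
  finally show ?thesis using assms by simp
qed

text \<open>The squares have only a moment of order \<open>1 + \<kappa> < 2\<close>, so they are truncated at the level
  \<open>max i m\<close>; after truncation the variances grow slowly enough for the maximal inequality.\<close>

lemma sum_squares_law:
  assumes m: "1 \<le> m" and \<eta>: "0 < \<eta>" and small: "K * real m powr (-\<kappa>) \<le> \<eta> / 2"
  shows "prob {\<omega> \<in> space P. \<exists>k\<ge>m. \<eta> * real k \<le> \<bar>Q k \<omega> - real k\<bar>}
           \<le> (4 / \<eta>\<^sup>2 + 1) * (K * (1 + 1 / \<kappa>) * real m powr (-\<kappa>))"
proof -
  define c where "c i = real (max i m)" for i
  have c: "0 < c i" "real m \<le> c i" for i using m by (auto simp: c_def)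
  define U where "U i y = min (y\<^sup>2) (c i)" for i and y :: real
  have U_b [measurable]: "U i \<in> borel_measurable borel" for i unfolding U_def[abs_def] by measurable
  have U_bd: "\<bar>U i y\<bar> \<le> c i" for i y using c[of i] by (auto simp: U_def)
  define \<mu> where "\<mu> i = expectation (\<lambda>\<omega>. U i (Y i \<omega>))" for i
  have int_U: "integrable P (\<lambda>\<omega>. U i (Y i \<omega>))" "integrable P (\<lambda>\<omega>. (U i (Y i \<omega>))\<^sup>2)" if "1 \<le> i" for i
  proof -
    note [measurable] = Y_measurable[OF that]
    show "integrable P (\<lambda>\<omega>. U i (Y i \<omega>))"
      by (rule integrable_const_bound[where B = "c i"]) (use U_bd in auto)
    show "integrable P (\<lambda>\<omega>. (U i (Y i \<omega>))\<^sup>2)"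
      by (rule integrable_const_bound[where B = "(c i)\<^sup>2"])
        (use U_bd c in \<open>auto intro!: power_mono simp: abs_le_square_iff[symmetric] less_imp_le\<close>)
  qed
  have \<kappa>1: "\<kappa> \<le> 1" using kappa by simp
  have \<mu>: "\<bar>\<mu> i - 1\<bar> \<le> K * real m powr (-\<kappa>)" if i: "1 \<le> i" for i
  proof -
    have "1 - \<mu> i = expectation (\<lambda>\<omega>. (Y i \<omega>)\<^sup>2 - U i (Y i \<omega>))"
      using int_U[OF i] Y_square_integrable[OF i] Y_moments(2)[OF i] by (simp add: \<mu>_def)
    moreover have "0 \<le> expectation (\<lambda>\<omega>. (Y i \<omega>)\<^sup>2 - U i (Y i \<omega>))"
      by (rule Bochner_Integration.integral_nonneg) (simp add: U_def)
    moreover have "expectation (\<lambda>\<omega>. (Y i \<omega>)\<^sup>2 - U i (Y i \<omega>))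
        \<le> expectation (\<lambda>\<omega>. ((Y i \<omega>)\<^sup>2) powr (1 + \<kappa>) * c i powr (-\<kappa>))"
      by (rule integral_mono)
        (use int_U[OF i] Y_square_integrable[OF i] Y_moments(3)[OF i] powr_truncation(2)[OF _ c(1) kappa(1) \<kappa>1]
          in \<open>auto simp: U_def\<close>)
    moreover have "\<dots> \<le> K * c i powr (-\<kappa>)"
      using Y_moments(4)[OF i] by (simp add: mult_right_mono)
    moreover have "c i powr (-\<kappa>) \<le> real m powr (-\<kappa>)"
      using m c[of i] kappa by (intro powr_mono2') auto
    then have "K * c i powr (-\<kappa>) \<le> K * real m powr (-\<kappa>)"
      by (rule mult_left_mono[OF _ K_nonneg])
    ultimately show ?thesis by linarith
  qed
  interpret MT: martingale_transform P Y "\<lambda>_ _. 1" "\<lambda>i y. U i y - \<mu> i"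
  proof unfold_locales
    fix k
    have "integrable P (\<lambda>\<omega>. (U (Suc k) (Y (Suc k) \<omega>))\<^sup>2 - 2 * U (Suc k) (Y (Suc k) \<omega>) * \<mu> (Suc k) + (\<mu> (Suc k))\<^sup>2)"
      using int_U[of "Suc k"] by simp
    then show "integrable P (\<lambda>\<omega>. (U (Suc k) (Y (Suc k) \<omega>) - \<mu> (Suc k))\<^sup>2)"
      by (simp add: power2_diff algebra_simps)
    show "expectation (\<lambda>\<omega>. U (Suc k) (Y (Suc k) \<omega>) - \<mu> (Suc k)) = 0"
      using int_U[of "Suc k"] by (simp add: \<mu>_def prob_space)
  qed auto
  have v: "MT.step_var i \<le> K * c i powr (1 - \<kappa>)" if i: "1 \<le> i" for i
  proof -
    have "MT.step_var i = variance (\<lambda>\<omega>. U i (Y i \<omega>))"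
      by (simp only: MT.step_var_def) (simp add: \<mu>_def prob_space)
    also have "\<dots> = expectation (\<lambda>\<omega>. (U i (Y i \<omega>))\<^sup>2) - (\<mu> i)\<^sup>2"
      unfolding \<mu>_def by (rule variance_eq) (use int_U[OF i] in auto)
    also have "\<dots> \<le> expectation (\<lambda>\<omega>. (U i (Y i \<omega>))\<^sup>2)" by simp
    also have "\<dots> \<le> expectation (\<lambda>\<omega>. ((Y i \<omega>)\<^sup>2) powr (1 + \<kappa>) * c i powr (1 - \<kappa>))"
      by (rule integral_mono)
        (use int_U[OF i] Y_moments(3)[OF i] powr_truncation(1)[OF _ c(1) kappa(1) \<kappa>1] in \<open>auto simp: U_def\<close>)
    also have "\<dots> \<le> K * c i powr (1 - \<kappa>)"
      using Y_moments(4)[OF i] by (simp add: mult_right_mono)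
    finally show ?thesis .
  qed
  let ?R = "K * (1 + 1 / \<kappa>) * real m powr (-\<kappa>)"
  have m0: "0 < real m" using m by simp
  have tail: "(\<Sum>i\<in>{m<..N}. K * real i powr (-1 - \<kappa>)) \<le> K * (real m powr (-\<kappa>) / \<kappa>)" for N
    unfolding sum_distrib_left[symmetric]
    by (rule mult_left_mono[OF sum_powr_tail[OF kappa(1) m] K_nonneg])
  have head: "real m * (K * real m powr (-1 - \<kappa>)) = K * real m powr (-\<kappa>)"
    using m0 by (simp add: powr_diff powr_minus field_simps)
  have R: "K * real m powr (-\<kappa>) + K * (real m powr (-\<kappa>) / \<kappa>) = ?R"
    by (simp add: algebra_simps)
  have fluct: "prob {\<omega> \<in> space P. \<exists>k\<ge>m. \<eta> / 2 * real k \<le> \<bar>MT.mart k \<omega>\<bar>} \<le> 4 / \<eta>\<^sup>2 * ?R"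
  proof (rule MT.hajek_renyi)
    fix N
    have "(\<Sum>i=1..m. MT.step_var i) \<le> (\<Sum>i=1..m. K * real m powr (1 - \<kappa>))"
    proof (rule sum_mono)
      fix i assume "i \<in> {1..m}"
      then have "1 \<le> i" "c i = real m" by (auto simp: c_def)
      then show "MT.step_var i \<le> K * real m powr (1 - \<kappa>)" using v[of i] by simp
    qed
    also have "\<dots> = real m * (K * real m powr (1 - \<kappa>))" by simp
    finally have "(\<Sum>i=1..m. MT.step_var i) / (\<eta> / 2 * real m)\<^sup>2
        \<le> real m * (K * real m powr (1 - \<kappa>)) / (\<eta> / 2 * real m)\<^sup>2"
      by (rule divide_right_mono) simp
    also have "\<dots> = 4 / \<eta>\<^sup>2 * (K * real m powr (-\<kappa>))"
    proof -
      have "real m powr (1 - \<kappa>) = real m * real m powr (-\<kappa>)" using m0 by (simp add: powr_diff powr_minus field_simps)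
      then show ?thesis using m0 \<eta> by (simp add: power2_eq_square field_simps)
    qed
    finally have 1: "(\<Sum>i=1..m. MT.step_var i) / (\<eta> / 2 * real m)\<^sup>2 \<le> 4 / \<eta>\<^sup>2 * (K * real m powr (-\<kappa>))" .
    have "(\<Sum>i\<in>{m<..N}. MT.step_var i / (\<eta> / 2 * real i)\<^sup>2)
        \<le> (\<Sum>i\<in>{m<..N}. 4 / \<eta>\<^sup>2 * (K * real i powr (-1 - \<kappa>)))"
    proof (rule sum_mono)
      fix i assume "i \<in> {m<..N}"
      then have i: "1 \<le> i" "c i = real i" "0 < real i" using m by (auto simp: c_def)
      have "MT.step_var i / (\<eta> / 2 * real i)\<^sup>2 \<le> K * real i powr (1 - \<kappa>) / (\<eta> / 2 * real i)\<^sup>2"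
        using v[OF i(1)] i(2) by (intro divide_right_mono) auto
      also have "\<dots> = 4 / \<eta>\<^sup>2 * (K * real i powr (-1 - \<kappa>))"
      proof -
        have "real i powr (1 - \<kappa>) = real i powr (2 + (-1 - \<kappa>))" by simp
        also have "\<dots> = (real i)\<^sup>2 * real i powr (-1 - \<kappa>)"
          unfolding powr_add using i by (simp add: powr_numeral)
        finally show ?thesis using i \<eta> by (simp add: power_mult_distrib power_divide field_simps)
      qed
      finally show "MT.step_var i / (\<eta> / 2 * real i)\<^sup>2 \<le> \<dots>" .
    qed
    also have "\<dots> = 4 / \<eta>\<^sup>2 * (\<Sum>i\<in>{m<..N}. K * real i powr (-1 - \<kappa>))"
      by (rule sum_distrib_left[symmetric])
    also have "\<dots> \<le> 4 / \<eta>\<^sup>2 * (K * (real m powr (-\<kappa>) / \<kappa>))"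
      by (rule mult_left_mono[OF tail]) simp
    finally have 2: "(\<Sum>i\<in>{m<..N}. MT.step_var i / (\<eta> / 2 * real i)\<^sup>2) \<le> \<dots>" .
    have "4 / \<eta>\<^sup>2 * (K * real m powr (-\<kappa>)) + 4 / \<eta>\<^sup>2 * (K * (real m powr (-\<kappa>) / \<kappa>)) = 4 / \<eta>\<^sup>2 * ?R"
      unfolding R[symmetric] by (rule distrib_left[symmetric])
    then show "(\<Sum>i=1..m. MT.step_var i) / (\<eta> / 2 * real m)\<^sup>2
        + (\<Sum>i\<in>{m<..N}. MT.step_var i / (\<eta> / 2 * real i)\<^sup>2) \<le> 4 / \<eta>\<^sup>2 * ?R"
      using 1 2 by linarith
  qed (use \<eta> m in auto)
  define Z where "Z i = {\<omega> \<in> space P. c i < (Y i \<omega>)\<^sup>2}" for i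
  have Z_ev [measurable]: "Z i \<in> sets P" if "1 \<le> i" for i
    unfolding Z_def using Y_measurable[OF that] by measurable
  have Zp: "prob (Z i) \<le> K * c i powr (-1 - \<kappa>)" if i: "1 \<le> i" for i
  proof -
    have "prob (Z i) = expectation (indicator (Z i))" using Z_ev[OF i] by simp
    also have "\<dots> \<le> expectation (\<lambda>\<omega>. ((Y i \<omega>)\<^sup>2) powr (1 + \<kappa>) * c i powr (-1 - \<kappa>))"
      by (rule integral_mono)
        (use Z_ev[OF i] Y_moments(3)[OF i] powr_truncation(3)[OF _ c(1) kappa(1) \<kappa>1]
          in \<open>auto simp: Z_def indicator_def less_top[symmetric]\<close>)
    also have "\<dots> \<le> K * c i powr (-1 - \<kappa>)"
      using Y_moments(4)[OF i] by (simp add: mult_right_mono)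
    finally show ?thesis .
  qed
  have large: "prob (\<Union>i\<in>{1..}. Z i) \<le> ?R"
  proof -
    have fin: "prob (\<Union>i\<in>{1..N}. Z i) \<le> ?R" for N
    proof -
      have "prob (\<Union>i\<in>{1..N}. Z i) \<le> (\<Sum>i\<in>{1..N}. prob (Z i))"
        by (rule finite_measure_subadditive_finite) auto
      also have "\<dots> \<le> (\<Sum>i\<in>{1..N}. K * c i powr (-1 - \<kappa>))"
        by (rule sum_mono) (use Zp in auto)
      also have "\<dots> \<le> (\<Sum>i\<in>{1..m} \<union> {m<..N}. K * c i powr (-1 - \<kappa>))"
        by (rule sum_mono2) (use K_nonneg in auto)
      also have "\<dots> = (\<Sum>i\<in>{1..m}. K * c i powr (-1 - \<kappa>)) + (\<Sum>i\<in>{m<..N}. K * c i powr (-1 - \<kappa>))"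
        by (rule sum.union_disjoint) auto
      also have "(\<Sum>i\<in>{1..m}. K * c i powr (-1 - \<kappa>)) = (\<Sum>i\<in>{1..m}. K * real m powr (-1 - \<kappa>))"
        by (rule sum.cong) (auto simp: c_def max_def)
      also have "\<dots> = K * real m powr (-\<kappa>)" using head by simp
      also have "(\<Sum>i\<in>{m<..N}. K * c i powr (-1 - \<kappa>)) = (\<Sum>i\<in>{m<..N}. K * real i powr (-1 - \<kappa>))"
        by (rule sum.cong) (auto simp: c_def max_def)
      also have "\<dots> \<le> K * (real m powr (-\<kappa>) / \<kappa>)" by (rule tail)
      finally show ?thesis using R by simp
    qed
    have "(\<lambda>N. prob (\<Union>i\<in>{1..N}. Z i)) \<longlonglongrightarrow> prob (\<Union>N. \<Union>i\<in>{1..N}. Z i)"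
    proof (rule finite_Lim_measure_incseq)
      show "range (\<lambda>N. \<Union>i\<in>{1..N}. Z i) \<subseteq> sets P" by (auto intro!: sets.finite_UN)
      show "incseq (\<lambda>N. \<Union>i\<in>{1..N}. Z i)" by (intro incseq_SucI) force
    qed
    then have "prob (\<Union>N. \<Union>i\<in>{1..N}. Z i) \<le> ?R"
      by (rule LIMSEQ_le_const2) (use fin in auto)
    also have "(\<Union>N. \<Union>i\<in>{1..N}. Z i) = (\<Union>i\<in>{1..}. Z i)" by fastforce
    finally show ?thesis .
  qed
  let ?F = "{\<omega> \<in> space P. \<exists>k\<ge>m. \<eta> / 2 * real k \<le> \<bar>MT.mart k \<omega>\<bar>}"
  have F_ev: "?F \<in> sets P" using MT.mart_measurable by measurable
  have Z_all: "(\<Union>i\<in>{1..}. Z i) \<in> sets P" by (intro sets.countable_UN'') auto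
  have "{\<omega> \<in> space P. \<exists>k\<ge>m. \<eta> * real k \<le> \<bar>Q k \<omega> - real k\<bar>} \<subseteq> ?F \<union> (\<Union>i\<in>{1..}. Z i)"
  proof (rule subsetI, rule ccontr)
    fix \<omega>
    assume "\<omega> \<in> {\<omega> \<in> space P. \<exists>k\<ge>m. \<eta> * real k \<le> \<bar>Q k \<omega> - real k\<bar>}"
      and out: "\<omega> \<notin> ?F \<union> (\<Union>i\<in>{1..}. Z i)"
    then obtain k where \<omega>: "\<omega> \<in> space P" and k: "m \<le> k" "\<eta> * real k \<le> \<bar>Q k \<omega> - real k\<bar>" by auto
    have M: "\<bar>MT.mart k \<omega>\<bar> < \<eta> / 2 * real k" using out \<omega> k(1) by force
    have "U i (Y i \<omega>) = (Y i \<omega>)\<^sup>2" if "i \<in> {1..k}" for i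
      using out \<omega> that by (auto simp: Z_def U_def not_less)
    then have "MT.mart k \<omega> = (\<Sum>i=1..k. (Y i \<omega>)\<^sup>2 - \<mu> i)"
      by (simp add: MT.mart_def)
    then have "Q k \<omega> - real k = MT.mart k \<omega> + (\<Sum>i=1..k. \<mu> i - 1)"
      by (simp add: Q_def sum_subtractf)
    moreover have "\<bar>\<Sum>i=1..k. \<mu> i - 1\<bar> \<le> (\<Sum>i=1..k. \<eta> / 2)"
      by (rule order_trans[OF sum_abs sum_mono]) (use \<mu> small in force)
    moreover have "(\<Sum>i=1..k. \<eta> / 2) = \<eta> / 2 * real k" by simp
    ultimately show False
      using M k(2) abs_triangle_ineq[of "MT.mart k \<omega>" "\<Sum>i=1..k. \<mu> i - 1"] by linarith
  qed
  then have "prob {\<omega> \<in> space P. \<exists>k\<ge>m. \<eta> * real k \<le> \<bar>Q k \<omega> - real k\<bar>} \<le> prob (?F \<union> (\<Union>i\<in>{1..}. Z i))"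
    by (rule finite_measure_mono[OF _ sets.Un[OF F_ev Z_all]])
  also have "\<dots> \<le> prob ?F + prob (\<Union>i\<in>{1..}. Z i)"
    by (rule measure_Un_le[OF F_ev Z_all])
  also have "\<dots> \<le> (4 / \<eta>\<^sup>2 + 1) * ?R"
    using fluct large by (simp add: distrib_right)
  finally show ?thesis .
qed

text \<open>\<open>S\<^sup>2 - Q\<close> is a martingale whose steps \<open>2 S Y\<close> need no more than second moments, so the far
  range of the boundary is out of reach with only the variance at hand.\<close>

lemma square_minus_sum_squares_tail:
  assumes m: "1 \<le> m" and T: "2 \<le> T"
  shows "prob {\<omega> \<in> space P. \<exists>k\<ge>T * m. real k * ln (real k / real m) / 8 \<le> \<bar>(S k \<omega>)\<^sup>2 - Q k \<omega>\<bar>}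
           \<le> 256 / (ln (real T))\<^sup>2 + 256 / ln (real T)"
proof -
  interpret MT: martingale_transform P Y "\<lambda>i \<omega>. 2 * S (i - 1) \<omega>" "\<lambda>_ y. y"
  proof unfold_locales
    fix k
    show "(\<lambda>\<omega>. 2 * S (Suc k - 1) \<omega>) \<in> borel_measurable (past P Y k)"
      using S_past[of k k] by simp
    show "integrable P (\<lambda>\<omega>. (2 * S (Suc k - 1) \<omega>)\<^sup>2)"
      using S_second_moment(1)[of k] by (simp add: power_mult_distrib)
  qed (auto simp: Y_square_integrable Y_moments)
  have mart: "MT.mart k \<omega> = (S k \<omega>)\<^sup>2 - Q k \<omega>" for k \<omega>
  proof (induction k)
    case 0
    show ?case by (simp only: MT.mart_def) (simp add: S_def Q_def)
  next
    case (Suc k)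
    show ?case unfolding MT.mart_Suc Suc by (simp add: S_Suc Q_Suc power2_sum)
  qed
  have v: "MT.step_var i \<le> 4 * real i" if "1 \<le> i" for i
  proof -
    have "MT.step_var i = 4 * expectation (\<lambda>\<omega>. (S (i - 1) \<omega>)\<^sup>2)"
      unfolding MT.step_var_def using that by (simp add: Y_moments power_mult_distrib)
    also have "\<dots> \<le> 4 * real (i - 1)"
      using S_second_moment(2)[of "i - 1"] by (intro mult_left_mono) auto
    also have "\<dots> \<le> 4 * real i" by simp
    finally show ?thesis .
  qed
  let ?n = "T * m" and ?a = "\<lambda>k. real k * ln (real k / real m) / 8"
  have mn: "m < ?n" "1 \<le> ?n" using m T by auto
  have lT: "0 < ln (real T)" using T by simp
  have ratio: "real ?n / real m = real T" using m by simp
  have pos: "0 < ?a k" if "?n \<le> k" for k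
  proof -
    have "m < k" using mn(1) that by (rule less_le_trans)
    then show ?thesis using m by simp
  qed
  have "prob {\<omega> \<in> space P. \<exists>k\<ge>?n. ?a k \<le> \<bar>MT.mart k \<omega>\<bar>} \<le> 256 / (ln (real T))\<^sup>2 + 256 / ln (real T)"
  proof (rule MT.hajek_renyi)
    fix k assume k: "?n \<le> k"
    with mn(1) have "m < k" by (rule less_le_trans)
    then have "0 \<le> ln (real k / real m)" "ln (real k / real m) \<le> ln (real (Suc k) / real m)"
      using m by (auto simp: divide_right_mono)
    then show "?a k \<le> ?a (Suc k)"
      by (intro divide_right_mono mult_mono) auto
  next
    fix N
    have "(\<Sum>i=1..?n. MT.step_var i) \<le> (\<Sum>i=1..?n. 4 * real ?n)"
    proof (rule sum_mono)
      fix i assume "i \<in> {1..?n}"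
      then have "1 \<le> i" "real i \<le> real ?n" by (auto simp del: of_nat_mult)
      then show "MT.step_var i \<le> 4 * real ?n" using v[of i] by linarith
    qed
    also have "\<dots> = 4 * (real ?n)\<^sup>2" by (simp add: power2_eq_square)
    finally have "(\<Sum>i=1..?n. MT.step_var i) / (?a ?n)\<^sup>2 \<le> 4 * (real ?n)\<^sup>2 / (?a ?n)\<^sup>2"
      by (rule divide_right_mono) simp
    also have "\<dots> = 256 / (ln (real T))\<^sup>2"
      unfolding ratio using mn by (simp add: power_mult_distrib power_divide del: of_nat_mult)
    finally have 1: "(\<Sum>i=1..?n. MT.step_var i) / (?a ?n)\<^sup>2 \<le> 256 / (ln (real T))\<^sup>2" .
    have "(\<Sum>i\<in>{?n<..N}. MT.step_var i / (?a i)\<^sup>2)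
        \<le> (\<Sum>i\<in>{?n<..N}. 256 * (1 / (real i * (ln (real i / real m))\<^sup>2)))"
    proof (rule sum_mono)
      fix i assume i: "i \<in> {?n<..N}"
      then have i0: "0 < real i" "1 \<le> i" by auto
      have "MT.step_var i / (?a i)\<^sup>2 \<le> 4 * real i / (?a i)\<^sup>2"
        by (rule divide_right_mono[OF v[OF i0(2)]]) simp
      also have "\<dots> = 256 * (1 / (real i * (ln (real i / real m))\<^sup>2))"
        using i0 by (simp add: power_mult_distrib power_divide) (simp add: power2_eq_square)
      finally show "MT.step_var i / (?a i)\<^sup>2 \<le> \<dots>" .
    qed
    also have "\<dots> = 256 * (\<Sum>i\<in>{?n<..N}. 1 / (real i * (ln (real i / real m))\<^sup>2))"
      by (rule sum_distrib_left[symmetric])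
    also have "\<dots> \<le> 256 * (1 / ln (real ?n / real m))"
      by (rule mult_left_mono[OF sum_log_tail[OF m mn(1)]]) simp
    finally have 2: "(\<Sum>i\<in>{?n<..N}. MT.step_var i / (?a i)\<^sup>2) \<le> 256 / ln (real T)"
      unfolding ratio by simp
    show "(\<Sum>i=1..?n. MT.step_var i) / (?a ?n)\<^sup>2 + (\<Sum>i\<in>{?n<..N}. MT.step_var i / (?a i)\<^sup>2)
        \<le> 256 / (ln (real T))\<^sup>2 + 256 / ln (real T)"
      using 1 2 by simp
  qed (use pos in auto)
  then show ?thesis unfolding mart by simp
qed

end

section \<open>The mixture likelihood ratio and its heat equation\<close>

text \<open>This is \<open>\<integral> exp (\<lambda> x - \<lambda>\<^sup>2 t / 2) d\<lambda> / sqrt (2 \<pi>)\<close>, the Gaussian likelihood ratio averaged over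
  all drifts with respect to the Lebesgue measure. It reaches \<open>exp (q / 2)\<close> exactly on the boundary
  \<open>x\<^sup>2 = t (q + ln t)\<close>.\<close>

definition mixture :: "real \<Rightarrow> real \<Rightarrow> real" where
  "mixture t x = exp (x\<^sup>2 / (2 * t) - ln t / 2)"

definition mixture1 :: "real \<Rightarrow> real \<Rightarrow> real" where
  "mixture1 t x = x / t * mixture t x"

definition mixture2 :: "real \<Rightarrow> real \<Rightarrow> real" where
  "mixture2 t x = (1 / t + x\<^sup>2 / t\<^sup>2) * mixture t x"

definition mixture3 :: "real \<Rightarrow> real \<Rightarrow> real" where
  "mixture3 t x = (3 * x / t\<^sup>2 + x ^ 3 / t ^ 3) * mixture t x"

definition mixture4 :: "real \<Rightarrow> real \<Rightarrow> real" where
  "mixture4 t x = (3 / t\<^sup>2 + 6 * x\<^sup>2 / t ^ 3 + x ^ 4 / t ^ 4) * mixture t x"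

lemma mixture_ge_iff:
  assumes "0 < t"
  shows "exp (q / 2) \<le> mixture t x \<longleftrightarrow> t * (q + ln t) \<le> x\<^sup>2"
proof -
  have "x\<^sup>2 / (2 * t) = x\<^sup>2 / t / 2" by simp
  then have "exp (q / 2) \<le> mixture t x \<longleftrightarrow> q + ln t \<le> x\<^sup>2 / t"
    unfolding mixture_def exp_le_cancel_iff by linarith
  then show ?thesis using assms by (simp add: pos_le_divide_eq mult.commute)
qed

lemma mixture_space_derivs:
  assumes "0 < t"
  shows "((\<lambda>x. mixture t x) has_real_derivative mixture1 t x) (at x)"
    and "((\<lambda>x. mixture1 t x) has_real_derivative mixture2 t x) (at x)"
    and "((\<lambda>x. mixture2 t x) has_real_derivative mixture3 t x) (at x)"
proof -
  show m: "((\<lambda>x. mixture t x) has_real_derivative mixture1 t x) (at x)"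
    unfolding mixture_def mixture1_def using assms
    by (auto intro!: derivative_eq_intros simp: field_simps power2_eq_square)
  show "((\<lambda>x. mixture1 t x) has_real_derivative mixture2 t x) (at x)"
    unfolding mixture1_def using assms
    by (auto intro!: derivative_eq_intros m simp: mixture1_def mixture2_def)
      (simp add: field_simps eval_nat_numeral)
  show "((\<lambda>x. mixture2 t x) has_real_derivative mixture3 t x) (at x)"
    unfolding mixture2_def using assms
    by (auto intro!: derivative_eq_intros m simp: mixture1_def mixture3_def)
      (simp add: field_simps eval_nat_numeral)
qed

text \<open>The backward heat equation: one time derivative is minus half of two space derivatives.\<close>

lemma mixture_time_derivs:
  assumes "0 < t"
  shows "((\<lambda>t. mixture t x) has_real_derivative - (mixture2 t x / 2)) (at t)"
    and "((\<lambda>t. - (mixture2 t x / 2)) has_real_derivative mixture4 t x / 4) (at t)"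
proof -
  show m: "((\<lambda>t. mixture t x) has_real_derivative - (mixture2 t x / 2)) (at t)"
    unfolding mixture_def mixture2_def using assms
    by (auto intro!: derivative_eq_intros simp: field_simps power2_eq_square)
  have p: "((\<lambda>t. 1 / t + x\<^sup>2 / t\<^sup>2) has_real_derivative (- 1 / t\<^sup>2 - 2 * x\<^sup>2 / t ^ 3)) (at t)"
    using assms
    by (auto intro!: derivative_eq_intros) (simp add: field_simps eval_nat_numeral)
  have "((\<lambda>t. - (mixture2 t x / 2)) has_real_derivative
      - (((- 1 / t\<^sup>2 - 2 * x\<^sup>2 / t ^ 3) * mixture t x + - (mixture2 t x / 2) * (1 / t + x\<^sup>2 / t\<^sup>2)) / 2)) (at t)"
    unfolding mixture2_def[of _ x] using DERIV_mult[OF p m]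
    by (intro DERIV_minus DERIV_cdivide) (simp add: mixture2_def)
  moreover have "- (((- 1 / t\<^sup>2 - 2 * x\<^sup>2 / t ^ 3) * mixture t x + - (mixture2 t x / 2) * (1 / t + x\<^sup>2 / t\<^sup>2)) / 2)
      = mixture4 t x / 4"
    unfolding mixture4_def mixture2_def using assms
    by (simp add: divide_simps) algebra
  ultimately show "((\<lambda>t. - (mixture2 t x / 2)) has_real_derivative mixture4 t x / 4) (at t)" by (rule DERIV_cong)
qed

lemma mixture_nonneg [simp]: "0 \<le> mixture t x" by (simp add: mixture_def)

lemma mixture_le_exp:
  assumes "1 \<le> t" "\<bar>x\<bar> \<le> R"
  shows "mixture t x \<le> exp (R\<^sup>2 / 2)"
proof -
  have "x\<^sup>2 \<le> R\<^sup>2" using assms by (metis abs_ge_zero power2_abs power_mono)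
  then have "x\<^sup>2 / (2 * t) \<le> R\<^sup>2 / 2"
    using assms by (intro frac_le) auto
  moreover have "0 \<le> ln t" using assms by (simp add: ln_ge_zero)
  ultimately show ?thesis unfolding mixture_def exp_le_cancel_iff by linarith
qed

lemma mixture_derivs_bounded:
  assumes "1 \<le> t" "\<bar>x\<bar> \<le> R" "1 \<le> R"
  shows "\<bar>mixture1 t x\<bar> \<le> 10 * R ^ 4 * exp (R\<^sup>2 / 2)"
    and "\<bar>mixture2 t x\<bar> \<le> 10 * R ^ 4 * exp (R\<^sup>2 / 2)"
    and "\<bar>mixture3 t x\<bar> \<le> 10 * R ^ 4 * exp (R\<^sup>2 / 2)"
    and "\<bar>mixture4 t x\<bar> \<le> 10 * R ^ 4 * exp (R\<^sup>2 / 2)"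
proof -
  have quot: "\<bar>x ^ j / t ^ i\<bar> \<le> R ^ 4" if "j \<le> 4" for i j
  proof -
    have "\<bar>x ^ j / t ^ i\<bar> = \<bar>x\<bar> ^ j / t ^ i" using assms by (simp add: power_abs)
    also have "\<dots> \<le> \<bar>x\<bar> ^ j / 1" using assms by (intro divide_left_mono) auto
    also have "\<dots> \<le> R ^ j" using assms by (simp add: power_mono)
    also have "\<dots> \<le> R ^ 4" using assms that by (intro power_increasing) auto
    finally show ?thesis .
  qed
  have bound: "\<bar>c * mixture t x\<bar> \<le> 10 * R ^ 4 * exp (R\<^sup>2 / 2)" if "\<bar>c\<bar> \<le> 10 * R ^ 4" for c
    unfolding abs_mult using that mixture_le_exp[OF assms(1,2)] by (intro mult_mono) auto
  have q: "\<bar>x / t\<bar> \<le> R ^ 4" "\<bar>1 / t\<bar> \<le> R ^ 4" "\<bar>x\<^sup>2 / t\<^sup>2\<bar> \<le> R ^ 4" "\<bar>x / t\<^sup>2\<bar> \<le> R ^ 4"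
    "\<bar>x ^ 3 / t ^ 3\<bar> \<le> R ^ 4" "\<bar>1 / t\<^sup>2\<bar> \<le> R ^ 4" "\<bar>x\<^sup>2 / t ^ 3\<bar> \<le> R ^ 4" "\<bar>x ^ 4 / t ^ 4\<bar> \<le> R ^ 4"
    using quot[of 1 1] quot[of 0 1] quot[of 2 2] quot[of 1 2] quot[of 3 3] quot[of 0 2] quot[of 2 3]
      quot[of 4 4] by simp_all
  show "\<bar>mixture1 t x\<bar> \<le> 10 * R ^ 4 * exp (R\<^sup>2 / 2)"
    unfolding mixture1_def by (rule bound) (use q(1) in linarith)
  show "\<bar>mixture2 t x\<bar> \<le> 10 * R ^ 4 * exp (R\<^sup>2 / 2)"
    unfolding mixture2_def by (rule bound) (use q(2,3) in linarith)
  show "\<bar>mixture3 t x\<bar> \<le> 10 * R ^ 4 * exp (R\<^sup>2 / 2)"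
    unfolding mixture3_def times_divide_eq_right[symmetric] by (rule bound) (use q(4,5) in linarith)
  have "3 / t\<^sup>2 + 6 * x\<^sup>2 / t ^ 3 + x ^ 4 / t ^ 4 = 3 * (1 / t\<^sup>2) + 6 * (x\<^sup>2 / t ^ 3) + x ^ 4 / t ^ 4"
    by simp
  then show "\<bar>mixture4 t x\<bar> \<le> 10 * R ^ 4 * exp (R\<^sup>2 / 2)"
    unfolding mixture4_def by (intro bound) (use q(6,7,8) in linarith)
qed

lemma in_segment_iff: "z \<in> closed_segment a b \<longleftrightarrow> min a b \<le> z \<and> z \<le> max a b" for a b z :: real
  by (auto simp: closed_segment_eq_real_ivl)

lemma Taylor2:
  fixes f f' f'' :: "real \<Rightarrow> real"
  assumes "\<And>z. z \<in> closed_segment a b \<Longrightarrow> (f has_real_derivative f' z) (at z)"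
    and "\<And>z. z \<in> closed_segment a b \<Longrightarrow> (f' has_real_derivative f'' z) (at z)"
    and "\<And>z. z \<in> closed_segment a b \<Longrightarrow> \<bar>f'' z\<bar> \<le> C"
  shows "\<bar>f b - f a - f' a * (b - a)\<bar> \<le> C * (b - a)\<^sup>2 / 2"
proof (cases "a = b")
  case False
  let ?d = "\<lambda>n::nat. if n = 0 then f else if n = 1 then f' else f''" 
  have "\<exists>t. (if b < a then b < t \<and> t < a else a < t \<and> t < b) \<and>
      f b = (\<Sum>m<2. ?d m a / fact m * (b - a) ^ m) + ?d 2 t / fact 2 * (b - a)\<^sup>2"
    by (rule Taylor[of 2 ?d f "min a b" "max a b" a b])
      (use assms False in \<open>auto simp: in_segment_iff less_2_cases_iff simp del: min_le_iff_disj le_max_iff_disj\<close>)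
  then obtain t where ord: "if b < a then b < t \<and> t < a else a < t \<and> t < b"
    and ex: "f b = (\<Sum>m<2. ?d m a / fact m * (b - a) ^ m) + ?d 2 t / fact 2 * (b - a) ^ 2"
    by blast
  have t: "t \<in> closed_segment a b"
    using ord by (auto simp: in_segment_iff split: if_splits)
  have eq: "f b = f a + f' a * (b - a) + f'' t / 2 * (b - a)\<^sup>2"
    using ex by (simp add: eval_nat_numeral)
  have "\<bar>f b - f a - f' a * (b - a)\<bar> = \<bar>f'' t\<bar> * (b - a)\<^sup>2 / 2"
    unfolding eq by (simp add: abs_mult)
  also have "\<dots> \<le> C * (b - a)\<^sup>2 / 2"
    using assms(3)[OF t] by (intro divide_right_mono mult_right_mono) auto
  finally show ?thesis .
qed simp

lemma Taylor3:
  fixes f f' f'' f''' :: "real \<Rightarrow> real"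
  assumes "\<And>z. z \<in> closed_segment a b \<Longrightarrow> (f has_real_derivative f' z) (at z)"
    and "\<And>z. z \<in> closed_segment a b \<Longrightarrow> (f' has_real_derivative f'' z) (at z)"
    and "\<And>z. z \<in> closed_segment a b \<Longrightarrow> (f'' has_real_derivative f''' z) (at z)"
    and "\<And>z. z \<in> closed_segment a b \<Longrightarrow> \<bar>f''' z\<bar> \<le> C"
  shows "\<bar>f b - f a - f' a * (b - a) - f'' a * (b - a)\<^sup>2 / 2\<bar> \<le> C * \<bar>b - a\<bar> ^ 3 / 6"
proof (cases "a = b")
  case False
  let ?d = "\<lambda>n::nat. if n = 0 then f else if n = 1 then f' else if n = 2 then f'' else f'''" 
  have lt3: "m < 3 \<longleftrightarrow> m = 0 \<or> m = 1 \<or> m = 2" for m :: nat by auto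
  have "\<exists>t. (if b < a then b < t \<and> t < a else a < t \<and> t < b) \<and>
      f b = (\<Sum>m<3. ?d m a / fact m * (b - a) ^ m) + ?d 3 t / fact 3 * (b - a) ^ 3"
    by (rule Taylor[of 3 ?d f "min a b" "max a b" a b])
      (use assms False in \<open>auto simp: in_segment_iff lt3 simp del: min_le_iff_disj le_max_iff_disj\<close>)
  then obtain t where ord: "if b < a then b < t \<and> t < a else a < t \<and> t < b"
    and ex: "f b = (\<Sum>m<3. ?d m a / fact m * (b - a) ^ m) + ?d 3 t / fact 3 * (b - a) ^ 3"
    by blast
  have t: "t \<in> closed_segment a b"
    using ord by (auto simp: in_segment_iff split: if_splits)
  have eq: "f b = f a + f' a * (b - a) + f'' a / 2 * (b - a)\<^sup>2 + f''' t / 6 * (b - a) ^ 3"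
    using ex by (simp add: eval_nat_numeral)
  have "\<bar>f b - f a - f' a * (b - a) - f'' a * (b - a)\<^sup>2 / 2\<bar> = \<bar>f''' t\<bar> * \<bar>b - a\<bar> ^ 3 / 6"
    unfolding eq by (simp add: abs_mult power_abs)
  also have "\<dots> \<le> C * \<bar>b - a\<bar> ^ 3 / 6"
    using assms(4)[OF t] by (intro divide_right_mono mult_right_mono) auto
  finally show ?thesis .
qed simp

text \<open>Dominates the cap below and the derivatives of the mixture up to order four wherever
  \<open>1 \<le> t\<close> and \<open>\<bar>x\<bar> \<le> R + 1\<close>.\<close>

definition reg_const :: "real \<Rightarrow> real" where
  "reg_const R = 10 * (R + 1) ^ 4 * exp ((R + 1)\<^sup>2 / 2)"

text \<open>Time is expanded to first order and space to second order. By the heat equation the two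
  surviving terms combine to \<open>(y\<^sup>2 - s) / 2\<close>, which has mean zero for an increment \<open>y\<close> of variance \<open>s\<close>.\<close>

lemma mixture_Taylor:
  assumes t: "1 \<le> t" and x: "\<bar>x\<bar> \<le> R" and s: "0 \<le> s" and y: "\<bar>y\<bar> \<le> 1"
  shows "\<bar>mixture (t + s) (x + y) - mixture t x - mixture1 t x * y - mixture2 t x * ((y\<^sup>2 - s) / 2)\<bar>
           \<le> reg_const R * (s\<^sup>2 + s * \<bar>y\<bar> + \<bar>y\<bar> ^ 3)"
proof -
  let ?B = "reg_const R"
  have R: "1 \<le> R + 1" "\<bar>x + y\<bar> \<le> R + 1" using x y by linarith+
  have seg: "\<bar>z\<bar> \<le> R + 1" if "z \<in> closed_segment x (x + y)" for z
    using that x y by (auto simp: closed_segment_eq_real_ivl split: if_splits)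
  have B: "0 \<le> ?B" using R by (simp add: reg_const_def)
  have t0: "0 < t" using t by simp
  have "\<bar>mixture (t + s) (x + y) - mixture t (x + y) - - (mixture2 t (x + y) / 2) * ((t + s) - t)\<bar>
      \<le> ?B * ((t + s) - t)\<^sup>2 / 2"
  proof (rule Taylor2[where f'' = "\<lambda>z. mixture4 z (x + y) / 4"])
    fix z assume "z \<in> closed_segment t (t + s)"
    then have z: "1 \<le> z" using t s by (simp add: closed_segment_eq_real_ivl)
    then show "((\<lambda>t. mixture t (x + y)) has_real_derivative - (mixture2 z (x + y) / 2)) (at z)"
      "((\<lambda>t. - (mixture2 t (x + y) / 2)) has_real_derivative mixture4 z (x + y) / 4) (at z)"
      using mixture_time_derivs[of z] by auto
    show "\<bar>mixture4 z (x + y) / 4\<bar> \<le> ?B"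
      using mixture_derivs_bounded(4)[OF z R(2,1)] by (simp add: reg_const_def)
  qed
  then have 1: "\<bar>mixture (t + s) (x + y) - mixture t (x + y) + s / 2 * mixture2 t (x + y)\<bar> \<le> ?B * s\<^sup>2"
    using mult_nonneg_nonneg[OF B zero_le_power2[of s]] by (simp add: mult.commute)
  have "\<bar>mixture2 t (x + y) - mixture2 t x\<bar> \<le> ?B * \<bar>(x + y) - x\<bar>"
    using field_differentiable_bound[of "closed_segment x (x + y)" "mixture2 t" "mixture3 t" ?B "x + y" x]
      mixture_space_derivs(3)[OF t0] mixture_derivs_bounded(3)[OF t seg R(1)]
    by (auto simp: reg_const_def intro: has_field_derivative_at_within)
  then have "\<bar>s / 2 * (mixture2 t (x + y) - mixture2 t x)\<bar> \<le> s / 2 * (?B * \<bar>y\<bar>)"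
    unfolding abs_mult using s by (intro mult_mono) auto
  also have "\<dots> \<le> ?B * (s * \<bar>y\<bar>)"
    using mult_nonneg_nonneg[OF B mult_nonneg_nonneg[OF s abs_ge_zero[of y]]]
    by (simp add: mult_ac)
  finally have 2: "\<bar>s / 2 * (mixture2 t (x + y) - mixture2 t x)\<bar> \<le> ?B * (s * \<bar>y\<bar>)" .
  have "\<bar>mixture t (x + y) - mixture t x - mixture1 t x * ((x + y) - x) - mixture2 t x * ((x + y) - x)\<^sup>2 / 2\<bar>
      \<le> ?B * \<bar>(x + y) - x\<bar> ^ 3 / 6"
    by (rule Taylor3[where f''' = "mixture3 t"])
      (use mixture_space_derivs[OF t0] mixture_derivs_bounded(3)[OF t seg R(1)] in \<open>auto simp: reg_const_def\<close>)
  also have "\<dots> \<le> ?B * \<bar>(x + y) - x\<bar> ^ 3"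
    using mult_nonneg_nonneg[OF B zero_le_power[OF abs_ge_zero[of y], of 3]] by simp
  finally have 3: "\<bar>mixture t (x + y) - mixture t x - mixture1 t x * y - mixture2 t x * y\<^sup>2 / 2\<bar> \<le> ?B * \<bar>y\<bar> ^ 3"
    by simp
  have "mixture (t + s) (x + y) - mixture t x - mixture1 t x * y - mixture2 t x * ((y\<^sup>2 - s) / 2)
      = (mixture (t + s) (x + y) - mixture t (x + y) + s / 2 * mixture2 t (x + y))
        - s / 2 * (mixture2 t (x + y) - mixture2 t x)
        + (mixture t (x + y) - mixture t x - mixture1 t x * y - mixture2 t x * y\<^sup>2 / 2)"
    by (simp add: algebra_simps diff_divide_distrib)
  moreover have "?B * (s\<^sup>2 + s * \<bar>y\<bar> + \<bar>y\<bar> ^ 3) = ?B * s\<^sup>2 + ?B * (s * \<bar>y\<bar>) + ?B * \<bar>y\<bar> ^ 3"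
    by (simp add: algebra_simps)
  ultimately show ?thesis using 1 2 3 by linarith
qed

text \<open>Capping keeps a single large increment from being amplified by the exponential growth.
  The cap lies above all values taken on \<open>\<bar>x\<bar> \<le> R + 1\<close>, hence the expansion around a point of
  \<open>\<bar>x\<bar> \<le> R\<close> is that of the uncapped function, up to a multiple of \<open>\<bar>y\<bar> powr (2 + 2 * \<kappa>)\<close>.\<close>

definition capped :: "real \<Rightarrow> real \<Rightarrow> real \<Rightarrow> real" where
  "capped R t x = min (mixture t x) (exp ((R + 1)\<^sup>2 / 2))"

lemma capped_eq: "1 \<le> t \<Longrightarrow> \<bar>x\<bar> \<le> R + 1 \<Longrightarrow> capped R t x = mixture t x"
  using mixture_le_exp by (simp add: capped_def min_absorb1)

lemma capped_bounds: "0 \<le> capped R t x" "capped R t x \<le> exp ((R + 1)\<^sup>2 / 2)"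
  by (simp_all add: capped_def)

lemma capped_measurable [measurable]: "capped R t \<in> borel_measurable borel"
  unfolding capped_def[abs_def] mixture_def[abs_def] by measurable

lemma exp_le_reg_const:
  assumes "0 \<le> R" shows "exp ((R + 1)\<^sup>2 / 2) \<le> reg_const R"
proof -
  have "1 \<le> (R + 1) ^ 4" using assms by (intro one_le_power) simp
  then have "1 \<le> 10 * (R + 1) ^ 4" by linarith
  then show ?thesis unfolding reg_const_def by simp
qed

lemma capped_Taylor:
  assumes t: "1 \<le> t" and x: "\<bar>x\<bar> \<le> R" and s: "0 \<le> s" "s \<le> 1" and \<kappa>: "0 < \<kappa>" "\<kappa> \<le> 1 / 2"
  shows "\<bar>capped R (t + s) (x + y) - capped R t x - mixture1 t x * y - mixture2 t x * ((y\<^sup>2 - s) / 2)\<bar>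
           \<le> 3 * reg_const R * (s\<^sup>2 + s * \<bar>y\<bar> + (y\<^sup>2) powr (1 + \<kappa>))"
proof -
  let ?B = "reg_const R" and ?p = "(y\<^sup>2) powr (1 + \<kappa>)"
  have R0: "0 \<le> R" using x by linarith
  have B: "0 \<le> ?B" using R0 by (simp add: reg_const_def)
  show ?thesis
  proof (cases "\<bar>y\<bar> \<le> 1")
    case True
    have "\<bar>y\<bar> ^ 3 \<le> ?p"
    proof (cases "y = 0")
      case False
      have "\<bar>y\<bar> ^ 3 = \<bar>y\<bar> powr 3" using False by (simp add: powr_numeral)
      also have "\<dots> \<le> \<bar>y\<bar> powr (2 * (1 + \<kappa>))"
        using True \<kappa> by (intro powr_mono') auto
      also have "\<dots> = (\<bar>y\<bar> powr 2) powr (1 + \<kappa>)" by (rule powr_powr[symmetric])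
      also have "\<bar>y\<bar> powr 2 = y\<^sup>2" using False by (simp add: powr_numeral)
      finally show ?thesis .
    qed simp
    then have "?B * (s\<^sup>2 + s * \<bar>y\<bar> + \<bar>y\<bar> ^ 3) \<le> 3 * ?B * (s\<^sup>2 + s * \<bar>y\<bar> + ?p)"
      using B s by (intro mult_mono) auto
    moreover have "capped R (t + s) (x + y) = mixture (t + s) (x + y)" "capped R t x = mixture t x"
      using t s x True by (auto intro!: capped_eq)
    ultimately show ?thesis using mixture_Taylor[OF t x s(1) True] by simp
  next
    case False
    then have y1: "1 < \<bar>y\<bar>" by simp
    have yy: "\<bar>y\<bar> \<le> y\<^sup>2" "1 \<le> y\<^sup>2"
      using mult_left_mono[of 1 "\<bar>y\<bar>" "\<bar>y\<bar>"] y1 by (simp_all add: power2_eq_square abs_mult_self_eq)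
    have "y\<^sup>2 powr 1 \<le> ?p" using yy \<kappa> by (intro powr_mono) auto
    then have p: "y\<^sup>2 \<le> ?p" using yy by simp
    have xR: "\<bar>x\<bar> \<le> R + 1" "1 \<le> R + 1" using x R0 by auto
    have c: "\<bar>capped R (t + s) (x + y) - capped R t x\<bar> \<le> ?B"
      using capped_bounds[of R "t + s" "x + y"] capped_bounds[of R t x] exp_le_reg_const[OF R0] by linarith
    have "\<bar>mixture1 t x * y\<bar> \<le> ?B * \<bar>y\<bar>"
      unfolding abs_mult using mixture_derivs_bounded(1)[OF t xR] 
      by (intro mult_right_mono) (auto simp: reg_const_def)
    moreover have "\<bar>mixture2 t x * ((y\<^sup>2 - s) / 2)\<bar> \<le> ?B * y\<^sup>2"
      unfolding abs_mult using mixture_derivs_bounded(2)[OF t xR] yy s B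
      by (intro mult_mono) (auto simp: reg_const_def)
    moreover have "?B * \<bar>y\<bar> \<le> ?B * ?p" "?B * y\<^sup>2 \<le> ?B * ?p" "?B * 1 \<le> ?B * ?p"
      by (rule mult_left_mono[OF _ B], use yy p in linarith)+
    moreover have "3 * ?B * ?p \<le> 3 * ?B * (s\<^sup>2 + s * \<bar>y\<bar> + ?p)"
      using B s by (intro mult_left_mono) auto
    ultimately show ?thesis using c by linarith
  qed
qed

text \<open>An increment of size at most \<open>\<epsilon>\<close> changes the value by a multiple of \<open>\<epsilon>\<close>; a larger one is paid for
  by its moment, the value being capped.\<close>

lemma capped_overshoot:
  assumes t: "1 \<le> t" and x: "\<bar>x\<bar> \<le> R" and s: "0 \<le> s" and \<kappa>: "0 < \<kappa>"
    and \<epsilon>: "0 < \<epsilon>" "\<epsilon> \<le> 1" and c: "mixture t x \<le> c"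
  shows "capped R (t + s) (x + y) \<le> c + reg_const R * \<epsilon> + reg_const R * (y\<^sup>2) powr (1 + \<kappa>) / (\<epsilon>\<^sup>2) powr (1 + \<kappa>)"
proof -
  let ?B = "reg_const R"
  have R0: "0 \<le> R" using x by linarith
  have B: "0 \<le> ?B" using R0 by (simp add: reg_const_def)
  have c0: "0 \<le> c" using c mixture_nonneg order_trans by blast
  have nn: "0 \<le> ?B * (y\<^sup>2) powr (1 + \<kappa>) / (\<epsilon>\<^sup>2) powr (1 + \<kappa>)" using B by simp
  show ?thesis
  proof (cases "\<bar>y\<bar> \<le> \<epsilon>")
    case True
    have y1: "\<bar>y\<bar> \<le> 1" using True \<epsilon> by simp
    have seg: "\<bar>z\<bar> \<le> R + 1" if "z \<in> closed_segment x (x + y)" for z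
      using that x y1 by (auto simp: closed_segment_eq_real_ivl split: if_splits)
    have "\<bar>mixture t (x + y) - mixture t x\<bar> \<le> ?B * \<bar>(x + y) - x\<bar>"
      using field_differentiable_bound[of "closed_segment x (x + y)" "mixture t" "mixture1 t" ?B "x + y" x]
        mixture_space_derivs(1)[of t] t mixture_derivs_bounded(1)[OF t seg] R0
      by (auto simp: reg_const_def intro: has_field_derivative_at_within)
    also have "\<dots> \<le> ?B * \<epsilon>" using True B by (intro mult_left_mono) auto
    finally have "mixture t (x + y) \<le> c + ?B * \<epsilon>" using c by linarith
    moreover have "mixture (t + s) (x + y) \<le> mixture t (x + y)"
    proof -
      have "(x + y)\<^sup>2 / (2 * (t + s)) \<le> (x + y)\<^sup>2 / (2 * t)"
        using t s by (intro divide_left_mono) auto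
      moreover have "ln t \<le> ln (t + s)" using t s by simp
      ultimately show ?thesis unfolding mixture_def by simp
    qed
    ultimately show ?thesis using nn by (simp add: capped_def)
  next
    case False
    have "\<epsilon>\<^sup>2 \<le> \<bar>y\<bar>\<^sup>2" using False \<epsilon> by (intro power_mono) auto
    then have "(\<epsilon>\<^sup>2) powr (1 + \<kappa>) \<le> (y\<^sup>2) powr (1 + \<kappa>)"
      using \<kappa> by (intro powr_mono2) auto
    then have "?B * 1 \<le> ?B * ((y\<^sup>2) powr (1 + \<kappa>) / (\<epsilon>\<^sup>2) powr (1 + \<kappa>))"
      using B \<epsilon> by (intro mult_left_mono) (auto simp: divide_simps)
    moreover have "0 \<le> ?B * \<epsilon>" using B \<epsilon> by simp
    ultimately show ?thesis
      using capped_bounds(2)[of R "t + s" "x + y"] exp_le_reg_const[OF R0] c0 by simp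
  qed
qed

section \<open>Crossing the boundary within a finite horizon\<close>

text \<open>The value \<open>min 1 (mixture 1 x / exp (q / 2))\<close> of the stopped mixture at its starting time.\<close>

definition clipped :: "real \<Rightarrow> real \<Rightarrow> real" where
  "clipped q x = min 1 (exp ((x\<^sup>2 - q) / 2))"

lemma clipped_measurable [measurable]: "clipped q \<in> borel_measurable borel"
  unfolding clipped_def[abs_def] by measurable

lemma clipped_bounds: "0 \<le> clipped q x" "clipped q x \<le> 1"
  by (simp_all add: clipped_def)

locale horizon = std_walk P Y \<kappa> K for P :: "'a measure" and Y \<kappa> K +
  fixes m T :: nat and q :: real
  assumes m: "1 \<le> m" and T: "1 \<le> T" and q: "0 < q"
begin

text \<open>A walk that has not crossed before time \<open>T\<close> stays in \<open>[-R, R]\<close>.\<close>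

definition R :: real where "R = sqrt (real T * (q + ln (real T)))"

definition time :: "nat \<Rightarrow> real" where "time k = real k / real m"
definition pos :: "nat \<Rightarrow> 'a \<Rightarrow> real" where "pos k \<omega> = S k \<omega> / sqrt (real m)"
definition alive :: "nat \<Rightarrow> 'a set" where
  "alive k = {\<omega> \<in> space P. \<forall>j\<in>{m..k}. (S j \<omega>)\<^sup>2 < real j * (q + ln (real j / real m))}"
definition value_at :: "nat \<Rightarrow> 'a \<Rightarrow> real" where
  "value_at k \<omega> = capped R (time k) (pos k \<omega>)"

lemma m_pos: "0 < real m" using m by simp

lemma time_bounds: "m \<le> k \<Longrightarrow> 1 \<le> time k" "k \<le> T * m \<Longrightarrow> time k \<le> real T"
  using m by (simp_all add: time_def field_simps flip: of_nat_mult)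

lemma time_Suc: "time (Suc k) = time k + 1 / real m"
  by (simp add: time_def add_divide_distrib)

lemma pos_Suc: "pos (Suc k) \<omega> = pos k \<omega> + Y (Suc k) \<omega> / sqrt (real m)"
  by (simp add: pos_def S_Suc add_divide_distrib)

lemma R_nonneg: "0 \<le> R" and R_square: "R\<^sup>2 = real T * (q + ln (real T))"
proof -
  have "0 \<le> real T * (q + ln (real T))" using T q by (simp add: ln_ge_zero)
  then show "0 \<le> R" "R\<^sup>2 = real T * (q + ln (real T))" by (simp_all add: R_def)
qed

lemma reg_nonneg: "0 \<le> reg_const R"
  using R_nonneg by (simp add: reg_const_def)

lemma crossing_iff:
  assumes "m \<le> k"
  shows "real k * (q + ln (real k / real m)) \<le> (S k \<omega>)\<^sup>2 \<longleftrightarrow> exp (q / 2) \<le> mixture (time k) (pos k \<omega>)"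
proof -
  have "0 < time k" using time_bounds(1)[OF assms] by simp
  then have "exp (q / 2) \<le> mixture (time k) (pos k \<omega>)
      \<longleftrightarrow> time k * (q + ln (time k)) \<le> (S k \<omega>)\<^sup>2 / real m"
    by (simp add: mixture_ge_iff pos_def power_divide)
  also have "\<dots> \<longleftrightarrow> real k * (q + ln (real k / real m)) \<le> (S k \<omega>)\<^sup>2"
    using m_pos by (simp add: time_def divide_le_cancel)
  finally show ?thesis by simp
qed

lemma alive_past: "alive k \<in> sets (past P Y k)"
proof -
  have "alive k = {\<omega> \<in> space (past P Y k). \<forall>j\<in>{m..k}. (S j \<omega>)\<^sup>2 < real j * (q + ln (real j / real m))}"
    by (simp add: alive_def)
  also have "\<dots> \<in> sets (past P Y k)"
  proof (rule sets.sets_Collect_finite_All)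
    fix j assume "j \<in> {m..k}"
    then have [measurable]: "S j \<in> borel_measurable (past P Y k)" by (intro S_past) auto
    show "{\<omega> \<in> space (past P Y k). (S j \<omega>)\<^sup>2 < real j * (q + ln (real j / real m))} \<in> sets (past P Y k)"
      by measurable
  qed simp
  finally show ?thesis .
qed

lemma alive_event [measurable]: "alive k \<in> sets P"
  using alive_past sets_past_subset by blast

lemma alive_mono: "k \<le> l \<Longrightarrow> alive l \<subseteq> alive k"
  by (auto simp: alive_def)

lemma alive_below:
  assumes "\<omega> \<in> alive k" "m \<le> k" "k \<le> T * m"
  shows "\<bar>pos k \<omega>\<bar> \<le> R" "mixture (time k) (pos k \<omega>) < exp (q / 2)"
proof -
  have lt: "(S k \<omega>)\<^sup>2 < real k * (q + ln (real k / real m))" using assms by (auto simp: alive_def)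
  then show "mixture (time k) (pos k \<omega>) < exp (q / 2)"
    using crossing_iff[OF assms(2), of \<omega>] by simp
  have "(pos k \<omega>)\<^sup>2 = (S k \<omega>)\<^sup>2 / real m" by (simp add: pos_def power_divide)
  also have "\<dots> \<le> real k * (q + ln (real k / real m)) / real m"
    using lt by (intro divide_right_mono) auto
  also have "\<dots> = time k * (q + ln (time k))" by (simp add: time_def)
  also have "\<dots> \<le> real T * (q + ln (real T))"
    using time_bounds[of k] assms q T by (intro mult_mono add_left_mono) (auto simp: ln_ge_zero)
  finally have "(pos k \<omega>)\<^sup>2 \<le> R\<^sup>2" by (simp add: R_square)
  then show "\<bar>pos k \<omega>\<bar> \<le> R" using R_nonneg by (rule power2_le_imp_le[of "\<bar>pos k \<omega>\<bar>", simplified])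
qed

lemma cap_ge: "exp (q / 2) \<le> exp ((R + 1)\<^sup>2 / 2)"
proof -
  have "q \<le> 1 * (q + ln (real T))" using T by (simp add: ln_ge_zero)
  also have "\<dots> \<le> R\<^sup>2" unfolding R_square using T q by (intro mult_right_mono) (auto simp: ln_ge_zero)
  also have "\<dots> \<le> (R + 1)\<^sup>2" using R_nonneg by (intro power_mono) auto
  finally show ?thesis by simp
qed

lemma pos_measurable [measurable]: "pos k \<in> borel_measurable P"
  unfolding pos_def[abs_def] by measurable

lemma value_measurable [measurable]: "value_at k \<in> borel_measurable P"
  unfolding value_at_def[abs_def] by measurable

lemma value_bounds: "0 \<le> value_at k \<omega>" "value_at k \<omega> \<le> exp ((R + 1)\<^sup>2 / 2)"
  by (simp_all add: value_at_def capped_bounds)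

lemma value_integrable: "A \<in> sets P \<Longrightarrow> integrable P (\<lambda>\<omega>. indicator A \<omega> * value_at k \<omega>)"
  by (rule integrable_const_bound[where B = "exp ((R + 1)\<^sup>2 / 2)"])
    (use value_bounds in \<open>auto simp: indicator_def\<close>)

text \<open>The expected payoff when crossing pays \<open>exp (q / 2)\<close> and survival pays the current value
  of the mixture. For a Gaussian walk in continuous time it would be constant.\<close>

definition payoff :: "nat \<Rightarrow> real" where
  "payoff k = expectation (\<lambda>\<omega>. indicator (alive k) \<omega> * value_at k \<omega>)
     + exp (q / 2) * prob (space P - alive k)"

definition moment_bound :: real where
  "moment_bound = real m powr (-1 - \<kappa>)"

lemma scaled_moment:
  "((Y k \<omega> / sqrt (real m))\<^sup>2) powr (1 + \<kappa>) = ((Y k \<omega>)\<^sup>2) powr (1 + \<kappa>) * moment_bound"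
proof -
  have "((Y k \<omega> / sqrt (real m))\<^sup>2) powr (1 + \<kappa>) = ((Y k \<omega>)\<^sup>2) powr (1 + \<kappa>) / real m powr (1 + \<kappa>)"
    by (simp add: power_divide powr_divide)
  also have "\<dots> = ((Y k \<omega>)\<^sup>2) powr (1 + \<kappa>) * real m powr (- (1 + \<kappa>))"
    by (simp only: powr_minus divide_inverse)
  finally show ?thesis by (simp add: moment_bound_def)
qed

text \<open>On survival the drift of the value vanishes to second order: the first-order term has mean
  zero and the second-order term is balanced by the passage of time.\<close>

lemma drift_bound:
  assumes k: "m \<le> k" "k < T * m"
  shows "\<bar>expectation (\<lambda>\<omega>. indicator (alive k) \<omega> * (value_at (Suc k) \<omega> - value_at k \<omega>))\<bar>
           \<le> 3 * reg_const R * (3 + K) * moment_bound"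
proof -
  let ?y = "\<lambda>\<omega>. Y (Suc k) \<omega> / sqrt (real m)" and ?s = "1 / real m"
  let ?h1 = "\<lambda>\<omega>. indicator (alive k) \<omega> * mixture1 (time k) (pos k \<omega>)"
  let ?h2 = "\<lambda>\<omega>. indicator (alive k) \<omega> * mixture2 (time k) (pos k \<omega>)"
  note [measurable] = Y_measurable[of "Suc k", simplified]
  have kT: "k \<le> T * m" using k by simp
  have bd: "norm (?h1 \<omega>) \<le> reg_const R" "norm (?h2 \<omega>) \<le> reg_const R" for \<omega>
  proof -
    have "\<bar>mixture1 (time k) (pos k \<omega>)\<bar> \<le> reg_const R \<and> \<bar>mixture2 (time k) (pos k \<omega>)\<bar> \<le> reg_const R"
      if "\<omega> \<in> alive k"
      using mixture_derivs_bounded(1,2)[OF time_bounds(1)[OF k(1)], of "pos k \<omega>" "R + 1"]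
        alive_below(1)[OF that k(1) kT] R_nonneg by (simp add: reg_const_def)
    then show "norm (?h1 \<omega>) \<le> reg_const R" "norm (?h2 \<omega>) \<le> reg_const R"
      using reg_nonneg by (auto simp: indicator_def)
  qed
  have pos_past: "pos k \<in> borel_measurable (past P Y k)"
    unfolding pos_def[abs_def] using S_past[of k k] by measurable
  have [measurable]: "mixture1 (time k) \<in> borel_measurable borel" "mixture2 (time k) \<in> borel_measurable borel"
    unfolding mixture1_def[abs_def] mixture2_def[abs_def] mixture_def[abs_def] by measurable
  have past: "?h1 \<in> borel_measurable (past P Y k)" "?h2 \<in> borel_measurable (past P Y k)"
    using alive_past[of k] pos_past by measurable
  have int: "integrable P ?h1" "integrable P ?h2"
    by (rule integrable_const_bound[where B = "reg_const R"]; use bd in \<open>auto intro: past_imp_measurable[OF past(1)] past_imp_measurable[OF past(2)]\<close>)+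
  have y_int: "integrable P (\<lambda>\<omega>. ?y \<omega>)" "integrable P (\<lambda>\<omega>. ((?y \<omega>)\<^sup>2 - ?s) / 2)"
    using Y_integrable[of "Suc k"] Y_square_integrable[of "Suc k"] by (simp_all add: power_divide)
  have "expectation (\<lambda>\<omega>. ?y \<omega>) = 0"
    using Y_moments(1)[of "Suc k"] Y_integrable[of "Suc k"] by simp
  note y0 = this
  have c1: "integrable P (\<lambda>\<omega>. ?h1 \<omega> * ?y \<omega>)"
    by (rule integrable_past_mult[OF past(1) int(1), of "\<lambda>y. y / sqrt (real m)"]) (use y_int in auto)
  have "expectation (\<lambda>\<omega>. ?h1 \<omega> * ?y \<omega>) = expectation ?h1 * expectation ?y"
    by (rule expectation_past_mult[OF past(1) int(1), of "\<lambda>y. y / sqrt (real m)"]) (use y_int in auto)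
  then have d1: "expectation (\<lambda>\<omega>. ?h1 \<omega> * ?y \<omega>) = 0" by (simp only: y0 mult_zero_right)
  have z0: "expectation (\<lambda>\<omega>. ((?y \<omega>)\<^sup>2 - ?s) / 2) = 0"
    using Y_moments(2)[of "Suc k"] Y_square_integrable[of "Suc k"] by (simp add: power_divide prob_space)
  have c2: "integrable P (\<lambda>\<omega>. ?h2 \<omega> * (((?y \<omega>)\<^sup>2 - ?s) / 2))"
    by (rule integrable_past_mult[OF past(2) int(2), of "\<lambda>y. ((y / sqrt (real m))\<^sup>2 - ?s) / 2"])
      (use y_int in auto)
  have "expectation (\<lambda>\<omega>. ?h2 \<omega> * (((?y \<omega>)\<^sup>2 - ?s) / 2))
      = expectation ?h2 * expectation (\<lambda>\<omega>. ((?y \<omega>)\<^sup>2 - ?s) / 2)"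
    by (rule expectation_past_mult[OF past(2) int(2), of "\<lambda>y. ((y / sqrt (real m))\<^sup>2 - ?s) / 2"])
      (use y_int in auto)
  then have d2: "expectation (\<lambda>\<omega>. ?h2 \<omega> * (((?y \<omega>)\<^sup>2 - ?s) / 2)) = 0" by (simp only: z0 mult_zero_right)
  have v_int: "integrable P (\<lambda>\<omega>. indicator (alive k) \<omega> * (value_at (Suc k) \<omega> - value_at k \<omega>))"
    using value_integrable[OF alive_event, of k "Suc k"] value_integrable[OF alive_event, of k k]
    by (simp add: right_diff_distrib)
  let ?G = "\<lambda>\<omega>. indicator (alive k) \<omega> * (value_at (Suc k) \<omega> - value_at k \<omega>)
      - ?h1 \<omega> * ?y \<omega> - ?h2 \<omega> * (((?y \<omega>)\<^sup>2 - ?s) / 2)"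
  let ?H = "\<lambda>\<omega>. 3 * reg_const R * ((?s\<^sup>2 + ?s * ((1 + (Y (Suc k) \<omega>)\<^sup>2) / sqrt (real m)))
      + ((Y (Suc k) \<omega>)\<^sup>2) powr (1 + \<kappa>) * moment_bound)"
  have G_le: "\<bar>?G \<omega>\<bar> \<le> ?H \<omega>" for \<omega>
  proof (cases "\<omega> \<in> alive k")
    case True
    have "\<bar>?y \<omega>\<bar> \<le> (1 + (Y (Suc k) \<omega>)\<^sup>2) / sqrt (real m)"
    proof -
      have "\<bar>Y (Suc k) \<omega>\<bar> \<le> 1 + (Y (Suc k) \<omega>)\<^sup>2"
        using sum_squares_bound[of 1 "\<bar>Y (Suc k) \<omega>\<bar>"] by simp
      then show ?thesis using m_pos by (simp add: abs_divide divide_right_mono)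
    qed
    then have "?s * \<bar>?y \<omega>\<bar> \<le> ?s * ((1 + (Y (Suc k) \<omega>)\<^sup>2) / sqrt (real m))"
      by (rule mult_left_mono) simp
    then have "3 * reg_const R * (?s\<^sup>2 + ?s * \<bar>?y \<omega>\<bar> + ((?y \<omega>)\<^sup>2) powr (1 + \<kappa>)) \<le> ?H \<omega>"
      unfolding scaled_moment using reg_nonneg
      by (intro mult_left_mono[OF add_right_mono[OF add_left_mono]]) auto
    moreover have "\<bar>capped R (time k + ?s) (pos k \<omega> + ?y \<omega>) - capped R (time k) (pos k \<omega>)
        - mixture1 (time k) (pos k \<omega>) * ?y \<omega> - mixture2 (time k) (pos k \<omega>) * (((?y \<omega>)\<^sup>2 - ?s) / 2)\<bar>
        \<le> 3 * reg_const R * (?s\<^sup>2 + ?s * \<bar>?y \<omega>\<bar> + ((?y \<omega>)\<^sup>2) powr (1 + \<kappa>))"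
      by (rule capped_Taylor) (use time_bounds(1)[OF k(1)] alive_below(1)[OF True k(1) kT] m kappa in auto)
    ultimately show ?thesis using True by (simp add: value_at_def time_Suc pos_Suc)
  next
    case False
    then show ?thesis using reg_nonneg by (simp add: moment_bound_def)
  qed
  have H_int: "integrable P ?H"
    using Y_square_integrable[of "Suc k"] Y_moments(3)[of "Suc k"]
    by (intro integrable_mult_right integrable_add integrable_mult_left integrable_divide_zero integrable_const) auto
  have G_int: "integrable P ?G" by (intro Bochner_Integration.integrable_diff v_int c1 c2)
  have E: "expectation (\<lambda>\<omega>. indicator (alive k) \<omega> * (value_at (Suc k) \<omega> - value_at k \<omega>)) = expectation ?G"
    by (simp only: Bochner_Integration.integral_diff[OF Bochner_Integration.integrable_diff[OF v_int c1] c2]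
        Bochner_Integration.integral_diff[OF v_int c1] d1 d2 diff_zero)
  have "\<bar>expectation (\<lambda>\<omega>. indicator (alive k) \<omega> * (value_at (Suc k) \<omega> - value_at k \<omega>))\<bar>
      \<le> expectation (\<lambda>\<omega>. \<bar>?G \<omega>\<bar>)"
    unfolding E by (rule integral_abs_bound)
  also have "\<dots> \<le> expectation ?H"
    by (rule integral_mono[OF integrable_abs[OF G_int] H_int G_le])
  also have "\<dots> = 3 * reg_const R * ((?s\<^sup>2 + ?s * (2 / sqrt (real m)))
      + expectation (\<lambda>\<omega>. ((Y (Suc k) \<omega>)\<^sup>2) powr (1 + \<kappa>)) * moment_bound)"
    using Y_square_integrable[of "Suc k"] Y_moments(2,3)[of "Suc k"] by (simp add: prob_space)
  also have "\<dots> \<le> 3 * reg_const R * ((moment_bound + 2 * moment_bound) + K * moment_bound)"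
  proof -
    have "?s\<^sup>2 = real m powr (-2)" using m_pos by (simp add: powr_minus powr_numeral power_inverse divide_inverse)
    also have "\<dots> \<le> moment_bound" unfolding moment_bound_def using m kappa by (intro powr_mono) auto
    finally have 1: "?s\<^sup>2 \<le> moment_bound" .
    have "real m powr (-1) * real m powr (- (1 / 2)) = ?s * (1 / sqrt (real m))"
      using m_pos by (simp only: powr_minus_divide powr_half_sqrt) simp
    then have "?s * (2 / sqrt (real m)) = 2 * (real m powr (-1) * real m powr (- (1 / 2)))"
      by simp
    also have "real m powr (-1) * real m powr (- (1 / 2)) = real m powr (- 3 / 2)"
      unfolding powr_add[symmetric] by simp
    also have "\<dots> \<le> moment_bound" unfolding moment_bound_def using m kappa by (intro powr_mono) auto
    finally have 2: "?s * (2 / sqrt (real m)) \<le> 2 * moment_bound" by simp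
    have 3: "expectation (\<lambda>\<omega>. ((Y (Suc k) \<omega>)\<^sup>2) powr (1 + \<kappa>)) * moment_bound \<le> K * moment_bound"
      using Y_moments(4)[of "Suc k"] by (intro mult_right_mono) (auto simp: moment_bound_def)
    show ?thesis using 1 2 3 reg_nonneg by (intro mult_left_mono add_mono) auto
  qed
  also have "\<dots> = 3 * reg_const R * (3 + K) * moment_bound" by (simp add: algebra_simps)
  finally show ?thesis by simp
qed

text \<open>A continuous path would cross at the value \<open>exp (q / 2)\<close> exactly; here \<open>E\<close> is the excess collected at
  step \<open>Suc k\<close>.\<close>

lemma overshoot_bound:
  assumes k: "m \<le> k" "k < T * m" and \<epsilon>: "0 < \<epsilon>" "\<epsilon> \<le> 1"
  defines "E \<equiv> expectation (\<lambda>\<omega>. indicator (alive k - alive (Suc k)) \<omega> * (value_at (Suc k) \<omega> - exp (q / 2)))"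
  shows "0 \<le> E" "E \<le> reg_const R * \<epsilon> * prob (alive k - alive (Suc k))
      + reg_const R * K / (\<epsilon>\<^sup>2) powr (1 + \<kappa>) * moment_bound"
proof -
  let ?D = "alive k - alive (Suc k)"
  have kT: "k \<le> T * m" "Suc k \<le> T * m" using k by auto
  have int: "integrable P (\<lambda>\<omega>. indicator ?D \<omega> * (value_at (Suc k) \<omega> - exp (q / 2)))"
    using value_integrable[of ?D "Suc k"]
    by (simp add: right_diff_distrib less_top[symmetric])
  have ge: "0 \<le> indicator ?D \<omega> * (value_at (Suc k) \<omega> - exp (q / 2))" for \<omega>
  proof (cases "\<omega> \<in> ?D")
    case True
    then obtain j where j: "j \<in> {m..Suc k}" "\<not> (S j \<omega>)\<^sup>2 < real j * (q + ln (real j / real m))"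
      by (auto simp: alive_def)
    moreover have "j \<notin> {m..k}" using True j(2) by (auto simp: alive_def)
    ultimately have "real (Suc k) * (q + ln (real (Suc k) / real m)) \<le> (S (Suc k) \<omega>)\<^sup>2"
      by (auto simp: le_Suc_eq not_less)
    then have "exp (q / 2) \<le> mixture (time (Suc k)) (pos (Suc k) \<omega>)"
      using crossing_iff[of "Suc k" \<omega>] k by simp
    then show ?thesis using cap_ge by (simp add: value_at_def capped_def)
  qed simp
  show "0 \<le> E" unfolding E_def by (rule Bochner_Integration.integral_nonneg[OF ge])
  have le: "indicator ?D \<omega> * (value_at (Suc k) \<omega> - exp (q / 2)) \<le> reg_const R * \<epsilon> * indicator ?D \<omega>
      + reg_const R / (\<epsilon>\<^sup>2) powr (1 + \<kappa>) * moment_bound * ((Y (Suc k) \<omega>)\<^sup>2) powr (1 + \<kappa>)" for \<omega>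
  proof (cases "\<omega> \<in> ?D")
    case True
    then have al: "\<omega> \<in> alive k" by simp
    have "value_at (Suc k) \<omega> \<le> exp (q / 2) + reg_const R * \<epsilon>
        + reg_const R * ((Y (Suc k) \<omega> / sqrt (real m))\<^sup>2) powr (1 + \<kappa>) / (\<epsilon>\<^sup>2) powr (1 + \<kappa>)"
      unfolding value_at_def time_Suc pos_Suc
      by (rule capped_overshoot)
        (use time_bounds(1)[OF k(1)] alive_below[OF al k(1) kT(1)] kappa \<epsilon> in auto)
    then show ?thesis unfolding scaled_moment using True by (simp add: mult_ac)
  next
    case False
    then show ?thesis using reg_nonneg by (simp add: moment_bound_def)
  qed
  have "E \<le> expectation (\<lambda>\<omega>. reg_const R * \<epsilon> * indicator ?D \<omega>
      + reg_const R / (\<epsilon>\<^sup>2) powr (1 + \<kappa>) * moment_bound * ((Y (Suc k) \<omega>)\<^sup>2) powr (1 + \<kappa>))"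
    unfolding E_def using Y_moments(3)[of "Suc k"]
    by (intro integral_mono[OF int _ le] integrable_add integrable_mult_right integrable_real_indicator)
      (auto simp: less_top[symmetric])
  also have "\<dots> = reg_const R * \<epsilon> * prob ?D
      + reg_const R / (\<epsilon>\<^sup>2) powr (1 + \<kappa>) * moment_bound * expectation (\<lambda>\<omega>. ((Y (Suc k) \<omega>)\<^sup>2) powr (1 + \<kappa>))"
    using Y_moments(3)[of "Suc k"]
    by (subst Bochner_Integration.integral_add) (auto simp: less_top[symmetric])
  also have "\<dots> \<le> reg_const R * \<epsilon> * prob ?D + reg_const R / (\<epsilon>\<^sup>2) powr (1 + \<kappa>) * moment_bound * K"
    using Y_moments(4)[of "Suc k"] reg_nonneg
    by (intro add_left_mono mult_left_mono) (auto simp: moment_bound_def)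
  finally show "E \<le> reg_const R * \<epsilon> * prob ?D + reg_const R * K / (\<epsilon>\<^sup>2) powr (1 + \<kappa>) * moment_bound"
    by (simp add: mult_ac)
qed

lemma payoff_step:
  assumes k: "m \<le> k" "k < T * m" and \<epsilon>: "0 < \<epsilon>" "\<epsilon> \<le> 1"
  shows "\<bar>payoff (Suc k) - payoff k\<bar>
      \<le> reg_const R * (3 * (3 + K) + K / (\<epsilon>\<^sup>2) powr (1 + \<kappa>)) * moment_bound
        + reg_const R * \<epsilon> * (prob (alive k) - prob (alive (Suc k)))"
proof -
  let ?D = "alive k - alive (Suc k)"
  let ?E1 = "expectation (\<lambda>\<omega>. indicator (alive k) \<omega> * (value_at (Suc k) \<omega> - value_at k \<omega>))"
  let ?E2 = "expectation (\<lambda>\<omega>. indicator ?D \<omega> * (value_at (Suc k) \<omega> - exp (q / 2)))"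
  have sub: "alive (Suc k) \<subseteq> alive k" by (rule alive_mono) simp
  have D: "prob ?D = prob (alive k) - prob (alive (Suc k))"
    by (rule finite_measure_Diff) (use sub in auto)
  note ints = value_integrable[OF alive_event, of "Suc k" "Suc k"] value_integrable[OF alive_event, of k "Suc k"]
    value_integrable[OF alive_event, of k k] value_integrable[of ?D "Suc k"]
  have split: "indicator (alive k) \<omega> * value_at (Suc k) \<omega>
      = indicator (alive (Suc k)) \<omega> * value_at (Suc k) \<omega> + indicator ?D \<omega> * value_at (Suc k) \<omega>" for \<omega>
    using sub by (auto simp: indicator_def)
  have e1: "?E1 = expectation (\<lambda>\<omega>. indicator (alive k) \<omega> * value_at (Suc k) \<omega>)
      - expectation (\<lambda>\<omega>. indicator (alive k) \<omega> * value_at k \<omega>)"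
    unfolding right_diff_distrib by (rule Bochner_Integration.integral_diff[OF ints(2,3)])
  have e1': "expectation (\<lambda>\<omega>. indicator (alive k) \<omega> * value_at (Suc k) \<omega>)
      = expectation (\<lambda>\<omega>. indicator (alive (Suc k)) \<omega> * value_at (Suc k) \<omega>)
        + expectation (\<lambda>\<omega>. indicator ?D \<omega> * value_at (Suc k) \<omega>)"
    unfolding split by (rule Bochner_Integration.integral_add[OF ints(1)]) (use ints(4) in simp)
  have e2: "?E2 = expectation (\<lambda>\<omega>. indicator ?D \<omega> * value_at (Suc k) \<omega>) - exp (q / 2) * prob ?D"
    unfolding right_diff_distrib
    by (subst Bochner_Integration.integral_diff) (use ints(4) in \<open>auto simp: less_top[symmetric]\<close>)
  have "payoff (Suc k) - payoff k = ?E1 - ?E2"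
    unfolding payoff_def e1 e1' e2 D prob_compl[OF alive_event] by (simp add: algebra_simps)
  then have "\<bar>payoff (Suc k) - payoff k\<bar> \<le> 3 * reg_const R * (3 + K) * moment_bound
     + (reg_const R * \<epsilon> * prob ?D + reg_const R * K / (\<epsilon>\<^sup>2) powr (1 + \<kappa>) * moment_bound)"
    using drift_bound[OF k] overshoot_bound[OF k \<epsilon>] by linarith
  then show ?thesis unfolding D by (simp add: algebra_simps)
qed

lemma payoff_change:
  assumes \<epsilon>: "0 < \<epsilon>" "\<epsilon> \<le> 1"
  shows "\<bar>payoff (T * m) - payoff m\<bar>
      \<le> real T * (reg_const R * (3 * (3 + K) + K / (\<epsilon>\<^sup>2) powr (1 + \<kappa>))) * real m powr (-\<kappa>)
        + reg_const R * \<epsilon>"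
proof -
  let ?C = "reg_const R * (3 * (3 + K) + K / (\<epsilon>\<^sup>2) powr (1 + \<kappa>))"
  have C: "0 \<le> ?C" using reg_nonneg K_nonneg by simp
  have le: "m \<le> T * m" using T by simp
  have "k \<le> T * m \<longrightarrow> \<bar>payoff k - payoff m\<bar> \<le> real (k - m) * (?C * moment_bound)
      + reg_const R * \<epsilon> * (prob (alive m) - prob (alive k))" if "m \<le> k" for k
    using that
  proof (induction k rule: dec_induct)
    case base
    then show ?case by simp
  next
    case (step k)
    show ?case
    proof
      assume kT: "Suc k \<le> T * m"
      have 1: "\<bar>payoff (Suc k) - payoff k\<bar> \<le> ?C * moment_bound
          + reg_const R * \<epsilon> * (prob (alive k) - prob (alive (Suc k)))"
        using payoff_step[of k, OF _ _ \<epsilon>] step kT by simp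
      have 2: "\<bar>payoff k - payoff m\<bar> \<le> real (k - m) * (?C * moment_bound)
          + reg_const R * \<epsilon> * (prob (alive m) - prob (alive k))" using step kT by simp
      have "real (Suc k - m) * (?C * moment_bound) = real (k - m) * (?C * moment_bound) + ?C * moment_bound"
        using step by (simp add: Suc_diff_le distrib_right)
      moreover have "reg_const R * \<epsilon> * (prob (alive m) - prob (alive (Suc k)))
          = reg_const R * \<epsilon> * (prob (alive m) - prob (alive k))
            + reg_const R * \<epsilon> * (prob (alive k) - prob (alive (Suc k)))"
        by (simp add: algebra_simps)
      ultimately show "\<bar>payoff (Suc k) - payoff m\<bar> \<le> real (Suc k - m) * (?C * moment_bound)
          + reg_const R * \<epsilon> * (prob (alive m) - prob (alive (Suc k)))"
        using 1 2 by linarith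
    qed
  qed
  then have "\<bar>payoff (T * m) - payoff m\<bar> \<le> real (T * m - m) * (?C * moment_bound)
      + reg_const R * \<epsilon> * (prob (alive m) - prob (alive (T * m)))"
    using le by blast
  also have "real (T * m - m) * (?C * moment_bound) \<le> real (T * m) * (?C * moment_bound)"
    by (intro mult_right_mono mult_nonneg_nonneg[OF C]) (simp_all add: moment_bound_def del: of_nat_mult)
  also have "\<dots> = real T * ?C * real m powr (-\<kappa>)"
    using m_pos by (simp add: moment_bound_def powr_diff powr_minus field_simps)
  also have "reg_const R * \<epsilon> * (prob (alive m) - prob (alive (T * m))) \<le> reg_const R * \<epsilon> * 1"
  proof (rule mult_left_mono)
    show "prob (alive m) - prob (alive (T * m)) \<le> 1"
      using prob_le_1[of "alive m"] measure_nonneg[of P "alive (T * m)"] by linarith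
    show "0 \<le> reg_const R * \<epsilon>" using reg_nonneg \<epsilon> by simp
  qed
  finally show ?thesis by simp
qed

lemma payoff_start:
  "payoff m = exp (q / 2) * expectation (\<lambda>\<omega>. clipped q (S m \<omega> / sqrt (real m)))"
proof -
  have eq: "indicator (alive m) \<omega> * value_at m \<omega> + exp (q / 2) * indicator (space P - alive m) \<omega>
      = exp (q / 2) * clipped q (S m \<omega> / sqrt (real m))" if "\<omega> \<in> space P" for \<omega>
  proof -
    have t: "time m = 1" using m_pos by (simp add: time_def)
    have c: "exp (q / 2) * clipped q (S m \<omega> / sqrt (real m)) = min (exp (q / 2)) (mixture 1 (pos m \<omega>))"
      by (simp add: clipped_def pos_def mixture_def min_mult_distrib_left diff_divide_distrib flip: exp_add)
    have le: "m \<le> T * m" using T by simp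
    show ?thesis
    proof (cases "\<omega> \<in> alive m")
      case True
      then have "mixture 1 (pos m \<omega>) < exp (q / 2)" using alive_below(2)[OF True order_refl le] by (simp add: t)
      moreover from this have "mixture 1 (pos m \<omega>) \<le> exp ((R + 1)\<^sup>2 / 2)" using cap_ge by linarith
      ultimately show ?thesis
        unfolding c using True by (simp only: value_at_def capped_def t) simp
    next
      case False
      then have "exp (q / 2) \<le> mixture 1 (pos m \<omega>)"
        using that crossing_iff[of m \<omega>] by (auto simp: alive_def t)
      then show ?thesis unfolding c using False that by simp
    qed
  qed
  have "payoff m = expectation (\<lambda>\<omega>. indicator (alive m) \<omega> * value_at m \<omega>
      + exp (q / 2) * indicator (space P - alive m) \<omega>)"
    unfolding payoff_def using value_integrable[OF alive_event, of m m]
    by (subst Bochner_Integration.integral_add) (auto simp: less_top[symmetric])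
  also have "\<dots> = expectation (\<lambda>\<omega>. exp (q / 2) * clipped q (S m \<omega> / sqrt (real m)))"
    by (rule Bochner_Integration.integral_cong) (use eq in auto)
  finally show ?thesis by simp
qed

text \<open>A walk that survives to the horizon has, with high probability, a square well below
  the boundary, where the mixture is of order \<open>T powr (- 1 / 4)\<close>.\<close>

lemma survivor_value:
  assumes T2: "2 \<le> T"
  shows "expectation (\<lambda>\<omega>. indicator (alive (T * m)) \<omega> * value_at (T * m) \<omega>)
      \<le> exp (- ln (real T) / 4) + exp (q / 2) * (2 / ln (real T))"
proof -
  let ?N = "T * m" and ?l = "ln (real T)"
  let ?A = "{\<omega> \<in> space P. ?l / 2 * real ?N \<le> (S ?N \<omega>)\<^sup>2}"
  have l: "0 < ?l" using T2 by simp
  have N: "m \<le> ?N" "1 \<le> ?N" using T m by auto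
  have t: "time ?N = real T" using m_pos by (simp add: time_def)
  have le: "indicator (alive ?N) \<omega> * value_at ?N \<omega> \<le> exp (- ?l / 4) + exp (q / 2) * indicator ?A \<omega>"
    if \<omega>: "\<omega> \<in> space P" for \<omega>
  proof (cases "\<omega> \<in> alive ?N")
    case al: True
    show ?thesis
    proof (cases "\<omega> \<in> ?A")
      case True
      have "value_at ?N \<omega> \<le> exp (q / 2)"
        using alive_below(2)[OF al N(1)] by (simp add: value_at_def capped_def)
      then show ?thesis using True al by (simp add: add_increasing)
    next
      case False
      then have s: "(S ?N \<omega>)\<^sup>2 < ?l / 2 * (real T * real m)" using \<omega> by simp
      have "(pos ?N \<omega>)\<^sup>2 / (2 * real T) = (S ?N \<omega>)\<^sup>2 / (2 * (real T * real m))"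
        by (simp add: pos_def power_divide)
      also have "\<dots> \<le> (?l / 2 * (real T * real m)) / (2 * (real T * real m))"
        using s by (intro divide_right_mono) auto
      also have "\<dots> = ?l / 4" using T m_pos by simp
      finally have "mixture (time ?N) (pos ?N \<omega>) \<le> exp (- ?l / 4)"
        unfolding mixture_def t by simp
      then show ?thesis using al False by (simp add: value_at_def capped_def)
    qed
  qed simp
  have A: "?A \<in> sets P" by measurable
  have "expectation (\<lambda>\<omega>. indicator (alive ?N) \<omega> * value_at ?N \<omega>)
      \<le> expectation (\<lambda>\<omega>. exp (- ?l / 4) + exp (q / 2) * indicator ?A \<omega>)"
    by (rule integral_mono[OF value_integrable[OF alive_event] _ le])
      (use A in \<open>auto simp: less_top[symmetric] simp del: of_nat_mult\<close>)
  also have "\<dots> = exp (- ?l / 4) + exp (q / 2) * prob ?A"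
    using A by (simp add: prob_space less_top[symmetric] del: of_nat_mult)
  also have "prob ?A \<le> 1 / (?l / 2)"
    using S_chebyshev[of "?l / 2" ?N] l N by simp
  finally show ?thesis by simp
qed

text \<open>The payoff at the horizon is \<open>exp (q / 2)\<close> times the probability of having crossed, plus the value of
  the survivors; the payoff at the start is \<open>exp (q / 2)\<close> times the expectation of \<open>clipped q\<close>.\<close>

theorem finite_horizon:
  assumes T2: "2 \<le> T" and \<epsilon>: "0 < \<epsilon>" "\<epsilon> \<le> 1"
  shows "\<bar>prob {\<omega> \<in> space P. \<exists>k\<in>{m..T * m}. real k * (q + ln (real k / real m)) \<le> (S k \<omega>)\<^sup>2}
          - expectation (\<lambda>\<omega>. clipped q (S m \<omega> / sqrt (real m)))\<bar>
      \<le> real T * (reg_const R * (3 * (3 + K) + K / (\<epsilon>\<^sup>2) powr (1 + \<kappa>))) * real m powr (-\<kappa>)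
        + reg_const R * \<epsilon> + exp (- ln (real T) / 4) + 2 / ln (real T)"
proof -
  let ?c = "exp (q / 2)" and ?X = "expectation (\<lambda>\<omega>. clipped q (S m \<omega> / sqrt (real m)))"
  let ?V = "expectation (\<lambda>\<omega>. indicator (alive (T * m)) \<omega> * value_at (T * m) \<omega>)"
  let ?p = "prob (space P - alive (T * m))"
  let ?e = "real T * (reg_const R * (3 * (3 + K) + K / (\<epsilon>\<^sup>2) powr (1 + \<kappa>))) * real m powr (-\<kappa>)
        + reg_const R * \<epsilon>"
  have c: "1 \<le> ?c" using q by simp
  have V: "0 \<le> ?V" by (rule Bochner_Integration.integral_nonneg) (use value_bounds in auto)
  have "?c * ?p - ?c * ?X = (payoff (T * m) - payoff m) - ?V"
    by (simp add: payoff_def[of "T * m"] payoff_start)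
  then have "\<bar>?c * ?p - ?c * ?X\<bar> \<le> \<bar>payoff (T * m) - payoff m\<bar> + ?V" using V by linarith
  also have "\<dots> \<le> ?e + (exp (- ln (real T) / 4) + ?c * (2 / ln (real T)))"
    by (rule add_mono[OF payoff_change[OF \<epsilon>] survivor_value[OF T2]])
  also have "\<dots> \<le> ?e + ?c * (exp (- ln (real T) / 4) + 2 / ln (real T))"
    using mult_right_mono[OF c, of "exp (- ln (real T) / 4)"] by (simp add: distrib_left)
  also have "?e \<le> ?c * ?e"
    using mult_right_mono[OF c, of ?e] reg_nonneg K_nonneg \<epsilon> by simp
  finally have "?c * \<bar>?p - ?X\<bar> \<le> ?c * (?e + (exp (- ln (real T) / 4) + 2 / ln (real T)))"
    by (simp add: right_diff_distrib[symmetric] abs_mult distrib_left)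
  then have "\<bar>?p - ?X\<bar> \<le> ?e + (exp (- ln (real T) / 4) + 2 / ln (real T))" by simp
  moreover have "space P - alive (T * m)
      = {\<omega> \<in> space P. \<exists>k\<in>{m..T * m}. real k * (q + ln (real k / real m)) \<le> (S k \<omega>)\<^sup>2}"
    by (auto simp: alive_def not_less)
  ultimately show ?thesis by simp
qed

end

section \<open>A central limit theorem along a sequence of probability measures\<close>

context std_walk
begin

text \<open>The remainder of the expansion of the characteristic function is bounded through
  \<open>min 1 z \<le> (z\<^sup>2) powr \<kappa>\<close> by the moment of order \<open>1 + \<kappa>\<close> of the square, at a rate that is the same for
  all walks of the locale. This lets the measure vary with \<open>n\<close> in the limit theorem below.\<close>

lemma char_S_estimate:
  assumes n: "1 \<le> n" "t\<^sup>2 / 4 \<le> real n"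
  shows "cmod (char (distr P borel (\<lambda>\<omega>. S n \<omega> / sqrt (real n))) t - complex_of_real ((1 + (- (t\<^sup>2) / 2) / real n) ^ n))
           \<le> t\<^sup>2 * (t\<^sup>2) powr \<kappa> * K * real n powr (-\<kappa>)"
proof -
  define s where "s = t / sqrt (real n)"
  have n0: "0 < real n" using n by simp
  have s2: "s\<^sup>2 = t\<^sup>2 / real n" by (simp add: s_def power_divide)
  let ?\<psi> = "char (distr P borel (Y 1)) s"
  note [measurable] = Y_measurable[of 1, simplified]
  have "char (distr P borel (\<lambda>\<omega>. S n \<omega> / sqrt (real n))) t
      = char (distr P borel (\<lambda>\<omega>. \<Sum>i\<in>{1..n}. Y i \<omega> / sqrt (real n))) t"
    by (simp add: S_def sum_divide_distrib)
  also have "\<dots> = (\<Prod>i\<in>{1..n}. char (distr P borel (\<lambda>\<omega>. Y i \<omega> / sqrt (real n))) t)"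
    by (rule char_distr_sum, rule indep_vars_compose2[where X = Y], rule indep_vars_subset[OF indep]) auto
  also have "\<dots> = (\<Prod>i\<in>{1..n}. ?\<psi>)"
  proof (rule prod.cong[OF refl])
    fix i assume "i \<in> {1..n}"
    then have i: "1 \<le> i" by simp
    note [measurable] = Y_measurable[OF i]
    have "char (distr P borel (\<lambda>\<omega>. Y i \<omega> / sqrt (real n))) t = char (distr P borel (Y i)) s"
      unfolding char_def s_def by (simp add: integral_distr mult.commute)
    then show "char (distr P borel (\<lambda>\<omega>. Y i \<omega> / sqrt (real n))) t = ?\<psi>"
      by (simp add: same_distr[OF i])
  qed
  finally have eq: "char (distr P borel (\<lambda>\<omega>. S n \<omega> / sqrt (real n))) t = ?\<psi> ^ n" by simp
  interpret \<mu>: real_distribution "distr P borel (Y 1)" by (rule real_distribution_distr) simp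
  have ints: "integrable P (Y 1)" "integrable P (\<lambda>\<omega>. (Y 1 \<omega>)\<^sup>2)" "expectation (Y 1) = 0"
    using Y_integrable[of 1] Y_square_integrable[of 1] Y_moments(1)[of 1] by auto
  have "cmod (?\<psi> - complex_of_real (1 + (- (t\<^sup>2) / 2) / real n))
      = cmod (?\<psi> - (1 - s\<^sup>2 * 1 / 2))"
    by (simp add: s2 algebra_simps)
  also have "\<dots> \<le> s\<^sup>2 / 6 * expectation (\<lambda>\<omega>. min (6 * (Y 1 \<omega>)\<^sup>2) (\<bar>s\<bar> * \<bar>Y 1 \<omega>\<bar> ^ 3))"
    using char_approx3'[of "Y 1" 1 "distr P borel (Y 1)" s] ints second_moment by simp
  also have "\<dots> \<le> s\<^sup>2 / 6 * expectation (\<lambda>\<omega>. 6 * (s\<^sup>2) powr \<kappa> * ((Y 1 \<omega>)\<^sup>2) powr (1 + \<kappa>))"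
  proof (intro mult_left_mono integral_mono)
    show "integrable P (\<lambda>\<omega>. min (6 * (Y 1 \<omega>)\<^sup>2) (\<bar>s\<bar> * \<bar>Y 1 \<omega>\<bar> ^ 3))"
      by (rule Bochner_Integration.integrable_bound[where f = "\<lambda>\<omega>. 6 * (Y 1 \<omega>)\<^sup>2"]) (use ints in auto)
    show "integrable P (\<lambda>\<omega>. 6 * (s\<^sup>2) powr \<kappa> * ((Y 1 \<omega>)\<^sup>2) powr (1 + \<kappa>))"
      using moment_integrable by simp
    fix \<omega>
    let ?y = "Y 1 \<omega>" and ?z = "\<bar>s\<bar> * \<bar>Y 1 \<omega>\<bar>"
    have "min 1 ?z \<le> (?z\<^sup>2) powr \<kappa>"
    proof (cases "?z = 0")
      case False
      then have z: "0 < ?z" by (simp add: mult_nonneg_nonneg order_less_le)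
      show ?thesis
      proof (cases "?z \<le> 1")
        case True
        have "?z powr 1 \<le> ?z powr (2 * \<kappa>)" using True z kappa by (intro powr_mono') auto
        also have "\<dots> = (?z powr 2) powr \<kappa>" by (rule powr_powr[symmetric])
        also have "?z powr 2 = ?z\<^sup>2" using z by (simp add: powr_numeral)
        finally show ?thesis using z by (simp add: min_le_iff_disj)
      next
        case False
        have "1 \<le> (?z\<^sup>2) powr \<kappa>" using False kappa by (intro ge_one_powr_ge_zero one_le_power) auto
        then show ?thesis by (simp add: min_le_iff_disj)
      qed
    next
      case True
      show ?thesis unfolding True by simp
    qed
    then have "6 * ?y\<^sup>2 * min 1 ?z \<le> 6 * ?y\<^sup>2 * (?z\<^sup>2) powr \<kappa>" by (intro mult_left_mono) auto
    moreover have "min (6 * ?y\<^sup>2) (\<bar>s\<bar> * \<bar>?y\<bar> ^ 3) \<le> 6 * ?y\<^sup>2 * min 1 ?z"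
    proof -
      have "\<bar>?y\<bar> ^ 3 = ?y\<^sup>2 * \<bar>?y\<bar>"
        by (simp only: power3_eq_cube power2_eq_square abs_mult_self_eq)
      then have "\<bar>s\<bar> * \<bar>?y\<bar> ^ 3 = ?y\<^sup>2 * ?z" by simp
      moreover have "?y\<^sup>2 * ?z \<le> 6 * ?y\<^sup>2 * ?z" by simp
      ultimately show ?thesis by (cases "1 \<le> ?z") (auto simp: min_absorb1 min_absorb2 min.coboundedI2)
    qed
    moreover have "6 * ?y\<^sup>2 * (?z\<^sup>2) powr \<kappa> = 6 * (s\<^sup>2) powr \<kappa> * (?y\<^sup>2) powr (1 + \<kappa>)"
      by (simp add: power_mult_distrib powr_mult powr_add)
    ultimately show "min (6 * ?y\<^sup>2) (\<bar>s\<bar> * \<bar>?y\<bar> ^ 3) \<le> 6 * (s\<^sup>2) powr \<kappa> * (?y\<^sup>2) powr (1 + \<kappa>)" by linarith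
  qed simp
  also have "\<dots> = s\<^sup>2 * (s\<^sup>2) powr \<kappa> * expectation (\<lambda>\<omega>. ((Y 1 \<omega>)\<^sup>2) powr (1 + \<kappa>))"
    using moment_integrable by simp
  also have "\<dots> \<le> s\<^sup>2 * (s\<^sup>2) powr \<kappa> * K"
    by (rule mult_left_mono[OF moment_le]) simp
  finally have one: "cmod (?\<psi> - complex_of_real (1 + (- (t\<^sup>2) / 2) / real n)) \<le> s\<^sup>2 * (s\<^sup>2) powr \<kappa> * K" .
  have "cmod (?\<psi> ^ n - (complex_of_real (1 + (- (t\<^sup>2) / 2) / real n)) ^ n)
      \<le> real n * cmod (?\<psi> - complex_of_real (1 + (- (t\<^sup>2) / 2) / real n))"
  proof (rule norm_power_diff)
    show "cmod ?\<psi> \<le> 1" by (rule \<mu>.cmod_char_le_1)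
    have "t\<^sup>2 / (2 * real n) \<le> 2" using n n0 by (simp add: field_simps)
    then show "cmod (complex_of_real (1 + (- (t\<^sup>2) / 2) / real n)) \<le> 1"
      unfolding norm_of_real by (intro abs_leI) auto
  qed
  also have "\<dots> \<le> real n * (s\<^sup>2 * (s\<^sup>2) powr \<kappa> * K)" by (rule mult_left_mono[OF one]) simp
  also have "\<dots> = t\<^sup>2 * (t\<^sup>2) powr \<kappa> * K * real n powr (-\<kappa>)"
    unfolding s2 using n0 by (simp add: powr_divide powr_minus_divide)
  finally show ?thesis unfolding eq by simp
qed

end

theorem uniform_clt:
  fixes P :: "nat \<Rightarrow> 'a measure" and f :: "real \<Rightarrow> real"
  assumes walk: "\<And>n. std_walk (P n) (Y n) \<kappa> K"
    and f: "\<And>x. isCont f x" "\<And>x. \<bar>f x\<bar> \<le> B"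
  shows "(\<lambda>n. \<integral>\<omega>. f ((\<Sum>i=1..n. Y n i \<omega>) / sqrt (real n)) \<partial>P n)
           \<longlonglongrightarrow> (\<integral>x. f x \<partial>std_normal_distribution)"
proof -
  interpret W: std_walk "P n" "Y n" \<kappa> K for n by (rule walk)
  let ?\<mu> = "\<lambda>n. distr (P n) borel (\<lambda>\<omega>. W.S n n \<omega> / sqrt (real n))"
  have dist: "real_distribution (?\<mu> n)" for n
    by (rule W.real_distribution_distr) simp
  have "weak_conv_m ?\<mu> std_normal_distribution"
  proof (rule levy_continuity)
    fix t :: real
    obtain N :: nat where N: "t\<^sup>2 / 4 \<le> real N" using real_arch_simple by blast
    have "\<forall>\<^sub>F n in sequentially. cmod (char (?\<mu> n) t - complex_of_real ((1 + (- (t\<^sup>2) / 2) / real n) ^ n))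
        \<le> t\<^sup>2 * (t\<^sup>2) powr \<kappa> * K * real n powr (-\<kappa>)"
      by (rule eventually_sequentiallyI[of "max 1 N"], rule W.char_S_estimate)
        (use N in \<open>auto intro: order_trans\<close>)
    moreover have "(\<lambda>n. t\<^sup>2 * (t\<^sup>2) powr \<kappa> * K * real n powr (-\<kappa>)) \<longlonglongrightarrow> 0"
      using W.kappa by (intro tendsto_mult_right_zero tendsto_neg_powr filterlim_real_sequentially) auto
    ultimately have "(\<lambda>n. char (?\<mu> n) t - complex_of_real ((1 + (- (t\<^sup>2) / 2) / real n) ^ n)) \<longlonglongrightarrow> 0"
      by (rule Lim_null_comparison)
    moreover have "(\<lambda>n. complex_of_real ((1 + (- (t\<^sup>2) / 2) / real n) ^ n)) \<longlonglongrightarrow> complex_of_real (exp (- (t\<^sup>2) / 2))"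
      by (rule isCont_tendsto_compose[OF _ tendsto_exp_limit_sequentially]) auto
    ultimately show "(\<lambda>n. char (?\<mu> n) t) \<longlonglongrightarrow> char std_normal_distribution t"
      unfolding char_std_normal_distribution by (rule Lim_transform[rotated])
  qed (use dist real_dist_normal_dist in auto)
  then have "(\<lambda>n. \<integral>x. f x \<partial>?\<mu> n) \<longlonglongrightarrow> (\<integral>x. f x \<partial>std_normal_distribution)"
    by (rule weak_conv_imp_integral_bdd_continuous_conv[OF dist real_dist_normal_dist]) (use f in auto)
  moreover have "(\<integral>x. f x \<partial>?\<mu> n) = (\<integral>\<omega>. f ((\<Sum>i=1..n. Y n i \<omega>) / sqrt (real n)) \<partial>P n)" for n
  proof -
    have [measurable]: "f \<in> borel_measurable borel"
      using f(1) by (intro borel_measurable_continuous_onI continuous_at_imp_continuous_on) auto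
    have "(\<integral>x. f x \<partial>?\<mu> n) = (\<integral>\<omega>. f (W.S n n \<omega> / sqrt (real n)) \<partial>P n)"
      by (rule integral_distr) simp_all
    then show ?thesis by (simp add: W.S_def)
  qed
  ultimately show ?thesis by simp
qed

section \<open>The Robbins-Siegmund distribution\<close>

interpretation std_normal: real_distribution std_normal_distribution
  by (rule real_dist_normal_dist)

text \<open>The probability that a Brownian motion \<open>W\<close> satisfies \<open>(W t)\<^sup>2 \<ge> t * (q + ln t)\<close> for some \<open>t \<ge> 1\<close>.\<close>

definition gauss_crossing :: "real \<Rightarrow> real" where
  "gauss_crossing q = (\<integral>x. clipped q x \<partial>std_normal_distribution)"

lemma clipped_integrable: "integrable std_normal_distribution (clipped q)"
  by (rule std_normal.integrable_const_bound[where B = 1]) (use clipped_bounds in auto)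

lemma clipped_isCont: "isCont (clipped q) x"
  unfolding clipped_def[abs_def] by (intro continuous_intros) auto

lemma measure_std_normal:
  assumes "A \<in> sets borel"
  shows "measure std_normal_distribution A = (\<integral>x. std_normal_density x * indicator A x \<partial>lborel)"
proof -
  have "measure std_normal_distribution A = (\<integral>x. indicator A x \<partial>std_normal_distribution)"
    using assms by simp
  also have "\<dots> = (\<integral>x. std_normal_density x * indicator A x \<partial>lborel)"
    using assms by (subst integral_density) auto
  finally show ?thesis .
qed

lemma std_normal_symmetric:
  "measure std_normal_distribution {..<-r} = 1 - Phi r"
proof -
  have "measure std_normal_distribution {..<-r} = (\<integral>x. std_normal_density x * indicator {..<-r} x \<partial>lborel)"
    by (rule measure_std_normal) simp
  also have "\<dots> = \<bar>-1\<bar> *\<^sub>R (\<integral>x. std_normal_density (0 + -1 * x) * indicator {..<-r} (0 + -1 * x) \<partial>lborel)"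
    by (rule lborel_integral_real_affine) simp
  also have "\<dots> = (\<integral>x. std_normal_density x * indicator {r<..} x \<partial>lborel)"
    by (simp add: std_normal_density_def indicator_def)
  also have "\<dots> = measure std_normal_distribution {r<..}"
    by (rule measure_std_normal[symmetric]) simp
  also have "{r<..} = space std_normal_distribution - {..r}" by auto
  also have "measure std_normal_distribution \<dots> = 1 - Phi r"
    unfolding cdf_def by (rule std_normal.prob_compl) simp
  finally show ?thesis .
qed

text \<open>Inside the boundary the density times \<open>exp ((x\<^sup>2 - q) / 2)\<close> is constant, equal to the density
  at the boundary, which produces the term \<open>sqrt q * \<phi> (sqrt q)\<close>.\<close>

lemma gauss_crossing_eq:
  assumes q: "0 \<le> q"
  shows "gauss_crossing q = 1 - RS_cdf q"
proof -
  define r where "r = sqrt q"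
  have r: "0 \<le> r" "r\<^sup>2 = q" using q by (simp_all add: r_def)
  have inside: "x\<^sup>2 \<le> q \<longleftrightarrow> x \<in> {-r..r}" for x
    using abs_le_square_iff[of x r] r by auto
  have dec: "std_normal_density x * clipped q x = std_normal_density r * indicator {-r..r} x
      + std_normal_density x * indicator {..<-r} x + std_normal_density x * indicator {r<..} x" for x
  proof (cases "x\<^sup>2 \<le> q")
    case True
    have "std_normal_density x * exp ((x\<^sup>2 - q) / 2) = std_normal_density r"
      by (simp add: std_normal_density_def r diff_divide_distrib flip: exp_add)
    then show ?thesis using True inside[of x] r(1) by (auto simp: clipped_def indicator_def)
  next
    case False
    then have "clipped q x = 1" by (simp add: clipped_def)
    then show ?thesis using False inside[of x] r(1) by (auto simp: indicator_def)
  qed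
  have int: "integrable lborel (\<lambda>x. std_normal_density x * indicator A x)" if "A \<in> sets borel" for A
    using integrable_mult_indicator[OF _ integrable_normal_density[of 1 0], of A] that
    by (simp add: mult.commute)
  have const: "integrable lborel (\<lambda>x. std_normal_density r * indicator {-r..r} x)"
    by (intro integrable_mult_right integrable_real_indicator) (simp_all add: emeasure_lborel_Icc_eq)
  have "gauss_crossing q = (\<integral>x. std_normal_density x * clipped q x \<partial>lborel)"
    unfolding gauss_crossing_def by (subst integral_density) auto
  also have "\<dots> = (\<integral>x. std_normal_density r * indicator {-r..r} x \<partial>lborel)
      + (\<integral>x. std_normal_density x * indicator {..<-r} x \<partial>lborel)
      + (\<integral>x. std_normal_density x * indicator {r<..} x \<partial>lborel)"
    unfolding dec using const int by (subst Bochner_Integration.integral_add | simp)+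
  also have "(\<integral>x. std_normal_density r * indicator {-r..r} x \<partial>lborel) = 2 * r * std_normal_density r"
    using r(1) by simp
  also have "(\<integral>x. std_normal_density x * indicator {..<-r} x \<partial>lborel) = 1 - Phi r"
    by (simp add: measure_std_normal[symmetric] std_normal_symmetric)
  also have "(\<integral>x. std_normal_density x * indicator {r<..} x \<partial>lborel) = 1 - Phi r"
  proof -
    have "{r<..} = space std_normal_distribution - {..r}" by auto
    then show ?thesis
      using std_normal.prob_compl[of "{..r}"] by (simp add: measure_std_normal[symmetric] cdf_def)
  qed
  finally show ?thesis using q by (simp add: RS_cdf_def r_def)
qed

lemma clipped_exp: "clipped q x = exp (min 0 ((x\<^sup>2 - q) / 2))"
  by (simp add: clipped_def min_def)

lemma clipped_antimono: "q \<le> q' \<Longrightarrow> clipped q' x \<le> clipped q x"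
  by (auto simp: clipped_exp min_def)

lemma clipped_Lipschitz:
  assumes "q \<le> q'"
  shows "clipped q x - clipped q' x \<le> (q' - q) / 2"
proof -
  define a b where "a = min 0 ((x\<^sup>2 - q) / 2)" and "b = min 0 ((x\<^sup>2 - q') / 2)"
  have ab: "b \<le> a" "a \<le> 0" "a - b \<le> (q' - q) / 2"
    using assms by (auto simp: a_def b_def min_def field_simps)
  have "exp a - exp b = exp a * (1 - exp (b - a))" by (simp add: exp_diff right_diff_distrib)
  also have "\<dots> \<le> 1 * (a - b)"
  proof (rule mult_mono)
    show "1 - exp (b - a) \<le> a - b" using exp_ge_add_one_self[of "b - a"] by linarith
  qed (use ab in auto)
  finally show ?thesis using ab by (simp add: clipped_exp a_def b_def)
qed

lemma gauss_crossing_antimono: "q \<le> q' \<Longrightarrow> gauss_crossing q' \<le> gauss_crossing q"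
  unfolding gauss_crossing_def by (intro integral_mono clipped_integrable clipped_antimono)

lemma gauss_crossing_Lipschitz:
  assumes "q \<le> q'"
  shows "gauss_crossing q - gauss_crossing q' \<le> (q' - q) / 2"
proof -
  have "gauss_crossing q - gauss_crossing q'
      = (\<integral>x. clipped q x - clipped q' x \<partial>std_normal_distribution)"
    unfolding gauss_crossing_def by (rule Bochner_Integration.integral_diff[symmetric, OF clipped_integrable clipped_integrable])
  also have "\<dots> \<le> (\<integral>x. (q' - q) / 2 \<partial>std_normal_distribution)"
    by (intro integral_mono clipped_Lipschitz[OF assms]) (auto simp: clipped_integrable)
  also have "\<dots> = (q' - q) / 2" using std_normal.prob_space by simp
  finally show ?thesis .
qed

lemma gauss_crossing_strict:
  assumes "0 \<le> q" "q < q'"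
  shows "gauss_crossing q' < gauss_crossing q"
  unfolding gauss_crossing_def
proof (rule std_normal.integral_less_AE[OF clipped_integrable clipped_integrable])
  let ?A = "{0..<sqrt q'}"
  show "emeasure std_normal_distribution ?A \<noteq> 0"
  proof
    assume "emeasure std_normal_distribution ?A = 0"
    then have "(\<integral>\<^sup>+ x. ennreal (std_normal_density x) * indicator ?A x \<partial>lborel) = 0"
      by (subst (asm) emeasure_density) auto
    then have "AE x in lborel. ennreal (std_normal_density x) * indicator ?A x = 0"
      by (subst (asm) nn_integral_0_iff_AE) auto
    then have "AE x in lborel. x \<notin> ?A"
    proof eventually_elim
      case (elim x)
      have "0 < std_normal_density x" by (rule normal_density_pos) simp
      then show ?case using elim by (auto simp: indicator_def split: if_splits)
    qed
    then have "?A \<in> null_sets lborel" by (subst AE_iff_null_sets) auto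
    then have "emeasure lborel ?A = 0" by (rule null_setsD1)
    then show False using assms by simp
  qed
  show "AE x in std_normal_distribution. x \<in> ?A \<longrightarrow> clipped q' x \<noteq> clipped q x"
  proof (rule AE_I2, rule impI)
    fix x :: real assume "x \<in> ?A"
    then have "x\<^sup>2 < (sqrt q')\<^sup>2" by (intro power_strict_mono) auto
    then have "x\<^sup>2 < q'" using assms by simp
    then have "min 0 ((x\<^sup>2 - q') / 2) < min 0 ((x\<^sup>2 - q) / 2)" using assms by (simp add: min_def)
    then show "clipped q' x \<noteq> clipped q x"
      unfolding clipped_exp exp_inj_iff by (rule less_imp_neq)
  qed
  show "AE x in std_normal_distribution. clipped q' x \<le> clipped q x"
    using assms by (intro AE_I2 clipped_antimono) simp
qed simp

lemma gauss_crossing_tendsto_0: "(\<lambda>n. gauss_crossing (real n)) \<longlonglongrightarrow> 0"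
proof -
  have "(\<lambda>n. \<integral>x. clipped (real n) x \<partial>std_normal_distribution) \<longlonglongrightarrow> (\<integral>x. 0 \<partial>std_normal_distribution)"
  proof (rule integral_dominated_convergence[where w = "\<lambda>_. 1"])
    show "AE x in std_normal_distribution. (\<lambda>n. clipped (real n) x) \<longlonglongrightarrow> 0"
    proof (rule AE_I2)
      fix x :: real
      have "(\<lambda>n. exp ((x\<^sup>2 - real n) / 2)) \<longlonglongrightarrow> 0" by real_asymp
      then have "(\<lambda>n. min 1 (exp ((x\<^sup>2 - real n) / 2))) \<longlonglongrightarrow> min 1 0"
        by (intro tendsto_min tendsto_const)
      then show "(\<lambda>n. clipped (real n) x) \<longlonglongrightarrow> 0" by (simp add: clipped_def)
    qed
  qed (use clipped_bounds in auto)
  then show ?thesis by (simp add: gauss_crossing_def)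
qed

lemma RS_cdf_strict_mono: "0 \<le> x \<Longrightarrow> x < y \<Longrightarrow> RS_cdf x < RS_cdf y"
  using gauss_crossing_strict[of x y] gauss_crossing_eq[of x] gauss_crossing_eq[of y] by simp

lemma gauss_crossing_0: "gauss_crossing 0 = 1"
proof -
  have "clipped 0 = (\<lambda>_. 1)" by (simp add: clipped_def fun_eq_iff)
  then show ?thesis using std_normal.prob_space by (simp add: gauss_crossing_def)
qed

lemma RS_quantile:
  assumes "0 < p" "p < 1"
  shows "0 < RS_quantile p" "RS_cdf (RS_quantile p) = p"
proof -
  have "inj_on RS_cdf {0..}"
    by (rule linorder_inj_onI') (use RS_cdf_strict_mono in \<open>force+\<close>)
  moreover have "p \<in> RS_cdf ` {0..}"
  proof -
    have "\<forall>\<^sub>F n in sequentially. gauss_crossing (real n) < 1 - p"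
      by (rule order_tendstoD(2)[OF gauss_crossing_tendsto_0]) (use assms in simp)
    then obtain n where n: "gauss_crossing (real n) < 1 - p"
      by (auto simp: eventually_sequentially)
    have "\<bar>gauss_crossing x - gauss_crossing y\<bar> \<le> 1 / 2 * \<bar>x - y\<bar>" for x y
      using gauss_crossing_Lipschitz[of x y] gauss_crossing_Lipschitz[of y x]
        gauss_crossing_antimono[of x y] gauss_crossing_antimono[of y x] by (cases "x \<le> y") auto
    then have "(1 / 2)-lipschitz_on {0..real n} gauss_crossing"
      by (intro lipschitz_onI) (auto simp: dist_real_def)
    then have "continuous_on {0..real n} gauss_crossing" by (rule lipschitz_on_continuous_on)
    then have "\<exists>x\<ge>0. x \<le> real n \<and> gauss_crossing x = 1 - p"
      using n assms gauss_crossing_0 by (intro IVT2') auto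
    then obtain x where "0 \<le> x" "gauss_crossing x = 1 - p" by blast
    then have "RS_cdf x = p" using gauss_crossing_eq[of x] by simp
    then show ?thesis using \<open>0 \<le> x\<close> by auto
  qed
  ultimately have "RS_quantile p \<in> {0..}" and eq: "RS_cdf (RS_quantile p) = p"
    unfolding RS_quantile_def
    by (simp_all only: the_inv_into_into[OF _ _ order_refl] f_the_inv_into_f)
  moreover have "RS_quantile p \<noteq> 0"
  proof
    assume "RS_quantile p = 0"
    then show False using eq assms gauss_crossing_0 gauss_crossing_eq[of 0] by simp
  qed
  ultimately show "0 < RS_quantile p" "RS_cdf (RS_quantile p) = p" by auto
qed

lemma RS_cdf_ge_iff:
  assumes "0 < p" "p < 1"
  shows "p \<le> RS_cdf x \<longleftrightarrow> RS_quantile p \<le> x"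
proof
  assume *: "p \<le> RS_cdf x"
  then have "0 \<le> x" using assms by (auto simp: RS_cdf_def split: if_splits)
  then show "RS_quantile p \<le> x"
    using RS_cdf_strict_mono[of x "RS_quantile p"] RS_quantile[OF assms] * by (cases "x < RS_quantile p") auto
next
  assume "RS_quantile p \<le> x"
  then show "p \<le> RS_cdf x"
    using RS_cdf_strict_mono[of "RS_quantile p" x] RS_quantile[OF assms] by (cases "RS_quantile p = x") auto
qed

section \<open>The studentised crossing event\<close>

text \<open>Up to the horizon the boundary is bounded, so a small relative error in the sum of squares
  amounts to a small shift of \<open>q\<close>. Beyond it, the boundary grows faster than \<open>S\<^sup>2 - Q\<close>.\<close>

lemma crossing_of_studentized:
  fixes s2 Q :: real
  assumes m: "1 \<le> m" "m \<le> k" "k \<le> T * m" and q: "0 < q" and s2: "0 \<le> s2"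
    and \<beta>: "(q + ln (real T)) * (\<eta> + (q + ln (real T)) / real m) \<le> \<epsilon>"
    and \<eta>: "0 \<le> \<eta>" and \<epsilon>: "0 \<le> \<epsilon>" and Q: "\<bar>Q - real k\<bar> < \<eta> * real k"
    and cross: "(q + ln (real k / real m)) * Q \<le> s2 * (1 + (q + ln (real k / real m)) / real k)"
  shows "real k * ((q - \<epsilon>) + ln (real k / real m)) \<le> s2"
proof (rule ccontr)
  define b where "b = q + ln (real k / real m)"
  define \<beta>' where "\<beta>' = q + ln (real T)"
  assume "\<not> real k * ((q - \<epsilon>) + ln (real k / real m)) \<le> s2"
  then have less: "s2 < real k * (b - \<epsilon>)" by (simp add: b_def algebra_simps)
  have k0: "0 < real k" and m0: "0 < real m" using m by auto
  have "0 \<le> ln (real k / real m)" using m by (simp add: ln_ge_zero)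
  then have b0: "0 < b" using q by (simp add: b_def)
  have ratio: "real k / real m \<le> real T" using m by (simp add: divide_le_eq flip: of_nat_mult)
  have b1: "b \<le> \<beta>'" using k0 m0 ratio unfolding b_def \<beta>'_def
    by (intro add_left_mono) (auto intro!: ln_mono)
  have "b * (real k * (1 - \<eta>)) \<le> b * Q"
    using b0 Q by (intro mult_left_mono) (auto simp: algebra_simps)
  also have "\<dots> \<le> s2 * (1 + b / real k)" using cross by (simp add: b_def)
  also have "\<dots> < real k * (b - \<epsilon>) * (1 + b / real k)"
    using less b0 k0 by (intro mult_strict_right_mono) (auto simp: add_pos_pos)
  also have "\<dots> = real k * (b + b * (b / real k) - \<epsilon> - \<epsilon> * (b / real k))"
    by (simp add: algebra_simps)
  also have "\<dots> \<le> real k * (b - b * \<eta>)"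
  proof (rule mult_left_mono)
    have "b * (b / real k) \<le> \<beta>' * (\<beta>' / real m)"
      using b0 b1 m k0 m0 by (intro mult_mono frac_le) auto
    moreover have "b * \<eta> \<le> \<beta>' * \<eta>" using b1 \<eta> by (rule mult_right_mono)
    moreover have "\<beta>' * \<eta> + \<beta>' * (\<beta>' / real m) \<le> \<epsilon>"
      using \<beta> by (simp add: \<beta>'_def distrib_left)
    moreover have "0 \<le> \<epsilon> * (b / real k)" using \<epsilon> b0 k0 by simp
    ultimately show "b + b * (b / real k) - \<epsilon> - \<epsilon> * (b / real k) \<le> b - b * \<eta>" by linarith
  qed (use k0 in simp)
  finally show False by (simp add: algebra_simps)
qed

lemma studentized_of_crossing:
  fixes s2 Q :: real
  assumes m: "1 \<le> m" "m \<le> k" "k \<le> T * m" and q: "0 < q" and s2: "0 \<le> s2"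
    and \<beta>: "(q + ln (real T)) * \<eta> < \<epsilon>" and \<eta>: "0 \<le> \<eta>" and Q: "\<bar>Q - real k\<bar> < \<eta> * real k"
    and cross: "real k * ((q + \<epsilon>) + ln (real k / real m)) \<le> s2"
  shows "(q + ln (real k / real m)) * Q < s2 * (1 + (q + ln (real k / real m)) / real k)"
proof -
  define b where "b = q + ln (real k / real m)"
  have k0: "0 < real k" and m0: "0 < real m" using m by auto
  have "0 \<le> ln (real k / real m)" using m by (simp add: ln_ge_zero)
  then have b0: "0 < b" using q by (simp add: b_def)
  have ratio: "real k / real m \<le> real T" using m by (simp add: divide_le_eq flip: of_nat_mult)
  have b1: "b \<le> q + ln (real T)" using k0 m0 ratio unfolding b_def
    by (intro add_left_mono) (auto intro!: ln_mono)
  have "b * Q \<le> b * (real k * (1 + \<eta>))"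
    using b0 Q by (intro mult_left_mono) (auto simp: algebra_simps)
  also have "\<dots> = real k * (b + b * \<eta>)" by (simp add: algebra_simps)
  also have "\<dots> < real k * (b + \<epsilon>)"
    using mult_right_mono[OF b1 \<eta>] \<beta> k0 by (intro mult_strict_left_mono) auto
  also have "\<dots> \<le> s2" using cross by (simp add: b_def algebra_simps)
  also have "\<dots> \<le> s2 * (1 + b / real k)" using s2 b0 k0 by (simp add: distrib_left)
  finally show ?thesis by (simp add: b_def)
qed

lemma no_studentized_crossing_in_tail:
  fixes s2 Q :: real
  assumes m: "1 \<le> m" "T * m \<le> k" and T: "1 \<le> T" "16 \<le> ln (real T)" and q: "0 < q" "q \<le> real m"
    and Q: "\<bar>Q - real k\<bar> < 1 / 2 * real k"
    and tail: "\<bar>s2 - Q\<bar> < real k * ln (real k / real m) / 8" and s2: "0 \<le> s2"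
  shows "s2 * (1 + (q + ln (real k / real m)) / real k) < (q + ln (real k / real m)) * Q"
proof -
  define L where "L = ln (real k / real m)"
  have m0: "0 < real m" using m by simp
  have mk: "m \<le> k" using m T by (metis le_trans mult_le_mono1 mult_1)
  have k0: "0 < real k" using m mk by simp
  have "real T \<le> real k / real m" using m m0 by (simp add: le_divide_eq flip: of_nat_mult)
  then have "ln (real T) \<le> L" using T unfolding L_def by (intro ln_mono) auto
  then have L16: "16 \<le> L" using T by simp
  have "L \<le> real k / real m - 1" unfolding L_def using k0 m0 by (intro ln_le_minus_one) simp
  also have "\<dots> = (real k - real m) / real m" using m0 by (simp add: diff_divide_distrib)
  also have "\<dots> \<le> (real k - real m) / 1" using m mk by (intro divide_left_mono) auto
  finally have Lk: "q + L \<le> real k" using q by simp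
  have "s2 * (1 + (q + L) / real k) \<le> s2 * 2"
    using Lk k0 s2 by (intro mult_left_mono) (auto simp: divide_le_eq)
  also have "\<dots> \<le> (3 / 2 * real k + real k * L / 8) * 2"
  proof (rule mult_right_mono)
    have "s2 - Q < real k * L / 8" unfolding L_def by (rule le_less_trans[OF abs_ge_self tail])
    moreover have "Q - real k < 1 / 2 * real k" by (rule le_less_trans[OF abs_ge_self Q])
    ultimately show "s2 \<le> 3 / 2 * real k + real k * L / 8" by linarith
  qed simp
  also have "\<dots> = real k * (3 + L / 4)" by (simp add: algebra_simps)
  also have "\<dots> < real k * (L / 2)" using L16 k0 by (intro mult_strict_left_mono) auto
  also have "\<dots> \<le> (q + L) * (real k / 2)" using q k0 by (simp add: algebra_simps)
  also have "\<dots> \<le> (q + L) * Q"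
  proof (rule mult_left_mono)
    show "real k / 2 \<le> Q" using abs_ge_minus_self[of "Q - real k"] Q by linarith
  qed (use q L16 in simp)
  finally show ?thesis by (simp add: L_def)
qed

context std_walk
begin

text \<open>The exceptional event \<open>(S m)\<^sup>2 = m * Q m\<close>, where the first \<open>m\<close> observations coincide, is part of the
  lower bound: as \<open>Q m\<close> is of order \<open>m\<close>, it forces \<open>(S m)\<^sup>2\<close> to be of order \<open>m\<^sup>2\<close>, which costs \<open>2 / m\<close> by
  the Chebyshev inequality.\<close>

lemma studentized_sandwich:
  assumes D: "D \<in> sets P"
    and upper: "D \<subseteq> {\<omega> \<in> space P. \<exists>k\<ge>m. (q + ln (real k / real m)) * Q k \<omega>
        \<le> (S k \<omega>)\<^sup>2 * (1 + (q + ln (real k / real m)) / real k)}"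
    and lower: "{\<omega> \<in> space P. (S m \<omega>)\<^sup>2 \<noteq> real m * Q m \<omega> \<and>
        (\<exists>k\<ge>m. (q + ln (real k / real m)) * Q k \<omega>
          < (S k \<omega>)\<^sup>2 * (1 + (q + ln (real k / real m)) / real k))} \<subseteq> D"
    and m: "1 \<le> m" and T: "2 \<le> T" "16 \<le> ln (real T)" and q: "0 < q" "q \<le> real m"
    and \<eta>: "0 < \<eta>" "\<eta> \<le> 1 / 2" "K * real m powr (-\<kappa>) \<le> \<eta> / 2"
    and \<epsilon>: "(q + ln (real T)) * (\<eta> + (q + ln (real T)) / real m) \<le> \<epsilon>"
  defines "err \<equiv> (4 / \<eta>\<^sup>2 + 1) * (K * (1 + 1 / \<kappa>) * real m powr (-\<kappa>))"
  shows "prob D \<le> prob {\<omega> \<in> space P. \<exists>k\<in>{m..T * m}. real k * ((q - \<epsilon>) + ln (real k / real m)) \<le> (S k \<omega>)\<^sup>2}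
      + err + (256 / (ln (real T))\<^sup>2 + 256 / ln (real T))"
    and "prob {\<omega> \<in> space P. \<exists>k\<in>{m..T * m}. real k * ((q + \<epsilon>) + ln (real k / real m)) \<le> (S k \<omega>)\<^sup>2}
      \<le> prob D + err + 2 / real m"
proof -
  let ?cross = "\<lambda>q. {\<omega> \<in> space P. \<exists>k\<in>{m..T * m}. real k * (q + ln (real k / real m)) \<le> (S k \<omega>)\<^sup>2}"
  let ?G1 = "{\<omega> \<in> space P. \<exists>k\<ge>m. \<eta> * real k \<le> \<bar>Q k \<omega> - real k\<bar>}"
  let ?G2 = "{\<omega> \<in> space P. \<exists>k\<ge>T * m. real k * ln (real k / real m) / 8 \<le> \<bar>(S k \<omega>)\<^sup>2 - Q k \<omega>\<bar>}"
  let ?V = "{\<omega> \<in> space P. real m / 2 * real m \<le> (S m \<omega>)\<^sup>2}"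
  have ev: "?cross q' \<in> sets P" "?G1 \<in> sets P" "?G2 \<in> sets P" "?V \<in> sets P" for q'
    by measurable
  have G1: "prob ?G1 \<le> err"
    unfolding err_def by (rule sum_squares_law[OF m \<eta>(1,3)])
  have G2: "prob ?G2 \<le> 256 / (ln (real T))\<^sup>2 + 256 / ln (real T)"
    by (rule square_minus_sum_squares_tail[OF m T(1)])
  have V: "prob ?V \<le> 2 / real m"
    using S_chebyshev[of "real m / 2" m] m by simp
  have \<beta>0: "0 < q + ln (real T)" using q T by simp
  have \<beta>\<eta>: "(q + ln (real T)) * \<eta> < \<epsilon>"
  proof -
    have "(q + ln (real T)) * \<eta> < (q + ln (real T)) * (\<eta> + (q + ln (real T)) / real m)"
      using \<beta>0 m by (intro mult_strict_left_mono) auto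
    then show ?thesis using \<epsilon> by simp
  qed
  have \<epsilon>0: "0 \<le> \<epsilon>" using \<beta>\<eta> \<beta>0 \<eta>(1) by (smt (verit) mult_pos_pos)
  have "D \<subseteq> ?cross (q - \<epsilon>) \<union> (?G1 \<union> ?G2)"
  proof (rule subsetI, rule ccontr)
    fix \<omega> assume "\<omega> \<in> D" and out: "\<omega> \<notin> ?cross (q - \<epsilon>) \<union> (?G1 \<union> ?G2)"
    then obtain k where \<omega>: "\<omega> \<in> space P" and k: "m \<le> k"
      and hit: "(q + ln (real k / real m)) * Q k \<omega> \<le> (S k \<omega>)\<^sup>2 * (1 + (q + ln (real k / real m)) / real k)"
      using upper by blast
    have Qk: "\<bar>Q k \<omega> - real k\<bar> < \<eta> * real k" using out \<omega> k by force
    show False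
    proof (cases "k \<le> T * m")
      case True
      have "real k * ((q - \<epsilon>) + ln (real k / real m)) \<le> (S k \<omega>)\<^sup>2"
        by (rule crossing_of_studentized[OF m k True q(1) _ \<epsilon> _ \<epsilon>0 Qk hit]) (use \<eta> in auto)
      then show False using out \<omega> k True by auto
    next
      case False
      then have kT: "T * m \<le> k" by simp
      have "\<eta> * real k \<le> 1 / 2 * real k" using \<eta> by (intro mult_right_mono) auto
      then have Q2: "\<bar>Q k \<omega> - real k\<bar> < 1 / 2 * real k" using Qk by linarith
      have tail: "\<bar>(S k \<omega>)\<^sup>2 - Q k \<omega>\<bar> < real k * ln (real k / real m) / 8" using out \<omega> kT by force
      show False
        using no_studentized_crossing_in_tail[OF m kT _ T(2) q Q2 tail] hit T(1) by simp
    qed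
  qed
  then have "prob D \<le> prob (?cross (q - \<epsilon>) \<union> (?G1 \<union> ?G2))"
    by (rule finite_measure_mono[OF _ sets.Un[OF ev(1) sets.Un[OF ev(2,3)]]])
  also have "\<dots> \<le> prob (?cross (q - \<epsilon>)) + prob (?G1 \<union> ?G2)"
    by (rule measure_Un_le[OF ev(1) sets.Un[OF ev(2,3)]])
  also have "prob (?G1 \<union> ?G2) \<le> prob ?G1 + prob ?G2"
    by (rule measure_Un_le[OF ev(2,3)])
  finally show "prob D \<le> prob (?cross (q - \<epsilon>)) + err + (256 / (ln (real T))\<^sup>2 + 256 / ln (real T))"
    using G1 G2 by linarith
  have "?cross (q + \<epsilon>) \<subseteq> D \<union> (?G1 \<union> ?V)"
  proof (rule subsetI, rule ccontr)
    fix \<omega> assume "\<omega> \<in> ?cross (q + \<epsilon>)" and out: "\<omega> \<notin> D \<union> (?G1 \<union> ?V)"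
    then obtain k where \<omega>: "\<omega> \<in> space P" and k: "m \<le> k" "k \<le> T * m"
      and hit: "real k * ((q + \<epsilon>) + ln (real k / real m)) \<le> (S k \<omega>)\<^sup>2" by auto
    have Qb: "\<bar>Q j \<omega> - real j\<bar> < \<eta> * real j" if "m \<le> j" for j using out \<omega> that by force
    have "(q + ln (real k / real m)) * Q k \<omega> < (S k \<omega>)\<^sup>2 * (1 + (q + ln (real k / real m)) / real k)"
      by (rule studentized_of_crossing[OF m k q(1) _ \<beta>\<eta> _ Qb[OF k(1)] hit]) (use \<eta> in auto)
    moreover have "(S m \<omega>)\<^sup>2 \<noteq> real m * Q m \<omega>"
    proof
      assume eq: "(S m \<omega>)\<^sup>2 = real m * Q m \<omega>"
      have "\<eta> * real m \<le> 1 / 2 * real m" using \<eta> by (intro mult_right_mono) auto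
      then have "real m / 2 \<le> Q m \<omega>" using Qb[of m] by linarith
      then have "real m * (real m / 2) \<le> (S m \<omega>)\<^sup>2" unfolding eq by (rule mult_left_mono) simp
      then show False using out \<omega> by (simp add: mult.commute)
    qed
    ultimately have "\<omega> \<in> D" using lower \<omega> k(1) by blast
    then show False using out by simp
  qed
  then have "prob (?cross (q + \<epsilon>)) \<le> prob (D \<union> (?G1 \<union> ?V))"
    by (rule finite_measure_mono[OF _ sets.Un[OF D sets.Un[OF ev(2,4)]]])
  also have "\<dots> \<le> prob D + prob (?G1 \<union> ?V)"
    by (rule measure_Un_le[OF D sets.Un[OF ev(2,4)]])
  also have "prob (?G1 \<union> ?V) \<le> prob ?G1 + prob ?V"
    by (rule measure_Un_le[OF ev(2,4)])
  finally show "prob (?cross (q + \<epsilon>)) \<le> prob D + err + 2 / real m"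
    using G1 V by linarith
qed

end

lemma powr_neg_tendsto_0: "0 < \<kappa> \<Longrightarrow> (\<lambda>m. c * real m powr (-\<kappa>)) \<longlonglongrightarrow> 0"
  by (intro tendsto_mult_right_zero tendsto_neg_powr filterlim_real_sequentially) auto

lemma crossing_limit:
  fixes P :: "nat \<Rightarrow> 'a measure"
  assumes walk: "\<And>m. std_walk (P m) (Y m) \<kappa> K"
    and q: "0 < q" and T: "2 \<le> T" and \<rho>: "0 < \<rho>" "exp (- ln (real T) / 4) + 2 / ln (real T) \<le> \<rho>"
  shows "\<forall>\<^sub>F m in sequentially.
    \<bar>measure (P m) {\<omega> \<in> space (P m). \<exists>k\<in>{m..T * m}.
        real k * (q + ln (real k / real m)) \<le> (\<Sum>i=1..k. Y m i \<omega>)\<^sup>2} - gauss_crossing q\<bar> \<le> 4 * \<rho>"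
proof -
  interpret W: std_walk "P m" "Y m" \<kappa> K for m by (rule walk)
  define B where "B = reg_const (sqrt (real T * (q + ln (real T))))"
  have B: "0 \<le> B" using q T by (simp add: B_def reg_const_def)
  \<comment> \<open>the size of increment below which the overshoot contributes at most \<open>\<rho>\<close>\<close>
  define \<epsilon> where "\<epsilon> = min 1 (\<rho> / (B + 1))"
  have \<epsilon>: "0 < \<epsilon>" "\<epsilon> \<le> 1" using B \<rho> by (auto simp: \<epsilon>_def)
  have "B * \<epsilon> \<le> (B + 1) * (\<rho> / (B + 1))" using B \<epsilon> \<rho> by (intro mult_mono) (auto simp: \<epsilon>_def)
  then have B\<epsilon>: "B * \<epsilon> \<le> \<rho>" using B by simp
  let ?c = "real T * (B * (3 * (3 + K) + K / (\<epsilon>\<^sup>2) powr (1 + \<kappa>)))"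
  have "(\<lambda>m. ?c * real m powr (-\<kappa>)) \<longlonglongrightarrow> 0" by (rule powr_neg_tendsto_0) (rule W.kappa)
  then have "\<forall>\<^sub>F m in sequentially. ?c * real m powr (-\<kappa>) < \<rho>"
    by (rule order_tendstoD(2)) (rule \<rho>)
  moreover have "\<forall>\<^sub>F m in sequentially.
      dist (\<integral>\<omega>. clipped q ((\<Sum>i=1..m. Y m i \<omega>) / sqrt (real m)) \<partial>P m) (gauss_crossing q) < \<rho>"
    unfolding gauss_crossing_def
    by (rule tendstoD[OF uniform_clt[OF walk clipped_isCont]]) (use clipped_bounds \<rho> in \<open>auto intro!: abs_leI\<close>)
  moreover have "\<forall>\<^sub>F m in sequentially. 1 \<le> (m :: nat)" by (rule eventually_ge_at_top)
  ultimately show ?thesis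
  proof eventually_elim
    case (elim m)
    interpret H: horizon "P m" "Y m" \<kappa> K m T q by unfold_locales (use elim T q in auto)
    have R: "reg_const H.R = B" by (simp add: B_def H.R_def)
    show ?case
      using H.finite_horizon[OF T \<epsilon>] elim \<rho>(2) B\<epsilon>
      unfolding R W.S_def[symmetric] dist_real_def by linarith
  qed
qed

text \<open>The shift \<open>\<epsilon>\<close> of \<open>q\<close> and the horizon \<open>T\<close> are chosen first, then the relative error \<open>\<eta>\<close> of \<open>Q\<close> in
  terms of both; the error terms that remain vanish as \<open>m\<close> tends to infinity.
  The weak and the strict inequality bound the event from the two sides.\<close>

theorem studentized_crossing_limit:
  fixes P :: "nat \<Rightarrow> 'a measure"
  assumes walk: "\<And>m. std_walk (P m) (Y m) \<kappa> K" and q: "0 < q"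
    and D: "\<And>m. 1 \<le> m \<Longrightarrow> D m \<in> sets (P m)"
    and upper: "\<And>m. 1 \<le> m \<Longrightarrow> D m \<subseteq> {\<omega> \<in> space (P m). \<exists>k\<ge>m.
        (q + ln (real k / real m)) * (\<Sum>i=1..k. (Y m i \<omega>)\<^sup>2)
          \<le> (\<Sum>i=1..k. Y m i \<omega>)\<^sup>2 * (1 + (q + ln (real k / real m)) / real k)}"
    and lower: "\<And>m \<omega>. \<lbrakk>1 \<le> m; \<omega> \<in> space (P m);
        (\<Sum>i=1..m. Y m i \<omega>)\<^sup>2 \<noteq> real m * (\<Sum>i=1..m. (Y m i \<omega>)\<^sup>2);
        \<exists>k\<ge>m. (q + ln (real k / real m)) * (\<Sum>i=1..k. (Y m i \<omega>)\<^sup>2)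
          < (\<Sum>i=1..k. Y m i \<omega>)\<^sup>2 * (1 + (q + ln (real k / real m)) / real k)\<rbrakk> \<Longrightarrow> \<omega> \<in> D m"
  shows "(\<lambda>m. measure (P m) (D m)) \<longlonglongrightarrow> gauss_crossing q"
proof (rule tendstoI)
  fix r :: real assume r: "0 < r"
  interpret W: std_walk "P m" "Y m" \<kappa> K for m by (rule walk)
  \<comment> \<open>seven error terms: four in \<open>crossing_limit\<close>, one each for the shift of \<open>q\<close>, for \<open>Q\<close>, and for the
      far range (upper bound) or the degenerate start (lower bound)\<close>
  define \<rho> where "\<rho> = r / 10"
  have \<rho>: "0 < \<rho>" using r by (simp add: \<rho>_def)
  define \<epsilon> where "\<epsilon> = min (q / 2) \<rho>"
  have \<epsilon>: "0 < \<epsilon>" "\<epsilon> < q" "\<epsilon> \<le> \<rho>" using q \<rho> by (auto simp: \<epsilon>_def)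
  have lnT: "filterlim (\<lambda>T. ln (real T)) at_top sequentially"
    by (rule filterlim_compose[OF ln_at_top filterlim_real_sequentially])
  have "((\<lambda>x::real. exp (- x / 4) + 2 / x) \<longlongrightarrow> 0) at_top" by real_asymp
  from filterlim_compose[OF this lnT]
  have T1: "\<forall>\<^sub>F T in sequentially. exp (- ln (real T) / 4) + 2 / ln (real T) < \<rho>"
    by (rule order_tendstoD(2)) (rule \<rho>)
  have "((\<lambda>x::real. 256 / x\<^sup>2 + 256 / x) \<longlongrightarrow> 0) at_top" by real_asymp
  from filterlim_compose[OF this lnT]
  have T2: "\<forall>\<^sub>F T in sequentially. 256 / (ln (real T))\<^sup>2 + 256 / ln (real T) < \<rho>"
    by (rule order_tendstoD(2)) (rule \<rho>)
  have T3: "\<forall>\<^sub>F T in sequentially. 16 \<le> ln (real T)"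
    using lnT by (simp add: filterlim_at_top)
  have "\<forall>\<^sub>F T in sequentially. 2 \<le> T \<and> 16 \<le> ln (real T) \<and>
      exp (- ln (real T) / 4) + 2 / ln (real T) < \<rho> \<and> 256 / (ln (real T))\<^sup>2 + 256 / ln (real T) < \<rho>"
    using T1 T2 T3 eventually_ge_at_top[of 2] by eventually_elim auto
  then obtain T :: nat where T: "2 \<le> T" "16 \<le> ln (real T)"
      "exp (- ln (real T) / 4) + 2 / ln (real T) \<le> \<rho>"
      "256 / (ln (real T))\<^sup>2 + 256 / ln (real T) < \<rho>"
    by (auto simp: eventually_sequentially dest!: spec[of _ _] intro: less_imp_le)
  define \<beta> where "\<beta> = q + ln (real T)"
  have \<beta>: "0 < \<beta>" using q T by (simp add: \<beta>_def)
  \<comment> \<open>a relative error \<open>\<eta>\<close> in \<open>Q\<close> shifts a boundary of height at most \<open>\<beta>\<close> by at most \<open>\<epsilon> / 2\<close>\<close>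
  define \<eta> where "\<eta> = min (1 / 2) (\<epsilon> / (2 * \<beta>))"
  have \<eta>: "0 < \<eta>" "\<eta> \<le> 1 / 2" "\<eta> \<le> \<epsilon> / (2 * \<beta>)" using \<beta> \<epsilon> by (auto simp: \<eta>_def)
  have "\<beta> * \<eta> \<le> \<beta> * (\<epsilon> / (2 * \<beta>))" using \<eta> \<beta> by (intro mult_left_mono) auto
  then have \<beta>\<eta>: "\<beta> * \<eta> \<le> \<epsilon> / 2" using \<beta> by simp
  have e1: "\<forall>\<^sub>F m in sequentially. K * real m powr (-\<kappa>) < \<eta> / 2"
    by (rule order_tendstoD(2)[OF powr_neg_tendsto_0[OF W.kappa(1)]]) (use \<eta> in simp)
  have e2: "\<forall>\<^sub>F m in sequentially. (4 / \<eta>\<^sup>2 + 1) * (K * (1 + 1 / \<kappa>)) * real m powr (-\<kappa>) < \<rho>"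
    by (rule order_tendstoD(2)[OF powr_neg_tendsto_0[OF W.kappa(1)]]) (rule \<rho>)
  have "(\<lambda>m. 2 / real m) \<longlonglongrightarrow> 0" by real_asymp
  then have e3: "\<forall>\<^sub>F m in sequentially. 2 / real m < \<rho>"
    by (rule order_tendstoD(2)) (rule \<rho>)
  have "(\<lambda>m. \<beta> * \<beta> * (1 / real m)) \<longlonglongrightarrow> \<beta> * \<beta> * 0"
    by (intro tendsto_mult tendsto_const lim_1_over_n)
  then have e4: "\<forall>\<^sub>F m in sequentially. \<beta> * \<beta> * (1 / real m) < \<epsilon> / 2"
    by (rule order_tendstoD(2)) (use \<epsilon> in simp)
  have e5: "\<forall>\<^sub>F m in sequentially. q \<le> real m"
    using filterlim_real_sequentially by (simp add: filterlim_at_top)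
  have c1: "\<forall>\<^sub>F m in sequentially. \<bar>measure (P m) {\<omega> \<in> space (P m). \<exists>k\<in>{m..T * m}.
        real k * ((q - \<epsilon>) + ln (real k / real m)) \<le> (\<Sum>i=1..k. Y m i \<omega>)\<^sup>2} - gauss_crossing (q - \<epsilon>)\<bar> \<le> 4 * \<rho>"
    by (rule crossing_limit[OF walk _ T(1) \<rho> T(3)]) (use \<epsilon> in simp)
  have c2: "\<forall>\<^sub>F m in sequentially. \<bar>measure (P m) {\<omega> \<in> space (P m). \<exists>k\<in>{m..T * m}.
        real k * ((q + \<epsilon>) + ln (real k / real m)) \<le> (\<Sum>i=1..k. Y m i \<omega>)\<^sup>2} - gauss_crossing (q + \<epsilon>)\<bar> \<le> 4 * \<rho>"
    by (rule crossing_limit[OF walk _ T(1) \<rho> T(3)]) (use \<epsilon> q in simp)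
  have lip: "gauss_crossing (q - \<epsilon>) \<le> gauss_crossing q + \<rho>" "gauss_crossing q \<le> gauss_crossing (q + \<epsilon>) + \<rho>"
    using gauss_crossing_Lipschitz[of "q - \<epsilon>" q] gauss_crossing_Lipschitz[of q "q + \<epsilon>"] \<epsilon> by auto
  show "\<forall>\<^sub>F m in sequentially. dist (measure (P m) (D m)) (gauss_crossing q) < r"
    using e1 e2 e3 e4 e5 c1 c2 eventually_ge_at_top[of 1]
  proof eventually_elim
    case (elim m)
    have \<beta>m: "(q + ln (real T)) * (\<eta> + (q + ln (real T)) / real m) \<le> \<epsilon>"
    proof -
      have "\<beta> * (\<beta> / real m) = \<beta> * \<beta> * (1 / real m)" by simp
      then show ?thesis
        unfolding \<beta>_def[symmetric] distrib_left using \<beta>\<eta> elim(4) by linarith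
    qed
    have K: "K * real m powr (-\<kappa>) \<le> \<eta> / 2" using elim(1) by simp
    note sandwich = W.studentized_sandwich[OF D[OF elim(8)], of m q T \<eta> \<epsilon>, OF _ _ elim(8) T(1,2) q elim(5) \<eta>(1,2) K \<beta>m]
    have up: "D m \<subseteq> {\<omega> \<in> space (P m). \<exists>k\<ge>m. (q + ln (real k / real m)) * W.Q m k \<omega>
        \<le> (W.S m k \<omega>)\<^sup>2 * (1 + (q + ln (real k / real m)) / real k)}"
      using upper[OF elim(8)] by (simp add: W.Q_def W.S_def)
    have lo: "{\<omega> \<in> space (P m). (W.S m m \<omega>)\<^sup>2 \<noteq> real m * W.Q m m \<omega> \<and>
        (\<exists>k\<ge>m. (q + ln (real k / real m)) * W.Q m k \<omega>
          < (W.S m k \<omega>)\<^sup>2 * (1 + (q + ln (real k / real m)) / real k))} \<subseteq> D m"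
      using lower[OF elim(8)] by (auto simp: W.Q_def W.S_def)
    have err: "(4 / \<eta>\<^sup>2 + 1) * (K * (1 + 1 / \<kappa>) * real m powr (-\<kappa>)) < \<rho>"
      using elim(2) by (simp add: mult.assoc)
    have "measure (P m) (D m) \<le> gauss_crossing q + 7 * \<rho>"
      using sandwich(1)[OF up lo] elim(6) err lip(1) T(4) unfolding W.S_def by linarith
    moreover have "gauss_crossing q \<le> measure (P m) (D m) + 7 * \<rho>"
      using sandwich(2)[OF up lo] elim(7) err lip(2) elim(3) unfolding W.S_def by linarith
    ultimately show ?case using \<rho> by (simp add: dist_real_def \<rho>_def abs_less_iff)
  qed
qed

section \<open>From the data to the standardised walk\<close>

definition standardized :: "'a measure \<Rightarrow> (nat \<Rightarrow> 'a \<Rightarrow> real) \<Rightarrow> nat \<Rightarrow> 'a \<Rightarrow> real" where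
  "standardized P X i \<omega> =
     (X i \<omega> - prob_space.expectation P (X 1)) / sqrt (prob_space.variance P (X 1))"

lemma powr_le_one_plus_powr:
  fixes x a b :: real
  assumes "0 \<le> x" "0 \<le> a" "a \<le> b"
  shows "x powr a \<le> 1 + x powr b"
proof (cases "x \<le> 1")
  case True
  have "x powr a \<le> 1 powr a" using assms True by (intro powr_mono2) auto
  then show ?thesis by (simp add: add_increasing2)
next
  case False
  then have "x powr a \<le> x powr b" using assms by (intro powr_mono) auto
  then show ?thesis by simp
qed

text \<open>With \<open>\<kappa> \<le> 1 / 2\<close> the moment has order at most three, the order of the Taylor remainder, whence
  \<open>min \<delta> 1\<close>; the constant depends only on
  the moment bound \<open>C\<close> and the lower bound \<open>v0\<close> of the variance.\<close>

lemma std_walk_standardized: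
  fixes P :: "'a measure"
  assumes "prob_space P" and iid: "iid P X" and \<delta>: "0 < \<delta>"
    and moment: "(\<integral>\<^sup>+ \<omega>. ennreal (\<bar>X 1 \<omega> - prob_space.expectation P (X 1)\<bar> powr (2 + \<delta>)) \<partial>P) \<le> ennreal C"
    and C: "0 \<le> C" and v0: "0 < v0" "v0 \<le> prob_space.variance P (X 1)"
  shows "std_walk P (standardized P X) (min \<delta> 1 / 2) ((1 + C) / v0 powr (1 + min \<delta> 1 / 2))"
proof -
  interpret prob_space P by fact
  define \<mu> where "\<mu> = expectation (X 1)"
  define v where "v = variance (X 1)"
  define \<kappa> where "\<kappa> = min \<delta> 1 / 2"
  have \<kappa>: "0 < \<kappa>" "\<kappa> \<le> 1 / 2" "2 * \<kappa> \<le> \<delta>" using \<delta> by (auto simp: \<kappa>_def)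
  have v: "0 < v" "v0 \<le> v" using v0 by (auto simp: v_def)
  let ?Y = "standardized P X"
  have Y: "?Y i \<omega> = (X i \<omega> - \<mu>) / sqrt v" for i \<omega> by (simp add: standardized_def \<mu>_def v_def)
  have ind: "indep_vars (\<lambda>_. borel) X {1..}" and same: "\<And>n. 1 \<le> n \<Longrightarrow> distr P borel (X n) = distr P borel (X 1)"
    using iid unfolding iid_def by blast+
  have X_m [measurable]: "X i \<in> borel_measurable P" if "1 \<le> i" for i
    using ind that by (auto simp: indep_vars_def)
  note [measurable] = X_m[of 1, simplified]
  let ?f = "\<lambda>\<omega>. \<bar>X 1 \<omega> - \<mu>\<bar> powr (2 + \<delta>)"
  have f_int: "integrable P ?f"
  proof (rule integrableI_nonneg)
    show "(\<integral>\<^sup>+ \<omega>. ennreal (?f \<omega>) \<partial>P) < \<infinity>"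
      using moment unfolding \<mu>_def by (rule le_less_trans) simp
  qed auto
  have f_le: "expectation ?f \<le> C"
  proof -
    have "ennreal (expectation ?f) = (\<integral>\<^sup>+ \<omega>. ennreal (?f \<omega>) \<partial>P)"
      by (rule nn_integral_eq_integral[symmetric, OF f_int]) simp
    also have "\<dots> \<le> ennreal C" using moment unfolding \<mu>_def .
    finally show ?thesis using C by simp
  qed
  have dom: "integrable P (\<lambda>\<omega>. \<bar>X 1 \<omega> - \<mu>\<bar> powr a)" if "0 \<le> a" "a \<le> 2 + \<delta>" for a
  proof (rule Bochner_Integration.integrable_bound[where f = "\<lambda>\<omega>. 1 + ?f \<omega>"])
    show "AE \<omega> in P. norm (\<bar>X 1 \<omega> - \<mu>\<bar> powr a) \<le> norm (1 + ?f \<omega>)"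
      using powr_le_one_plus_powr[OF _ that] by (intro AE_I2) simp
  qed (use f_int in auto)
  have "integrable P (\<lambda>\<omega>. \<bar>X 1 \<omega> - \<mu>\<bar>)" using dom[of 1] \<delta> by (simp add: powr_one_gt_zero_iff powr_one')
  then have "integrable P (\<lambda>\<omega>. X 1 \<omega> - \<mu>)" by (rule integrable_abs_cancel) simp
  then have "integrable P (\<lambda>\<omega>. (X 1 \<omega> - \<mu>) + \<mu>)" by (intro Bochner_Integration.integrable_add) auto
  then have X_int: "integrable P (X 1)" by simp
  have square: "(?Y 1 \<omega>)\<^sup>2 powr (1 + \<kappa>) = \<bar>X 1 \<omega> - \<mu>\<bar> powr (2 + 2 * \<kappa>) / v powr (1 + \<kappa>)" for \<omega>
  proof -
    have "(?Y 1 \<omega>)\<^sup>2 = (X 1 \<omega> - \<mu>)\<^sup>2 / v" using v by (simp add: Y power_divide)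
    then have "(?Y 1 \<omega>)\<^sup>2 powr (1 + \<kappa>) = ((X 1 \<omega> - \<mu>)\<^sup>2) powr (1 + \<kappa>) / v powr (1 + \<kappa>)"
      using v by (simp add: powr_divide)
    also have "((X 1 \<omega> - \<mu>)\<^sup>2) powr (1 + \<kappa>) = \<bar>X 1 \<omega> - \<mu>\<bar> powr (2 + 2 * \<kappa>)"
    proof (cases "X 1 \<omega> = \<mu>")
      case False
      then have "(X 1 \<omega> - \<mu>)\<^sup>2 = \<bar>X 1 \<omega> - \<mu>\<bar> powr 2" by (simp add: powr_numeral)
      then show ?thesis by (simp only: powr_powr distrib_left mult_1_right)
    qed simp
    finally show ?thesis .
  qed
  show ?thesis
    unfolding \<kappa>_def[symmetric]
  proof (unfold_locales)
    show "indep_vars (\<lambda>_. borel) ?Y {1..}"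
      unfolding standardized_def[abs_def] by (rule indep_vars_compose2[OF ind]) auto
    fix i :: nat assume i: "1 \<le> i"
    note [measurable] = X_m[OF i]
    have "distr P borel (?Y j) = distr (distr P borel (X j)) borel (\<lambda>x. (x - \<mu>) / sqrt v)" if "1 \<le> j" for j
      using X_m[OF that] by (subst distr_distr) (auto simp: comp_def Y[abs_def])
    then show "distr P borel (?Y i) = distr P borel (?Y 1)" using same[OF i] i by simp
  next
    have "expectation (\<lambda>\<omega>. (X 1 \<omega> - \<mu>) / sqrt v) = 0"
      using X_int by (simp add: \<mu>_def prob_space)
    then show "expectation (?Y 1) = 0" by (simp add: Y[abs_def])
    have "expectation (\<lambda>\<omega>. (?Y 1 \<omega>)\<^sup>2) = expectation (\<lambda>\<omega>. (X 1 \<omega> - \<mu>)\<^sup>2 / v)"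
      using v by (simp add: Y power_divide)
    also have "\<dots> = 1" using v by (simp add: v_def \<mu>_def)
    finally show "expectation (\<lambda>\<omega>. (?Y 1 \<omega>)\<^sup>2) = 1" .
    show "0 < \<kappa>" "\<kappa> \<le> 1 / 2" by (rule \<kappa>)+
    have int: "integrable P (\<lambda>\<omega>. \<bar>X 1 \<omega> - \<mu>\<bar> powr (2 + 2 * \<kappa>))" using \<kappa> by (intro dom) auto
    then show "integrable P (\<lambda>\<omega>. (?Y 1 \<omega>)\<^sup>2 powr (1 + \<kappa>))" unfolding square by simp
    have "expectation (\<lambda>\<omega>. \<bar>X 1 \<omega> - \<mu>\<bar> powr (2 + 2 * \<kappa>)) \<le> expectation (\<lambda>\<omega>. 1 + ?f \<omega>)"
      using \<kappa> by (intro integral_mono int powr_le_one_plus_powr) (use f_int in auto)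
    also have "\<dots> \<le> 1 + C" using f_int f_le by (simp add: prob_space)
    finally have "expectation (\<lambda>\<omega>. (?Y 1 \<omega>)\<^sup>2 powr (1 + \<kappa>)) \<le> (1 + C) / v powr (1 + \<kappa>)"
      unfolding square by (simp add: divide_right_mono)
    also have "\<dots> \<le> (1 + C) / v0 powr (1 + \<kappa>)"
      using v v0 C \<kappa> by (intro divide_left_mono powr_mono2 mult_pos_pos) auto
    finally show "expectation (\<lambda>\<omega>. (?Y 1 \<omega>)\<^sup>2 powr (1 + \<kappa>)) \<le> (1 + C) / v0 powr (1 + \<kappa>)" .
  qed
qed

lemma sum_sq_deviation:
  fixes y :: "nat \<Rightarrow> real"
  assumes "1 \<le> k"
  shows "(\<Sum>i=1..k. (y i - (\<Sum>j=1..k. y j) / real k)\<^sup>2) = (\<Sum>i=1..k. (y i)\<^sup>2) - (\<Sum>i=1..k. y i)\<^sup>2 / real k"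
proof -
  define c where "c = (\<Sum>j=1..k. y j) / real k"
  have "(\<Sum>i=1..k. (y i - c)\<^sup>2) = (\<Sum>i=1..k. (y i)\<^sup>2 + c\<^sup>2 - 2 * c * y i)"
    by (intro sum.cong refl) (simp add: power2_diff)
  also have "\<dots> = (\<Sum>i=1..k. (y i)\<^sup>2) + real k * c\<^sup>2 - 2 * c * (\<Sum>i=1..k. y i)"
    by (simp add: sum_subtractf sum.distrib flip: sum_distrib_left)
  also have "\<dots> = (\<Sum>i=1..k. (y i)\<^sup>2) - (\<Sum>i=1..k. y i)\<^sup>2 / real k"
    using assms by (simp add: c_def power2_eq_square)
  finally show ?thesis by (simp add: c_def)
qed

text \<open>Both events are determined by \<open>S = (\<Sum>i=1..k. y i)\<close> and \<open>Q = (\<Sum>i=1..k. (y i)\<^sup>2)\<close>: with the sample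
  variance \<open>v * (Q / k - (S / k)\<^sup>2)\<close>, the statistic reaches \<open>b\<close> iff \<open>b * Q \<le> S\<^sup>2 * (1 + b / k)\<close>.\<close>

context
  fixes X :: "nat \<Rightarrow> 'a \<Rightarrow> real" and \<omega> :: 'a and \<mu> v \<alpha> :: real and y :: "nat \<Rightarrow> real" and m k :: nat
  assumes v: "0 < v" and X: "\<And>i. X i \<omega> = \<mu> + sqrt v * y i"
    and \<alpha>: "0 < \<alpha>" "\<alpha> < 1" and mk: "1 \<le> m" "m \<le> k"
begin

lemma sample_mean_standardized: "sample_mean X k \<omega> = \<mu> + sqrt v * ((\<Sum>i=1..k. y i) / real k)"
  using mk by (simp add: sample_mean_def X sum.distrib field_simps flip: sum_distrib_left)

lemma sample_var_standardized:
  "sample_var X k \<omega> = v * ((\<Sum>i=1..k. (y i)\<^sup>2) / real k - ((\<Sum>i=1..k. y i) / real k)\<^sup>2)"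
proof -
  have k0: "1 \<le> k" using mk by simp
  have "(X i \<omega> - sample_mean X k \<omega>)\<^sup>2 = v * (y i - (\<Sum>j=1..k. y j) / real k)\<^sup>2" for i
  proof -
    have "X i \<omega> - sample_mean X k \<omega> = sqrt v * (y i - (\<Sum>j=1..k. y j) / real k)"
      unfolding sample_mean_standardized X by (simp add: right_diff_distrib)
    then show ?thesis using v by (simp add: power_mult_distrib)
  qed
  then have "sample_var X k \<omega> = 1 / real k * (\<Sum>i=1..k. v * (y i - (\<Sum>j=1..k. y j) / real k)\<^sup>2)"
    unfolding sample_var_def by simp
  also have "\<dots> = v * ((\<Sum>i=1..k. (y i)\<^sup>2) / real k - ((\<Sum>i=1..k. y i) / real k)\<^sup>2)"
    unfolding sum_distrib_left[symmetric] sum_sq_deviation[OF k0]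
    by (simp add: right_diff_distrib diff_divide_distrib power_divide power2_eq_square)
  finally show ?thesis .
qed

lemma boundary_pos: "0 < RS_quantile (1 - \<alpha>) + ln (real k / real m)"
proof -
  have "0 \<le> ln (real k / real m)" using mk by (simp add: ln_ge_zero)
  then show ?thesis using RS_quantile(1)[of "1 - \<alpha>"] \<alpha> by simp
qed

lemma p_value_le_iff:
  assumes "\<mu> = 0"
  shows "p_value X m k \<omega> \<le> \<alpha> \<longleftrightarrow> 0 < sample_var X k \<omega> \<and>
    (RS_quantile (1 - \<alpha>) + ln (real k / real m)) * (\<Sum>i=1..k. (y i)\<^sup>2)
      \<le> (\<Sum>i=1..k. y i)\<^sup>2 * (1 + (RS_quantile (1 - \<alpha>) + ln (real k / real m)) / real k)"
proof -
  let ?q = "RS_quantile (1 - \<alpha>)" and ?l = "ln (real k / real m)"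
  define S Q where "S = (\<Sum>i=1..k. y i)" and "Q = (\<Sum>i=1..k. (y i)\<^sup>2)"
  define b where "b = ?q + ?l"
  define V where "V = Q / real k - (S / real k)\<^sup>2"
  have k0: "0 < real k" using mk by simp
  have b0: "0 < b" using boundary_pos by (simp add: b_def)
  have var: "sample_var X k \<omega> = v * V" unfolding sample_var_standardized by (simp add: V_def S_def Q_def)
  have "0 \<le> sample_var X k \<omega>" by (simp add: sample_var_def sum_nonneg)
  then have V0: "0 \<le> V" using v by (simp add: var zero_le_mult_iff)
  have mean: "sample_mean X k \<omega> = sqrt v * (S / real k)"
    unfolding sample_mean_standardized by (simp add: assms S_def)
  have level: "0 < 1 - \<alpha>" "1 - \<alpha> < 1" using \<alpha> by simp_all
  have "p_value X m k \<omega> \<le> \<alpha> \<longleftrightarrow> 1 - \<alpha> \<le> RS_cdf (real k * (sample_mean X k \<omega>)\<^sup>2 / sample_var X k \<omega> - ?l)"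
    by (auto simp: p_value_def)
  also have "\<dots> \<longleftrightarrow> b \<le> real k * (sample_mean X k \<omega>)\<^sup>2 / sample_var X k \<omega>"
    using RS_cdf_ge_iff[OF level, of "real k * (sample_mean X k \<omega>)\<^sup>2 / sample_var X k \<omega> - ?l"]
    by (simp only: b_def le_diff_eq)
  also have "real k * (sample_mean X k \<omega>)\<^sup>2 / sample_var X k \<omega> = real k * (S / real k)\<^sup>2 / V"
  proof -
    have "(sqrt v * (S / real k))\<^sup>2 = v * (S / real k)\<^sup>2"
      unfolding power_mult_distrib using v by (subst real_sqrt_pow2) simp_all
    then have "real k * (sample_mean X k \<omega>)\<^sup>2 / sample_var X k \<omega> = (v * (real k * (S / real k)\<^sup>2)) / (v * V)"
      unfolding mean var by (simp only: mult.left_commute)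
    also have "\<dots> = real k * (S / real k)\<^sup>2 / V"
      by (rule mult_divide_mult_cancel_left) (use v in simp)
    finally show ?thesis .
  qed
  also have "b \<le> real k * (S / real k)\<^sup>2 / V \<longleftrightarrow> 0 < V \<and> b * Q \<le> S\<^sup>2 * (1 + b / real k)"
  proof (cases "V = 0")
    case True
    then show ?thesis using b0 by simp
  next
    case False
    then have Vp: "0 < V" using V0 by simp
    have "b \<le> real k * (S / real k)\<^sup>2 / V \<longleftrightarrow> b * V \<le> real k * (S / real k)\<^sup>2"
      using Vp by (simp add: le_divide_eq)
    also have "\<dots> \<longleftrightarrow> real k * (b * V) \<le> real k * (real k * (S / real k)\<^sup>2)"
      using k0 by simp
    also have "real k * (real k * (S / real k)\<^sup>2) = S\<^sup>2" using k0 by (simp add: power_divide power2_eq_square)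
    also have "real k * (b * V) = b * Q - S\<^sup>2 * (b / real k)"
      using k0 by (simp add: V_def field_simps power2_eq_square)
    finally show ?thesis using Vp by (auto simp: distrib_left)
  qed
  finally show ?thesis using v by (simp add: var zero_less_mult_iff b_def S_def Q_def)
qed

lemma not_in_conf_set_iff:
  "\<mu> \<notin> conf_set X m k \<alpha> \<omega> \<longleftrightarrow>
    (RS_quantile (1 - \<alpha>) + ln (real k / real m)) * (\<Sum>i=1..k. (y i)\<^sup>2)
      < (\<Sum>i=1..k. y i)\<^sup>2 * (1 + (RS_quantile (1 - \<alpha>) + ln (real k / real m)) / real k)"
proof -
  define S Q where "S = (\<Sum>i=1..k. y i)" and "Q = (\<Sum>i=1..k. (y i)\<^sup>2)"
  define b where "b = RS_quantile (1 - \<alpha>) + ln (real k / real m)"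
  define V where "V = Q / real k - (S / real k)\<^sup>2"
  have k0: "0 < real k" using mk by simp
  have var: "sample_var X k \<omega> = v * V" unfolding sample_var_standardized by (simp add: V_def S_def Q_def)
  have "\<mu> \<notin> conf_set X m k \<alpha> \<omega> \<longleftrightarrow>
      sample_sd X k \<omega> * sqrt (b / real k) < \<bar>sqrt v * (S / real k)\<bar>"
  proof -
    have "\<mu> \<notin> {\<mu> + d - r..\<mu> + d + r} \<longleftrightarrow> r < \<bar>d\<bar>" for d r :: real
      unfolding atLeastAtMost_iff by linarith
    then show ?thesis
      unfolding conf_set_def pm_interval_def sample_mean_standardized b_def S_def .
  qed
  also have "sample_sd X k \<omega> * sqrt (b / real k) = sqrt v * sqrt (V * (b / real k))"
    by (simp only: sample_sd_def var real_sqrt_mult mult.assoc)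
  also have "\<bar>sqrt v * (S / real k)\<bar> = sqrt v * sqrt ((S / real k)\<^sup>2)"
    using v by (simp add: abs_mult)
  also have "sqrt v * sqrt (V * (b / real k)) < sqrt v * sqrt ((S / real k)\<^sup>2)
      \<longleftrightarrow> V * (b / real k) < (S / real k)\<^sup>2"
    using v by (simp only: mult_less_cancel_left_pos real_sqrt_gt_0_iff real_sqrt_less_iff)
  also have "\<dots> \<longleftrightarrow> real k * real k * (V * (b / real k)) < real k * real k * (S / real k)\<^sup>2"
    using mult_less_cancel_left_pos[OF mult_pos_pos[OF k0 k0]] by blast
  also have "real k * real k * (S / real k)\<^sup>2 = S\<^sup>2" using k0 by (simp add: power_divide power2_eq_square)
  also have "real k * real k * (V * (b / real k)) = b * Q - S\<^sup>2 * (b / real k)"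
    using k0 by (simp add: V_def field_simps power2_eq_square)
  also have "b * Q - S\<^sup>2 * (b / real k) < S\<^sup>2 \<longleftrightarrow> b * Q < S\<^sup>2 * (1 + b / real k)"
    by (auto simp: distrib_left)
  finally show ?thesis by (simp add: b_def S_def Q_def)
qed

text \<open>A vanishing sample variance forces all observations so far to coincide.\<close>

lemma sample_var_pos:
  assumes "(\<Sum>i=1..m. y i)\<^sup>2 \<noteq> real m * (\<Sum>i=1..m. (y i)\<^sup>2)"
  shows "0 < sample_var X k \<omega>"
proof (rule ccontr)
  have k0: "1 \<le> k" using mk by simp
  define c where "c = (\<Sum>j=1..k. y j) / real k"
  assume "\<not> 0 < sample_var X k \<omega>"
  moreover have "0 \<le> sample_var X k \<omega>" by (simp add: sample_var_def sum_nonneg)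
  ultimately have "sample_var X k \<omega> = 0" by simp
  then have "(\<Sum>i=1..k. (y i)\<^sup>2) / real k = ((\<Sum>i=1..k. y i) / real k)\<^sup>2"
    unfolding sample_var_standardized using v by simp
  then have "(\<Sum>i=1..k. (y i)\<^sup>2) - (\<Sum>i=1..k. y i)\<^sup>2 / real k = 0"
    using k0 by (simp add: field_simps power2_eq_square)
  then have "(\<Sum>i=1..k. (y i - c)\<^sup>2) = 0"
    using sum_sq_deviation[OF k0, of y] by (simp add: c_def)
  then have "y i = c" if "i \<in> {1..k}" for i
    using that by (subst (asm) sum_nonneg_eq_0_iff) auto
  then have "y i = c" if "i \<in> {1..m}" for i using that mk by auto
  then have "(\<Sum>i=1..m. y i) = real m * c" "(\<Sum>i=1..m. (y i)\<^sup>2) = real m * c\<^sup>2" by simp_all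
  then show False using assms by (simp add: power2_eq_square)
qed

end

text \<open>Apply the hypothesis to points that attain the supremum up to \<open>1 / Suc m\<close>.\<close>

lemma SUP_tendsto_of_sequences:
  fixes f :: "nat \<Rightarrow> 'b \<Rightarrow> real"
  assumes ne: "A \<noteq> {}" and bound: "\<And>m x. x \<in> A \<Longrightarrow> f m x \<le> B"
    and seq: "\<And>x. (\<And>m. x m \<in> A) \<Longrightarrow> (\<lambda>m. f m (x m)) \<longlonglongrightarrow> L"
  shows "(\<lambda>m. SUP x\<in>A. f m x) \<longlonglongrightarrow> L"
proof -
  have bdd: "bdd_above (f m ` A)" for m using bound by (intro bdd_aboveI[where M = B]) auto
  have "\<exists>x\<in>A. (SUP x\<in>A. f m x) - 1 / real (Suc m) < f m x" for m
    using less_cSUP_iff[OF ne bdd[of m], of "(SUP x\<in>A. f m x) - 1 / real (Suc m)"] by simp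
  then obtain x where x: "\<And>m. x m \<in> A" "\<And>m. (SUP x\<in>A. f m x) - 1 / real (Suc m) < f m (x m)"
    by metis
  show ?thesis
  proof (rule tendsto_sandwich)
    show "(\<lambda>m. f m (x m)) \<longlonglongrightarrow> L" by (rule seq[OF x(1)])
    show "(\<lambda>m. f m (x m) + 1 / real (Suc m)) \<longlonglongrightarrow> L"
      using tendsto_add[OF seq[OF x(1)] lim_inverse_n'[THEN LIMSEQ_Suc]] by simp
    show "\<forall>\<^sub>F m in sequentially. f m (x m) \<le> (SUP x\<in>A. f m x)"
      by (intro always_eventually allI cSUP_upper x(1) bdd)
    show "\<forall>\<^sub>F m in sequentially. (SUP x\<in>A. f m x) \<le> f m (x m) + 1 / real (Suc m)"
      using x(2) by (intro always_eventually allI) (smt (verit))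
  qed
qed

theorem theorem3p3:
  fixes M :: "'a measure"
    and \<P> \<P>\<^sub>0 :: "'a measure set"
    and X :: "nat \<Rightarrow> 'a \<Rightarrow> real"
    and \<delta> \<alpha> :: real
  assumes prob: "\<And>P. P \<in> \<P> \<Longrightarrow> prob_space P \<and> sets P = sets M"
    and rv: "\<And>n. n \<ge> 1 \<Longrightarrow> X n \<in> borel_measurable M"
    and iid: "\<And>P. P \<in> \<P> \<Longrightarrow> iid P X"
    and delta: "\<delta> > 0"
    and moment: "(SUP P\<in>\<P>. \<integral>\<^sup>+ \<omega>.
        ennreal (\<bar>X 1 \<omega> - prob_space.expectation P (X 1)\<bar> powr (2 + \<delta>)) \<partial>P) < \<infinity>"
    and var: "(INF P\<in>\<P>. prob_space.variance P (X 1)) > 0"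
    and P0: "\<P>\<^sub>0 = {P \<in> \<P>. prob_space.expectation P (X 1) = 0}"
    and P0_nonempty: "\<P>\<^sub>0 \<noteq> {}"
    and alpha: "0 < \<alpha>" "\<alpha> < 1"
  shows "(\<lambda>m. SUP P\<in>\<P>\<^sub>0. prob_space.prob P {\<omega> \<in> space P. \<exists>k\<ge>m. p_value X m k \<omega> \<le> \<alpha>})
           \<longlonglongrightarrow> \<alpha> \<and>
         (\<lambda>m. SUP P\<in>\<P>. prob_space.prob P
             {\<omega> \<in> space P. \<exists>k\<ge>m. prob_space.expectation P (X 1) \<notin> conf_set X m k \<alpha> \<omega>})
           \<longlonglongrightarrow> \<alpha>"
proof -
  define C where "C = enn2real (SUP P\<in>\<P>. \<integral>\<^sup>+ \<omega>.
        ennreal (\<bar>X 1 \<omega> - prob_space.expectation P (X 1)\<bar> powr (2 + \<delta>)) \<partial>P)"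
  define v0 where "v0 = (INF P\<in>\<P>. prob_space.variance P (X 1))"
  define q where "q = RS_quantile (1 - \<alpha>)"
  let ?\<mu> = "\<lambda>P. prob_space.expectation P (X 1)" and ?v = "\<lambda>P. prob_space.variance P (X 1)"
  let ?\<kappa> = "min \<delta> 1 / 2"
  let ?K = "(1 + C) / v0 powr (1 + ?\<kappa>)"
  let ?b = "\<lambda>m k :: nat. q + ln (real k / real m)"
  let ?S = "\<lambda>P k \<omega>. \<Sum>i=1..k. standardized P X i \<omega>"
  let ?Q = "\<lambda>P k \<omega>. \<Sum>i=1..k. (standardized P X i \<omega>)\<^sup>2"
  have q: "0 < q" using RS_quantile(1)[of "1 - \<alpha>"] alpha by (simp add: q_def)
  have limit: "gauss_crossing q = \<alpha>"
    using gauss_crossing_eq[of q] RS_quantile(2)[of "1 - \<alpha>"] alpha q by (simp add: q_def)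
  have v_ge: "v0 \<le> ?v P" if "P \<in> \<P>" for P
  proof -
    have "0 \<le> ?v P'" for P' :: "'a measure" by (rule Bochner_Integration.integral_nonneg) simp
    then show ?thesis unfolding v0_def using that by (intro cINF_lower bdd_belowI[where m = 0]) auto
  qed
  then have v_pos: "0 < ?v P" if "P \<in> \<P>" for P using var that by (force simp: v0_def)
  have walk: "std_walk P (standardized P X) ?\<kappa> ?K" if P: "P \<in> \<P>" for P
  proof (rule std_walk_standardized)
    show "(\<integral>\<^sup>+ \<omega>. ennreal (\<bar>X 1 \<omega> - ?\<mu> P\<bar> powr (2 + \<delta>)) \<partial>P) \<le> ennreal C"
      using SUP_upper[OF P, of "\<lambda>P. \<integral>\<^sup>+ \<omega>. ennreal (\<bar>X 1 \<omega> - ?\<mu> P\<bar> powr (2 + \<delta>)) \<partial>P"] moment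
      by (simp add: C_def less_top)
  qed (use prob[OF P] iid[OF P] delta v_ge[OF P] var in \<open>auto simp: C_def v0_def\<close>)
  have X_eq: "X i \<omega> = ?\<mu> P + sqrt (?v P) * standardized P X i \<omega>" if "P \<in> \<P>" for P i \<omega>
    using v_pos[OF that] by (simp add: standardized_def)
  have X_meas: "X i \<in> borel_measurable P" if "P \<in> \<P>" "1 \<le> i" for P i
    using rv[OF that(2)] prob[OF that(1)] measurable_cong_sets[of P M borel borel] by auto
  have stats [measurable]: "(\<lambda>\<omega>. \<Sum>i=1..k. standardized P X i \<omega>) \<in> borel_measurable P"
      "(\<lambda>\<omega>. \<Sum>i=1..k. (standardized P X i \<omega>)\<^sup>2) \<in> borel_measurable P"
      "sample_var X k \<in> borel_measurable P" if "P \<in> \<P>" for P k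
    unfolding standardized_def sample_var_def[abs_def] sample_mean_def using X_meas[OF that]
    by (auto intro!: borel_measurable_sum borel_measurable_times borel_measurable_power
        borel_measurable_diff borel_measurable_divide)
  have p_iff: "p_value X m k \<omega> \<le> \<alpha> \<longleftrightarrow> 0 < sample_var X k \<omega> \<and>
      ?b m k * (?Q P k \<omega>)
        \<le> (?S P k \<omega>)\<^sup>2 * (1 + ?b m k / real k)"
    if "P \<in> \<P>\<^sub>0" "1 \<le> m" "m \<le> k" for P m k \<omega>
  proof -
    have PP: "P \<in> \<P>" using that(1) by (simp add: P0)
    have mu: "?\<mu> P = 0" using that(1) by (simp add: P0)
    show ?thesis unfolding q_def
      by (rule p_value_le_iff[where X = X and \<omega> = \<omega> and \<mu> = "?\<mu> P" and v = "?v P"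
            and y = "\<lambda>i. standardized P X i \<omega>", OF v_pos[OF PP] X_eq[OF PP] alpha that(2,3) mu])
  qed
  have c_iff: "?\<mu> P \<notin> conf_set X m k \<alpha> \<omega> \<longleftrightarrow>
      ?b m k * (?Q P k \<omega>)
        < (?S P k \<omega>)\<^sup>2 * (1 + ?b m k / real k)"
    if "P \<in> \<P>" "1 \<le> m" "m \<le> k" for P m k \<omega>
    unfolding q_def
    by (rule not_in_conf_set_iff[where X = X and \<omega> = \<omega> and \<mu> = "?\<mu> P" and v = "?v P"
          and y = "\<lambda>i. standardized P X i \<omega>", OF v_pos[OF that(1)] X_eq[OF that(1)] alpha that(2,3)])
  have "(\<lambda>m. SUP P\<in>\<P>\<^sub>0. measure P {\<omega> \<in> space P. \<exists>k\<ge>m. p_value X m k \<omega> \<le> \<alpha>}) \<longlonglongrightarrow> \<alpha>"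
  proof (rule SUP_tendsto_of_sequences[OF P0_nonempty, where B = 1])
    fix m P assume "P \<in> \<P>\<^sub>0"
    then show "measure P {\<omega> \<in> space P. \<exists>k\<ge>m. p_value X m k \<omega> \<le> \<alpha>} \<le> 1"
      using prob by (intro prob_space.prob_le_1) (auto simp: P0)
  next
    fix P :: "nat \<Rightarrow> 'a measure" assume "\<And>m. P m \<in> \<P>\<^sub>0"
    then have P: "P m \<in> \<P>\<^sub>0" "P m \<in> \<P>" for m by (auto simp: P0)
    have "(\<lambda>m. measure (P m) {\<omega> \<in> space (P m). \<exists>k\<ge>m. p_value X m k \<omega> \<le> \<alpha>}) \<longlonglongrightarrow> gauss_crossing q"
    proof (rule studentized_crossing_limit[where Y = "\<lambda>m. standardized (P m) X" and P = P, OF walk[OF P(2)] q])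
      fix m :: nat assume m: "1 \<le> m"
      have eq: "{\<omega> \<in> space (P m). \<exists>k\<ge>m. p_value X m k \<omega> \<le> \<alpha>} = {\<omega> \<in> space (P m). \<exists>k\<ge>m. 0 < sample_var X k \<omega> \<and>
        ?b m k * (?Q (P m) k \<omega>)
          \<le> (?S (P m) k \<omega>)\<^sup>2 * (1 + ?b m k / real k)}"
        using p_iff[OF P(1) m] by auto
      note [measurable] = stats[OF P(2)[of m]]
      show "{\<omega> \<in> space (P m). \<exists>k\<ge>m. p_value X m k \<omega> \<le> \<alpha>} \<in> sets (P m)"
        unfolding eq by measurable
      show "{\<omega> \<in> space (P m). \<exists>k\<ge>m. p_value X m k \<omega> \<le> \<alpha>} \<subseteq> {\<omega> \<in> space (P m). \<exists>k\<ge>m.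
        ?b m k * (?Q (P m) k \<omega>)
          \<le> (?S (P m) k \<omega>)\<^sup>2 * (1 + ?b m k / real k)}"
        unfolding eq by auto
      fix \<omega> assume \<omega>: "\<omega> \<in> space (P m)"
        and ne: "(?S (P m) m \<omega>)\<^sup>2 \<noteq> real m * (?Q (P m) m \<omega>)"
        and "\<exists>k\<ge>m. ?b m k * (?Q (P m) k \<omega>)
          < (?S (P m) k \<omega>)\<^sup>2 * (1 + ?b m k / real k)"
      then obtain k where k: "m \<le> k" "?b m k * (?Q (P m) k \<omega>)
          < (?S (P m) k \<omega>)\<^sup>2 * (1 + ?b m k / real k)" by blast
      have "0 < sample_var X k \<omega>"
        by (rule sample_var_pos[where X = X and \<omega> = \<omega> and \<mu> = "?\<mu> (P m)" and v = "?v (P m)"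
              and y = "\<lambda>i. standardized (P m) X i \<omega>", OF v_pos[OF P(2)] X_eq[OF P(2)] alpha m k(1) ne])
      then show "\<omega> \<in> {\<omega> \<in> space (P m). \<exists>k\<ge>m. p_value X m k \<omega> \<le> \<alpha>}"
        using p_iff[OF P(1) m k(1)] k \<omega> by (auto intro: less_imp_le)
    qed
    then show "(\<lambda>m. measure (P m) {\<omega> \<in> space (P m). \<exists>k\<ge>m. p_value X m k \<omega> \<le> \<alpha>}) \<longlonglongrightarrow> \<alpha>"
      unfolding limit .
  qed
  moreover have "(\<lambda>m. SUP P\<in>\<P>. measure P {\<omega> \<in> space P. \<exists>k\<ge>m. ?\<mu> P \<notin> conf_set X m k \<alpha> \<omega>}) \<longlonglongrightarrow> \<alpha>"
  proof (rule SUP_tendsto_of_sequences[where B = 1])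
    show "\<P> \<noteq> {}" using P0_nonempty P0 by auto
    fix m P assume "P \<in> \<P>"
    then show "measure P {\<omega> \<in> space P. \<exists>k\<ge>m. ?\<mu> P \<notin> conf_set X m k \<alpha> \<omega>} \<le> 1"
      using prob by (intro prob_space.prob_le_1) auto
  next
    fix P :: "nat \<Rightarrow> 'a measure" assume P: "\<And>m. P m \<in> \<P>"
    have "(\<lambda>m. measure (P m) {\<omega> \<in> space (P m). \<exists>k\<ge>m. ?\<mu> (P m) \<notin> conf_set X m k \<alpha> \<omega>}) \<longlonglongrightarrow> gauss_crossing q"
    proof (rule studentized_crossing_limit[where Y = "\<lambda>m. standardized (P m) X" and P = P, OF walk[OF P] q])
      fix m :: nat assume m: "1 \<le> m"
      have eq: "{\<omega> \<in> space (P m). \<exists>k\<ge>m. ?\<mu> (P m) \<notin> conf_set X m k \<alpha> \<omega>} = {\<omega> \<in> space (P m). \<exists>k\<ge>m.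
        ?b m k * (?Q (P m) k \<omega>)
          < (?S (P m) k \<omega>)\<^sup>2 * (1 + ?b m k / real k)}"
        using c_iff[OF P m] by auto
      note [measurable] = stats[OF P[of m]]
      show "{\<omega> \<in> space (P m). \<exists>k\<ge>m. ?\<mu> (P m) \<notin> conf_set X m k \<alpha> \<omega>} \<in> sets (P m)"
        unfolding eq by measurable
      show "{\<omega> \<in> space (P m). \<exists>k\<ge>m. ?\<mu> (P m) \<notin> conf_set X m k \<alpha> \<omega>} \<subseteq> {\<omega> \<in> space (P m). \<exists>k\<ge>m.
        ?b m k * (?Q (P m) k \<omega>)
          \<le> (?S (P m) k \<omega>)\<^sup>2 * (1 + ?b m k / real k)}"
        unfolding eq by (auto intro: less_imp_le)
      fix \<omega> assume "\<omega> \<in> space (P m)"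
        and "\<exists>k\<ge>m. ?b m k * (?Q (P m) k \<omega>)
          < (?S (P m) k \<omega>)\<^sup>2 * (1 + ?b m k / real k)"
      then show "\<omega> \<in> {\<omega> \<in> space (P m). \<exists>k\<ge>m. ?\<mu> (P m) \<notin> conf_set X m k \<alpha> \<omega>}"
        unfolding eq by simp
    qed
    then show "(\<lambda>m. measure (P m) {\<omega> \<in> space (P m). \<exists>k\<ge>m. ?\<mu> (P m) \<notin> conf_set X m k \<alpha> \<omega>}) \<longlonglongrightarrow> \<alpha>"
      unfolding limit .
  qed
  ultimately show ?thesis by simp
qed

end
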